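(* For $\omega\in\Omega^1(K)$, one has $\int_e\omega=0$ for all $e\in E_*$ if and only if $Q[\omega]=0$; that is, $Q^{1/2}$ is a norm on $\Omega^1(K)$. Therefore $\Omega^1(K)$ coincides with $\Omega^1(\mathcal F)/\{Q=0\}\subset\mathcal H$ (equivalently, for $\omega\in\Omega^1(\mathcal F)$, all edge integrals $\int_e\omega$, $e\in E_*$, vanish if and only if $Q[\omega]=0$), $Q^{1/2}$ coincides with $\|\cdot\|_{\mathcal H}$ on $\Omega^1(K)$, and $\Omega^1(K)$ is dense in $\mathcal H$.
   Context: Sierpinski gasket: $p_0=(0,0)$, $p_1=(\frac12,\frac{\sqrt3}2)$, $p_2=(1,0)$, $w_i(x)=p_i+\frac12(x-p_i)$, and $K\subset\mathbb R^2$ is the unique nonempty compact set with $K=\bigcup_{i=0}^2w_i(K)$. For a word $\sigma\in\{0,1,2\}^m$, $|\sigma|=m$ and $w_\sigma=w_{\sigma_1}\circ\dots\circ w_{\sigma_m}$. $E_0$ is the set of the three sides of the triangle $p_0p_1p_2$, $E_m=\bigcup_{|\sigma|=m}w_\sigma(E_0)$ (edges of level $m$), $E_*=\bigcup_mE_m$. An oriented edge $e$ has source $e_-$ and target $e_+$. Energy: for real-valued $f\in C(K)$, $\mathcal E[f]=\lim_{m}(5/3)^m\sum_{e\in E_m}|f(e_+)-f(e_-)|^2$, and $\mathcal F=\{f\in C(K):\mathcal E[f]<\infty\}$, a subalgebra of $C(K)$; $\mathcal E(\cdot,\cdot)$ is the associated bilinear form. For $f,g\in\mathcal F$ the energy measure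 $\mu(f,g)$ is the finite Radon measure on $K$ with $\int_Kh\,d\mu(f,g)=\frac12\big(\mathcal E(f,gh)-\mathcal E(fg,h)+\mathcal E(hf,g)\big)$, $h\in\mathcal F$. Universal 1-forms: for $f\in\mathcal F$, $df=f\otimes1-1\otimes f$; $\Omega^1(\mathcal F)\subset\mathcal F\otimes\mathcal F$ (algebraic tensor product) is the sub-$\mathcal F$-bimodule generated by the elements $f\,dg$, with actions $f(a\otimes b)=fa\otimes b$, $(a\otimes b)f=a\otimes bf$. $Q$ is the positive semidefinite form on $\Omega^1(\mathcal F)$ obtained by bilinear extension of $Q(f\,dg,h\,dk)=\int_Kfh\,d\mu(g,k)$; $Q[\omega]=Q(\omega,\omega)$. $\mathcal H$ is the Hilbert space obtained from $(\Omega^1(\mathcal F),Q)$ by separation and completion. Integral: for an oriented edge $e\in E_*$ and $\omega=\sum_if_i\,dg_i$, $\int_e\omega=\lim_n\sum_{e'\in E_n,\,e'\subset e}\sum_if_i(e'_+)(g_i(e'_+)-g_i(e'_-))$, where the $e'$ are oriented as $e$; the limit exists. Smooth 1-forms: $\Omega^1(K)=\Omega^1(\mathcal F)/\!\sim$, where $\omega\sim\omega'$ iff $\int_e(\omega-\omega')=0$ for all $e\in E_*$. $Q$ is well defined on $\Omega^1(K)$, since $Q[\omega]=\lim_n(5/3)^n\sum_{e\in E_n}|\int_e\omega|^2$. *)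

theory Defs
  imports "HOL-Analysis.Analysis" "HOL-Library.Function_Algebras"
begin

text \<open>
  Pointwise scalar multiplication. Together with the pointwise ring operations of
  \<^theory>\<open>HOL-Library.Function_Algebras\<close> it lets \<^const>\<open>subspace\<close>, \<^const>\<open>span\<close> etc. be used for sets
  of functions, and for sets of sequences of functions.
\<close>

instantiation "fun" :: (type, scaleR) scaleR
begin

definition scaleR_fun_def: "c *\<^sub>R f = (\<lambda>x. c *\<^sub>R f x)"

instance ..

end

lemma scaleR_fun_apply [simp]: "(c *\<^sub>R f) x = c *\<^sub>R f x"
  by (simp add: scaleR_fun_def)

instance "fun" :: (type, real_vector) real_vector
  by standard (simp_all add: fun_eq_iff scaleR_add_right scaleR_add_left)

type_synonym pt = "real ^ 2"


section \<open>The gasket and its edges\<close>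

definition corner :: "nat \<Rightarrow> pt" where
  "corner i = (if i = 0 then vector [0, 0]
               else if i = 1 then vector [1 / 2, sqrt 3 / 2]
               else vector [1, 0])"

definition contraction :: "nat \<Rightarrow> pt \<Rightarrow> pt" where
  "contraction i x = corner i + (1 / 2) *\<^sub>R (x - corner i)"

definition gasket :: "pt set" where
  "gasket = (THE K. compact K \<and> K \<noteq> {} \<and> K = (\<Union>i\<in>{0, 1, 2}. contraction i ` K))"

definition words :: "nat \<Rightarrow> nat list set" where
  "words m = {\<sigma>. length \<sigma> = m \<and> set \<sigma> \<subseteq> {0, 1, 2}}"

definition word_map :: "nat list \<Rightarrow> pt \<Rightarrow> pt" where
  "word_map \<sigma> = foldr (\<lambda>i g. contraction i \<circ> g) \<sigma> id"

definition edges0 :: "pt set set" where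
  "edges0 = {closed_segment (corner 0) (corner 1),
             closed_segment (corner 1) (corner 2),
             closed_segment (corner 2) (corner 0)}"

definition edges :: "nat \<Rightarrow> pt set set" where
  "edges m = (\<Union>\<sigma>\<in>words m. (\<lambda>s. word_map \<sigma> ` s) ` edges0)"

text \<open>
  An oriented edge is the pair (source, target) of its end points. Each edge of level \<open>m\<close>
  yields exactly two oriented edges.
\<close>

definition oriented_edges :: "nat \<Rightarrow> (pt \<times> pt) set" where
  "oriented_edges m = {(a, b). closed_segment a b \<in> edges m}"

definition all_oriented_edges :: "(pt \<times> pt) set" where
  "all_oriented_edges = (\<Union>m. oriented_edges m)"

definition subedges :: "nat \<Rightarrow> pt \<times> pt \<Rightarrow> (pt \<times> pt) set" where
  "subedges n e = {(a, b) \<in> oriented_edges n.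
     closed_segment a b \<subseteq> closed_segment (fst e) (snd e) \<and>
     (\<exists>c>0. b - a = c *\<^sub>R (snd e - fst e))}"


section \<open>Energy and energy measures\<close>

text \<open>
  A function on the gasket is represented by its extension by zero to the plane, so that
  equality of representatives is equality on the gasket. The unit of the algebra is thus the
  indicator of the gasket.
\<close>

definition gasket_continuous :: "(pt \<Rightarrow> real) set" where
  "gasket_continuous = {f. continuous_on gasket f \<and> (\<forall>x. x \<notin> gasket \<longrightarrow> f x = 0)}"

definition gasket_one :: "pt \<Rightarrow> real" where
  "gasket_one = indicator gasket"

text \<open>
  The summand does not depend on the orientation of the edge; the factor \<open>1/2\<close>
  compensates for counting both orientations.
\<close>

definition level_energy :: "nat \<Rightarrow> (pt \<Rightarrow> real) \<Rightarrow> real" where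
  "level_energy m f = (5 / 3) ^ m * ((1 / 2) * (\<Sum>(a, b)\<in>oriented_edges m. (f b - f a)\<^sup>2))"

definition energy :: "(pt \<Rightarrow> real) \<Rightarrow> ereal" where
  "energy f = lim (\<lambda>m. ereal (level_energy m f))"

definition finite_energy :: "(pt \<Rightarrow> real) set" where
  "finite_energy = {f \<in> gasket_continuous. energy f < \<infinity>}"

definition energy_form :: "(pt \<Rightarrow> real) \<Rightarrow> (pt \<Rightarrow> real) \<Rightarrow> real" where
  "energy_form f g = (real_of_ereal (energy (f + g)) - real_of_ereal (energy (f - g))) / 4"

text \<open>
  A finite signed Borel measure on the gasket is a set function that is the difference of two
  finite (positive) Borel measures. The integral does not depend on the two measures
  chosen.
\<close>

definition difference_of_measures ::
  "(pt set \<Rightarrow> real) \<Rightarrow> pt measure \<Rightarrow> pt measure \<Rightarrow> bool" where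
  "difference_of_measures \<nu> M N \<longleftrightarrow>
     finite_measure M \<and> sets M = sets (restrict_space borel gasket) \<and>
     finite_measure N \<and> sets N = sets (restrict_space borel gasket) \<and>
     \<nu> = (\<lambda>A. measure M A - measure N A)"

definition signed_measure :: "(pt set \<Rightarrow> real) \<Rightarrow> bool" where
  "signed_measure \<nu> \<longleftrightarrow> (\<exists>M N. difference_of_measures \<nu> M N)"

definition signed_integral :: "(pt set \<Rightarrow> real) \<Rightarrow> (pt \<Rightarrow> real) \<Rightarrow> real" where
  "signed_integral \<nu> h =
     (THE I. \<exists>M N. difference_of_measures \<nu> M N \<and> I = (\<integral>x. h x \<partial>M) - (\<integral>x. h x \<partial>N))"

text \<open>
  The measure selected here is unique, since the functions of finite energy are uniformly dense
  in the continuous functions on the gasket.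
\<close>

definition energy_measure :: "(pt \<Rightarrow> real) \<Rightarrow> (pt \<Rightarrow> real) \<Rightarrow> pt set \<Rightarrow> real" where
  "energy_measure f g = (SOME \<nu>. signed_measure \<nu> \<and>
     (\<forall>h\<in>finite_energy. signed_integral \<nu> h =
        (1 / 2) * (energy_form f (g * h) - energy_form (f * g) h + energy_form (h * f) g)))"


section \<open>Universal 1-forms\<close>

text \<open>
  The algebraic tensor square of a space of functions is realised as the span of the product
  functions \<open>(x, y) \<mapsto> f x * g y\<close>. Lemma \<open>tensor_universal\<close> below is the nontrivial half of the
  universal property for this realisation.
\<close>

definition tensor :: "('a \<Rightarrow> real) \<Rightarrow> ('b \<Rightarrow> real) \<Rightarrow> 'a \<times> 'b \<Rightarrow> real"  (infixr \<open>\<otimes>\<^sub>f\<close> 72) where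
  "f \<otimes>\<^sub>f g = (\<lambda>(x, y). f x * g y)"

lemma tensor_universal:
  fixes B :: "('a \<Rightarrow> real) \<Rightarrow> ('b \<Rightarrow> real) \<Rightarrow> 'v::real_vector"
  assumes F: "subspace F" and G: "subspace G"
    and add_left: "\<And>f f' g. f \<in> F \<Longrightarrow> f' \<in> F \<Longrightarrow> g \<in> G \<Longrightarrow> B (f + f') g = B f g + B f' g"
    and scale_left: "\<And>c f g. f \<in> F \<Longrightarrow> g \<in> G \<Longrightarrow> B (c *\<^sub>R f) g = c *\<^sub>R B f g"
    and add_right: "\<And>f g g'. f \<in> F \<Longrightarrow> g \<in> G \<Longrightarrow> g' \<in> G \<Longrightarrow> B f (g + g') = B f g + B f g'"
    and scale_right: "\<And>c f g. f \<in> F \<Longrightarrow> g \<in> G \<Longrightarrow> B f (c *\<^sub>R g) = c *\<^sub>R B f g"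
    and mem: "\<And>i. i < (n::nat) \<Longrightarrow> f i \<in> F \<and> g i \<in> G"
    and zero: "(\<Sum>i<n. f i \<otimes>\<^sub>f g i) = 0"
  shows "(\<Sum>i<n. B (f i) (g i)) = 0"
  using mem zero
proof (induction n arbitrary: g)
  case 0
  then show ?case by simp
next
  case (Suc n)
  have ev: "(\<Sum>i<Suc n. f i x * g i y) = 0" for x y
  proof -
    have "(\<Sum>i<k. f i \<otimes>\<^sub>f g i) (x, y) = (\<Sum>i<k. f i x * g i y)" for k
      by (induction k) (simp_all add: tensor_def)
    with Suc.prems(2) show ?thesis by (metis zero_fun_apply)
  qed
  have fn: "f n \<in> F" and gn: "g n \<in> G" using Suc.prems(1) by auto
  show ?case
  proof (cases "g n = 0")
    case True
    have "B (f n) (g n) = 0"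
      using scale_right[OF fn gn, of 0] True by simp
    moreover have "(\<Sum>i<n. B (f i) (g i)) = 0"
    proof (rule Suc.IH)
      show "(\<Sum>i<n. f i \<otimes>\<^sub>f g i) = 0"
        using Suc.prems(2) True by (simp add: tensor_def fun_eq_iff)
    qed (use Suc.prems(1) in auto)
    ultimately show ?thesis by simp
  next
    case False
    then obtain y0 where y0: "g n y0 \<noteq> 0" by (auto simp: fun_eq_iff)
    define c where "c i = - g i y0 / g n y0" for i
    define g' where "g' i = g i + c i *\<^sub>R g n" for i
    have fnx: "f n x = (\<Sum>i<n. c i * f i x)" for x
    proof -
      have "f n x * g n y0 = - (\<Sum>i<n. f i x * g i y0)"
        using ev[where x=x and y=y0] by simp
      then have "f n x = - (\<Sum>i<n. f i x * g i y0) / g n y0"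
        using y0 by (simp add: field_simps)
      also have "\<dots> = (\<Sum>i<n. c i * f i x)"
        by (simp add: c_def sum_divide_distrib sum_negf mult.commute)
      finally show ?thesis .
    qed
    have fn_eq: "f n = (\<Sum>i<n. c i *\<^sub>R f i)"
    proof
      fix x
      have "(\<Sum>i<k. c i *\<^sub>R f i) x = (\<Sum>i<k. c i * f i x)" for k
        by (induction k) simp_all
      then show "f n x = (\<Sum>i<n. c i *\<^sub>R f i) x" using fnx by simp
    qed
    have "(\<Sum>i<n. B (f i) (g' i)) = 0"
    proof (rule Suc.IH)
      show "f i \<in> F \<and> g' i \<in> G" if "i < n" for i
        using Suc.prems(1)[of i] that gn G
        by (auto simp: g'_def intro: subspace_add subspace_scale)
      show "(\<Sum>i<n. f i \<otimes>\<^sub>f g' i) = 0"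
      proof
        fix z :: "'a \<times> 'b"
        obtain x y where z: "z = (x, y)" by (cases z)
        have "(\<Sum>i<k. f i \<otimes>\<^sub>f g' i) (x, y) = (\<Sum>i<k. f i x * g' i y)" for k
          by (induction k) (simp_all add: tensor_def)
        then have "(\<Sum>i<n. f i \<otimes>\<^sub>f g' i) (x, y) = (\<Sum>i<n. f i x * g' i y)" .
        also have "\<dots> = (\<Sum>i<n. f i x * g i y) + (\<Sum>i<n. c i * f i x) * g n y"
          by (simp add: g'_def algebra_simps sum.distrib sum_distrib_left)
        also have "\<dots> = (\<Sum>i<Suc n. f i x * g i y)"
          using fnx by simp
        finally show "(\<Sum>i<n. f i \<otimes>\<^sub>f g' i) z = 0 z" using ev z by simp
      qed
    qed
    moreover have "(\<Sum>i<n. B (f i) (g' i)) = (\<Sum>i<n. B (f i) (g i)) + (\<Sum>i<n. c i *\<^sub>R B (f i) (g n))"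
    proof -
      have "B (f i) (g' i) = B (f i) (g i) + c i *\<^sub>R B (f i) (g n)" if "i < n" for i
        using Suc.prems(1)[of i] that gn G
        by (simp add: g'_def add_right scale_right subspace_scale)
      then show ?thesis by (simp add: sum.distrib)
    qed
    moreover have "B (f n) (g n) = (\<Sum>i<n. c i *\<^sub>R B (f i) (g n))"
    proof -
      have "(\<Sum>i<k. c i *\<^sub>R f i) \<in> F \<and>
            B (\<Sum>i<k. c i *\<^sub>R f i) (g n) = (\<Sum>i<k. c i *\<^sub>R B (f i) (g n))" if "k \<le> n" for k
        using that
      proof (induction k)
        case 0
        have "B 0 (g n) = 0" using scale_left[OF fn gn, of 0] by simp
        then show ?case using subspace_0[OF F] unfolding lessThan_0 sum.empty by blast
      next
        case (Suc k)
        then have "f k \<in> F" using Suc.prems \<open>\<And>i. i < Suc n \<Longrightarrow> f i \<in> F \<and> g i \<in> G\<close> by auto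
        then have ck: "c k *\<^sub>R f k \<in> F" by (rule subspace_scale[OF F])
        have IH: "(\<Sum>i<k. c i *\<^sub>R f i) \<in> F"
            "B (\<Sum>i<k. c i *\<^sub>R f i) (g n) = (\<Sum>i<k. c i *\<^sub>R B (f i) (g n))"
          using Suc.IH Suc.prems Suc_leD by blast+
        show ?case
          unfolding sum.lessThan_Suc add_left[OF IH(1) ck gn] scale_left[OF \<open>f k \<in> F\<close> gn] IH(2)
          using subspace_add[OF F IH(1) ck] by blast
      qed
      then show ?thesis using fn_eq by auto
    qed
    ultimately show ?thesis by simp
  qed
qed

definition tensor_square :: "(pt \<times> pt \<Rightarrow> real) set" where
  "tensor_square = span {f \<otimes>\<^sub>f g |f g. f \<in> finite_energy \<and> g \<in> finite_energy}"

definition left_act :: "('a \<Rightarrow> real) \<Rightarrow> ('a \<times> 'b \<Rightarrow> real) \<Rightarrow> 'a \<times> 'b \<Rightarrow> real" where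
  "left_act f \<omega> = (\<lambda>(x, y). f x * \<omega> (x, y))"

definition right_act :: "('a \<times> 'b \<Rightarrow> real) \<Rightarrow> ('b \<Rightarrow> real) \<Rightarrow> 'a \<times> 'b \<Rightarrow> real" where
  "right_act \<omega> f = (\<lambda>(x, y). \<omega> (x, y) * f y)"

definition univ_d :: "(pt \<Rightarrow> real) \<Rightarrow> pt \<times> pt \<Rightarrow> real" where
  "univ_d f = f \<otimes>\<^sub>f gasket_one - gasket_one \<otimes>\<^sub>f f"

definition sub_bimodule :: "(pt \<times> pt \<Rightarrow> real) set \<Rightarrow> bool" where
  "sub_bimodule S \<longleftrightarrow> S \<subseteq> tensor_square \<and> subspace S \<and>
     (\<forall>f\<in>finite_energy. \<forall>\<omega>\<in>S. left_act f \<omega> \<in> S \<and> right_act \<omega> f \<in> S)"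

definition univ_forms :: "(pt \<times> pt \<Rightarrow> real) set" where
  "univ_forms = sub_bimodule hull
     {left_act f (univ_d g) |f g. f \<in> finite_energy \<and> g \<in> finite_energy}"

text \<open>
  By the Leibniz rule every universal 1-form is a finite sum of forms \<open>f dg\<close>;
  \<open>represents n f g \<omega>\<close> says that \<open>\<omega>\<close> is the sum of the \<open>n\<close> forms \<open>f i dg i\<close>. The form \<open>Q\<close> and
  the edge integrals below do not depend on the representation.
\<close>

definition represents ::
  "nat \<Rightarrow> (nat \<Rightarrow> pt \<Rightarrow> real) \<Rightarrow> (nat \<Rightarrow> pt \<Rightarrow> real) \<Rightarrow> (pt \<times> pt \<Rightarrow> real) \<Rightarrow> bool" where
  "represents n f g \<omega> \<longleftrightarrow> (\<forall>i<n. f i \<in> finite_energy \<and> g i \<in> finite_energy) \<and>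
     \<omega> = (\<Sum>i<n. left_act (f i) (univ_d (g i)))"

definition Q_form :: "(pt \<times> pt \<Rightarrow> real) \<Rightarrow> (pt \<times> pt \<Rightarrow> real) \<Rightarrow> real" where
  "Q_form \<omega> \<eta> = (THE q. \<exists>n f g m h k. represents n f g \<omega> \<and> represents m h k \<eta> \<and>
     q = (\<Sum>i<n. \<Sum>j<m. signed_integral (energy_measure (g i) (k j)) (f i * h j)))"

definition edge_integral :: "pt \<times> pt \<Rightarrow> (pt \<times> pt \<Rightarrow> real) \<Rightarrow> real" where
  "edge_integral e \<omega> = (THE I. \<exists>n f g. represents n f g \<omega> \<and>
     (\<lambda>l. \<Sum>(a, b)\<in>subedges l e. \<Sum>i<n. f i b * (g i b - g i a)) \<longlonglongrightarrow> I)"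


section \<open>Quotients and completions\<close>

definition quot_zero :: "('a::real_vector \<times> 'a) set \<Rightarrow> 'a set" where
  "quot_zero R = R `` {0}"

definition quot_add :: "('a::real_vector \<times> 'a) set \<Rightarrow> 'a set \<Rightarrow> 'a set \<Rightarrow> 'a set" where
  "quot_add R X Y = (\<Union>x\<in>X. \<Union>y\<in>Y. R `` {x + y})"

definition quot_scale :: "('a::real_vector \<times> 'a) set \<Rightarrow> real \<Rightarrow> 'a set \<Rightarrow> 'a set" where
  "quot_scale R c X = (\<Union>x\<in>X. R `` {c *\<^sub>R x})"

definition norm_on_quotient :: "'a::real_vector set \<Rightarrow> ('a \<times> 'a) set \<Rightarrow> ('a set \<Rightarrow> real) \<Rightarrow> bool" where
  "norm_on_quotient V R N \<longleftrightarrow>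
     (\<forall>X\<in>V // R. 0 \<le> N X \<and> (N X = 0 \<longleftrightarrow> X = quot_zero R)) \<and>
     (\<forall>X\<in>V // R. \<forall>c. N (quot_scale R c X) = \<bar>c\<bar> * N X) \<and>
     (\<forall>X\<in>V // R. \<forall>Y\<in>V // R. N (quot_add R X Y) \<le> N X + N Y)"

definition null_rel :: "'a::real_vector set \<Rightarrow> ('a \<Rightarrow> 'a \<Rightarrow> real) \<Rightarrow> ('a \<times> 'a) set" where
  "null_rel V q = {(x, y). x \<in> V \<and> y \<in> V \<and> q (x - y) (x - y) = 0}"

text \<open>
  The Hilbert space obtained from a space \<open>V\<close> with a positive semidefinite form \<open>q\<close> by separation
  and completion: Cauchy sequences in \<open>V\<close> modulo sequences tending to zero, both with respect
  to the seminorm of \<open>q\<close>. The vector space operations are \<open>quot_add\<close> and \<open>quot_scale\<close> for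
  the relation \<open>completion_rel V q\<close>.
\<close>

definition cauchy_seqs :: "'a::real_vector set \<Rightarrow> ('a \<Rightarrow> 'a \<Rightarrow> real) \<Rightarrow> (nat \<Rightarrow> 'a) set" where
  "cauchy_seqs V q = {s. (\<forall>n. s n \<in> V) \<and>
     (\<forall>\<epsilon>>0. \<exists>N. \<forall>m\<ge>N. \<forall>n\<ge>N. sqrt (q (s m - s n) (s m - s n)) < \<epsilon>)}"

definition completion_rel ::
  "'a::real_vector set \<Rightarrow> ('a \<Rightarrow> 'a \<Rightarrow> real) \<Rightarrow> ((nat \<Rightarrow> 'a) \<times> (nat \<Rightarrow> 'a)) set" where
  "completion_rel V q = {(s, t). s \<in> cauchy_seqs V q \<and> t \<in> cauchy_seqs V q \<and>
     (\<lambda>n. sqrt (q (s n - t n) (s n - t n))) \<longlonglongrightarrow> 0}"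

definition hilbert_completion ::
  "'a::real_vector set \<Rightarrow> ('a \<Rightarrow> 'a \<Rightarrow> real) \<Rightarrow> (nat \<Rightarrow> 'a) set set" where
  "hilbert_completion V q = cauchy_seqs V q // completion_rel V q"

definition completion_inner ::
  "('a::real_vector \<Rightarrow> 'a \<Rightarrow> real) \<Rightarrow> (nat \<Rightarrow> 'a) set \<Rightarrow> (nat \<Rightarrow> 'a) set \<Rightarrow> real" where
  "completion_inner q X Y = (THE l. \<exists>s\<in>X. \<exists>t\<in>Y. (\<lambda>n. q (s n) (t n)) \<longlonglongrightarrow> l)"

definition completion_norm :: "('a::real_vector \<Rightarrow> 'a \<Rightarrow> real) \<Rightarrow> (nat \<Rightarrow> 'a) set \<Rightarrow> real" where
  "completion_norm q X = sqrt (completion_inner q X X)"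

text \<open>The canonical map, on classes of elements of \<open>V\<close>: constant sequences.\<close>

definition completion_embed ::
  "'a::real_vector set \<Rightarrow> ('a \<Rightarrow> 'a \<Rightarrow> real) \<Rightarrow> 'a set \<Rightarrow> (nat \<Rightarrow> 'a) set" where
  "completion_embed V q X = (\<Union>x\<in>X. completion_rel V q `` {\<lambda>_. x})"


section \<open>Smooth 1-forms\<close>

definition smooth_rel :: "((pt \<times> pt \<Rightarrow> real) \<times> (pt \<times> pt \<Rightarrow> real)) set" where
  "smooth_rel = {(\<omega>, \<omega>'). \<omega> \<in> univ_forms \<and> \<omega>' \<in> univ_forms \<and>
     (\<forall>e\<in>all_oriented_edges. edge_integral e (\<omega> - \<omega>') = 0)}"

definition smooth_forms :: "(pt \<times> pt \<Rightarrow> real) set set" where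
  "smooth_forms = univ_forms // smooth_rel"

definition smooth_edge_integral :: "pt \<times> pt \<Rightarrow> (pt \<times> pt \<Rightarrow> real) set \<Rightarrow> real" where
  "smooth_edge_integral e X = (THE I. \<exists>\<omega>\<in>X. I = edge_integral e \<omega>)"

definition smooth_Q :: "(pt \<times> pt \<Rightarrow> real) set \<Rightarrow> (pt \<times> pt \<Rightarrow> real) set \<Rightarrow> real" where
  "smooth_Q X Y = (THE q. \<exists>\<omega>\<in>X. \<exists>\<eta>\<in>Y. q = Q_form \<omega> \<eta>)"

abbreviation form_space :: "(nat \<Rightarrow> pt \<times> pt \<Rightarrow> real) set set" where
  "form_space \<equiv> hilbert_completion univ_forms Q_form"

abbreviation form_space_rel :: "((nat \<Rightarrow> pt \<times> pt \<Rightarrow> real) \<times> (nat \<Rightarrow> pt \<times> pt \<Rightarrow> real)) set" where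
  "form_space_rel \<equiv> completion_rel univ_forms Q_form"

abbreviation form_space_diff ::
  "(nat \<Rightarrow> pt \<times> pt \<Rightarrow> real) set \<Rightarrow> (nat \<Rightarrow> pt \<times> pt \<Rightarrow> real) set \<Rightarrow> (nat \<Rightarrow> pt \<times> pt \<Rightarrow> real) set" where
  "form_space_diff X Y \<equiv> quot_add form_space_rel X (quot_scale form_space_rel (- 1) Y)"

abbreviation form_norm :: "(nat \<Rightarrow> pt \<times> pt \<Rightarrow> real) set \<Rightarrow> real" where
  "form_norm \<equiv> completion_norm Q_form"

abbreviation embed_form :: "(pt \<times> pt \<Rightarrow> real) set \<Rightarrow> (nat \<Rightarrow> pt \<times> pt \<Rightarrow> real) set" where
  "embed_form \<equiv> completion_embed univ_forms Q_form"

end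

theory Submission
  imports Defs
begin

text \<open>
  On an edge \<open>(a, b)\<close> the form \<open>\<omega> = \<Sum> f\<^sub>i dg\<^sub>i\<close> takes the value
  \<open>\<omega>(b, a) = \<Sum> f\<^sub>i(b) (g\<^sub>i(b) - g\<^sub>i(a))\<close>, and \<open>Q(\<omega>, \<eta>)\<close> is the limit of
  \<open>(5/3)\<^sup>n \<Sum> \<omega>(b, a) \<eta>(b, a)\<close> over the edges of level \<open>n\<close>. On an edge of a cell of level \<open>n\<close>
  the edge integral differs from this value by at most a multiple of \<open>(3/5)\<^sup>n\<close> times the energies
  of the \<open>f\<^sub>i\<close>, \<open>g\<^sub>i\<close> on the cell. As these energies are additive over cells, vanishing edge
  integrals force \<open>Q[\<omega>] = 0\<close>. Conversely, on a cell of level \<open>n\<close> the form \<open>\<omega>\<close> is close to the exact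
  form \<open>dG\<close>, \<open>G = \<Sum> f\<^sub>i(b) g\<^sub>i\<close>, because a function of finite energy oscillates there by at most a
  multiple of \<open>((3/5)\<^sup>n m)\<^sup>1\<^sup>/\<^sup>2\<close>, where \<open>m\<close> is its energy on the cell. If \<open>Q[\<omega>] = 0\<close>, the energy of
  \<open>G\<close> on the cell is therefore of order \<open>(3/5)\<^sup>n\<close> times a product of cell energies; since discrete
  energies of functions increase with the level, the values \<open>\<omega>(b, a)\<close> are of order \<open>(3/5)\<^sup>n\<close>
  times the cell energies, and their sum over the edges of level \<open>n\<close> tends to zero.
\<close>

section \<open>Quotients and completions of semi-inner product spaces\<close>

text \<open>Why \<open>Q[\<omega>] = 0\<close> does not yield vanishing integrals at once: it says
  that (5/3)^n times the sum of the squares \<omega>(b, a)^2 tends to zero, but an edge has 2^n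
  subedges n levels further down, and Cauchy-Schwarz leaves the divergent factor 2^n (3/5)^n =
  (6/5)^n. Hence the bound on the values themselves, linear in an additive cell energy: summing it
  over the subedges costs nothing and the factor (3/5)^n survives. A bound at one fixed level has to
  be won from a limit over all levels; monotonicity in the level provides this for energies of
  functions, and this is the reason for the detour through an exact form. The definitions are
  descriptions (\<open>THE\<close>, \<open>SOME\<close>). They become usable because \<omega> enters
  all sums over edges only through its values at pairs of points, so that the limits cannot depend
  on a representation. The choice in \<open>energy_measure\<close> calls for an actual measure,
  hence the explicit construction from Lebesgue measure; afterwards it occurs only through integrals
  of functions of finite energy, which are limits of sums over edges.\<close>

definition coset_rel :: "'a::real_vector set \<Rightarrow> 'a set \<Rightarrow> ('a \<times> 'a) set" where
  "coset_rel W K = {(x, y). x \<in> W \<and> y \<in> W \<and> x - y \<in> K}"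

context
  fixes W K :: "'a::real_vector set"
  assumes W: "subspace W" and K: "subspace K"
begin

text \<open>Both \<open>null_rel\<close> (K the null vectors) and \<open>completion_rel\<close> (K
  the null sequences) turn out to be relations of this kind, so the facts on quotient operations are
  proved once for both.\<close>

lemma equiv_coset_rel: "equiv W (coset_rel W K)"
proof (rule equivI)
  show "coset_rel W K \<subseteq> W \<times> W" by (auto simp: coset_rel_def)
  show "refl_on W (coset_rel W K)"
    using subspace_0[OF K] by (auto simp: refl_on_def coset_rel_def)
  show "sym (coset_rel W K)"
  proof (rule symI)
    fix x y assume *: "(x, y) \<in> coset_rel W K"
    then have "- (x - y) \<in> K" unfolding coset_rel_def by (blast intro: subspace_neg[OF K])
    with * show "(y, x) \<in> coset_rel W K" by (simp add: coset_rel_def)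
  qed
  show "trans (coset_rel W K)"
  proof (rule transI)
    fix x y z assume *: "(x, y) \<in> coset_rel W K" "(y, z) \<in> coset_rel W K"
    then have "(x - y) + (y - z) \<in> K"
      unfolding coset_rel_def by (blast intro: subspace_add[OF K])
    with * show "(x, z) \<in> coset_rel W K" by (simp add: coset_rel_def)
  qed
qed

lemma coset_eq_iff:
  assumes "x \<in> W" "y \<in> W"
  shows "coset_rel W K `` {x} = coset_rel W K `` {y} \<longleftrightarrow> x - y \<in> K"
  using eq_equiv_class_iff[OF equiv_coset_rel assms] assms by (simp add: coset_rel_def)

text \<open>\<open>quot_add\<close> is a union over all pairs of representatives. Changing
  representatives changes the sum by an element of K, so every pair contributes the same class and
  the union collapses.\<close>

lemma quot_add_coset:
  assumes "x \<in> W" "y \<in> W"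
  shows "quot_add (coset_rel W K) (coset_rel W K `` {x}) (coset_rel W K `` {y})
    = coset_rel W K `` {x + y}"
proof -
  have "coset_rel W K `` {x' + y'} = coset_rel W K `` {x + y}"
    if "x' \<in> coset_rel W K `` {x}" "y' \<in> coset_rel W K `` {y}" for x' y'
  proof -
    have m: "x' \<in> W" "y' \<in> W" and d: "x - x' \<in> K" "y - y' \<in> K"
      using that by (auto simp: coset_rel_def)
    have "- ((x - x') + (y - y')) \<in> K"
      by (intro subspace_neg[OF K] subspace_add[OF K] d)
    then show ?thesis
      using m assms by (subst coset_eq_iff) (auto simp: algebra_simps intro: subspace_add[OF W])
  qed
  moreover have "x \<in> coset_rel W K `` {x}" "y \<in> coset_rel W K `` {y}"
    using assms subspace_0[OF K] by (auto simp: coset_rel_def)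
  ultimately show ?thesis
    unfolding quot_add_def by fast
qed

lemma quot_scale_coset:
  assumes "x \<in> W"
  shows "quot_scale (coset_rel W K) c (coset_rel W K `` {x}) = coset_rel W K `` {c *\<^sub>R x}"
proof -
  have "coset_rel W K `` {c *\<^sub>R x'} = coset_rel W K `` {c *\<^sub>R x}"
    if "x' \<in> coset_rel W K `` {x}" for x'
  proof -
    have m: "x' \<in> W" and d: "x - x' \<in> K"
      using that by (auto simp: coset_rel_def)
    have "(- c) *\<^sub>R (x - x') \<in> K"
      by (intro subspace_scale[OF K] d)
    then show ?thesis
      using m assms by (subst coset_eq_iff) (auto simp: algebra_simps intro: subspace_scale[OF W])
  qed
  moreover have "x \<in> coset_rel W K `` {x}"
    using assms subspace_0[OF K] by (auto simp: coset_rel_def)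
  ultimately show ?thesis
    unfolding quot_scale_def by fast
qed

end

section \<open>Semi-inner products and the quotient by the null vectors\<close>

locale psd_form =
  fixes V :: "'a::real_vector set" and q :: "'a \<Rightarrow> 'a \<Rightarrow> real"
  assumes V: "subspace V"
    and q_add: "x \<in> V \<Longrightarrow> y \<in> V \<Longrightarrow> z \<in> V \<Longrightarrow> q (x + y) z = q x z + q y z"
    and q_scale: "x \<in> V \<Longrightarrow> z \<in> V \<Longrightarrow> q (c *\<^sub>R x) z = c * q x z"
    and q_sym: "x \<in> V \<Longrightarrow> y \<in> V \<Longrightarrow> q x y = q y x"
    and q_nonneg: "x \<in> V \<Longrightarrow> 0 \<le> q x x"
begin

abbreviation seminorm :: "'a \<Rightarrow> real" where
  "seminorm x \<equiv> sqrt (q x x)"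

lemmas V_mem [simp, intro] = subspace_0[OF V] subspace_add[OF V] subspace_diff[OF V] subspace_scale[OF V]

lemma q_add_right: "x \<in> V \<Longrightarrow> y \<in> V \<Longrightarrow> z \<in> V \<Longrightarrow> q z (x + y) = q z x + q z y"
  by (simp add: q_sym[of z] q_add)

lemma q_scale_right: "x \<in> V \<Longrightarrow> z \<in> V \<Longrightarrow> q z (c *\<^sub>R x) = c * q z x"
  by (simp add: q_sym[of z] q_scale)

lemma q_diff: "x \<in> V \<Longrightarrow> y \<in> V \<Longrightarrow> z \<in> V \<Longrightarrow> q (x - y) z = q x z - q y z"
  using q_add[of x "(-1) *\<^sub>R y" z] q_scale[of y z "-1"] subspace_neg[OF V, of y] by simp

lemma q_diff_right: "x \<in> V \<Longrightarrow> y \<in> V \<Longrightarrow> z \<in> V \<Longrightarrow> q z (x - y) = q z x - q z y"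
  by (simp add: q_sym[of z] q_diff)

text \<open>The usual argument by nonnegativity of the quadratic polynomial q(x - t y, x - t y); the
  form is only semidefinite, so the case q y y = 0 is treated separately.\<close>

lemma q_cauchy_schwarz:
  assumes "x \<in> V" "y \<in> V"
  shows "\<bar>q x y\<bar> \<le> seminorm x * seminorm y"
proof -
  have pos: "0 \<le> q x x - 2 * t * q x y + t\<^sup>2 * q y y" for t
    using q_nonneg[of "x - t *\<^sub>R y"] assms
    by (simp add: q_diff q_diff_right q_scale q_scale_right q_sym[of y x] power2_eq_square algebra_simps)
  have "(q x y)\<^sup>2 \<le> q x x * q y y"
  proof (cases "q y y = 0")
    case True
    have "q x y = 0"
    proof (rule ccontr)
      assume "q x y \<noteq> 0"
      \<comment> \<open>Without quadratic term the polynomial is affine in t; this t gives it the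
        value -1.\<close>
      then show False
        using pos[of "(q x x + 1) / (2 * q x y)"] True by simp
    qed
    then show ?thesis using True by simp
  next
    case False
    then have "0 < q y y" using q_nonneg[OF assms(2)] by simp
    then show ?thesis
      using pos[of "q x y / q y y"] by (simp add: field_simps power2_eq_square)
  qed
  then have "sqrt ((q x y)\<^sup>2) \<le> sqrt (q x x * q y y)" by (rule real_sqrt_le_mono)
  then show ?thesis by (simp add: real_sqrt_mult)
qed

lemma seminorm_triangle:
  assumes "x \<in> V" "y \<in> V"
  shows "seminorm (x + y) \<le> seminorm x + seminorm y"
proof (rule real_le_lsqrt)
  have "q (x + y) (x + y) = q x x + 2 * q x y + q y y"
    using assms by (simp add: q_add q_add_right q_sym[of y x])
  also have "\<dots> \<le> q x x + 2 * (seminorm x * seminorm y) + q y y"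
    using q_cauchy_schwarz[OF assms] by simp
  also have "\<dots> = (seminorm x + seminorm y)\<^sup>2"
    using assms by (simp add: power2_sum q_nonneg)
  finally show "q (x + y) (x + y) \<le> (seminorm x + seminorm y)\<^sup>2" .
  show "0 \<le> seminorm x + seminorm y"
    using assms by (simp add: q_nonneg)
qed

lemma seminorm_scale: "x \<in> V \<Longrightarrow> seminorm (c *\<^sub>R x) = \<bar>c\<bar> * seminorm x"
  by (simp add: q_scale q_scale_right real_sqrt_mult flip: mult.assoc)

lemma seminorm_minus_commute:
  assumes "x \<in> V" "y \<in> V"
  shows "seminorm (x - y) = seminorm (y - x)"
  using seminorm_scale[of "y - x" "-1"] assms by simp

lemma seminorm_diff_le:
  assumes "x \<in> V" "y \<in> V"
  shows "\<bar>seminorm x - seminorm y\<bar> \<le> seminorm (x - y)"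
  using seminorm_triangle[of "x - y" y] seminorm_triangle[of "y - x" x]
    seminorm_minus_commute[of x y] assms by simp

text \<open>Null vectors are orthogonal to everything by Cauchy-Schwarz. This makes them a subspace
  and makes \<open>q\<close> independent of representatives.\<close>

lemma null_q:
  assumes "x \<in> V" "y \<in> V" "q x x = 0"
  shows "q x y = 0"
  using q_cauchy_schwarz[of x y] assms by simp

definition null :: "'a set" where
  "null = {x \<in> V. q x x = 0}"

lemma subspace_null: "subspace null"
  unfolding subspace_def
proof (intro conjI ballI allI)
  show "0 \<in> null" using q_scale[of 0 0 0] by (simp add: null_def)
next
  fix x y assume "x \<in> null" "y \<in> null"
  then show "x + y \<in> null" by (simp add: null_def q_add q_add_right null_q)
next
  fix c x assume "x \<in> null"
  then show "c *\<^sub>R x \<in> null" by (simp add: null_def q_scale q_scale_right)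
qed

lemma null_rel_eq: "null_rel V q = coset_rel V null"
  by (auto simp: null_rel_def coset_rel_def null_def)

lemmas quot_add_null = quot_add_coset[OF V subspace_null, folded null_rel_eq]
  and quot_scale_null = quot_scale_coset[OF V subspace_null, folded null_rel_eq]
  and null_eq_iff = coset_eq_iff[OF V subspace_null, folded null_rel_eq]
  and equiv_null_rel = equiv_coset_rel[OF V subspace_null, folded null_rel_eq]

lemma q_null_rel:
  assumes "(x, x') \<in> null_rel V q" "(y, y') \<in> null_rel V q"
  shows "q x' y' = q x y"
proof -
  have m: "x \<in> V" "x' \<in> V" "y \<in> V" "y' \<in> V" and d: "q (x - x') (x - x') = 0" "q (y - y') (y - y') = 0"
    using assms by (auto simp: null_rel_def)
  have "q (x - x') y = 0" "q (y - y') x' = 0"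
    using null_q m d by auto
  then show ?thesis
    using m by (simp add: q_diff q_sym[of y x'] q_sym[of y' x'])
qed

text \<open>The body is that of \<open>smooth_Q\<close> with a general form, so that
  \<open>smooth_Q\<close> becomes an instance by mere unfolding.\<close>

definition quot_form :: "'a set \<Rightarrow> 'a set \<Rightarrow> real" where
  "quot_form X Y = (THE r. \<exists>x\<in>X. \<exists>y\<in>Y. r = q x y)"

lemma quot_form_class:
  assumes "x \<in> V" "y \<in> V"
  shows "quot_form (null_rel V q `` {x}) (null_rel V q `` {y}) = q x y"
  unfolding quot_form_def
proof (rule the_equality)
  have "x \<in> null_rel V q `` {x}" "y \<in> null_rel V q `` {y}"
    using assms subspace_0[OF subspace_null] by (auto simp: null_rel_eq coset_rel_def)
  then show "\<exists>x'\<in>null_rel V q `` {x}. \<exists>y'\<in>null_rel V q `` {y}. q x y = q x' y'"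
    by blast
qed (auto simp: q_null_rel)

lemma norm_on_quotient_null_rel:
  "norm_on_quotient V (null_rel V q) (\<lambda>X. sqrt (quot_form X X))"
  unfolding norm_on_quotient_def
proof (intro conjI ballI allI)
  let ?R = "null_rel V q"
  fix X assume "X \<in> V // ?R"
  then obtain x where x: "x \<in> V" "X = ?R `` {x}" by (auto elim: quotientE)
  show "0 \<le> sqrt (quot_form X X)"
    using x by (simp add: quot_form_class q_nonneg)
  show "(sqrt (quot_form X X) = 0) = (X = quot_zero ?R)"
    using x null_eq_iff[OF x(1), of 0]
    by (simp add: quot_form_class quot_zero_def) (simp add: null_def)
  show "sqrt (quot_form (quot_scale ?R c X) (quot_scale ?R c X)) = \<bar>c\<bar> * sqrt (quot_form X X)" for c
    using x seminorm_scale[OF x(1)]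
    by (simp add: quot_form_class quot_scale_null)
  fix Y assume "Y \<in> V // ?R"
  then obtain y where y: "y \<in> V" "Y = ?R `` {y}" by (auto elim: quotientE)
  show "sqrt (quot_form (quot_add ?R X Y) (quot_add ?R X Y))
      \<le> sqrt (quot_form X X) + sqrt (quot_form Y Y)"
    using x y seminorm_triangle[OF x(1) y(1)]
    by (simp add: quot_form_class quot_add_null)
qed

section \<open>Completion by Cauchy sequences\<close>

abbreviation "CS \<equiv> cauchy_seqs V q"
abbreviation "CR \<equiv> completion_rel V q"

lemma cauchy_mem: "s \<in> CS \<Longrightarrow> s n \<in> V"
  by (simp add: cauchy_seqs_def)

lemma cauchyD:
  assumes "s \<in> CS" "0 < \<epsilon>"
  shows "\<exists>N. \<forall>m\<ge>N. \<forall>n\<ge>N. seminorm (s m - s n) < \<epsilon>"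
  using assms unfolding cauchy_seqs_def by blast

lemma const_cauchy: "x \<in> V \<Longrightarrow> (\<lambda>_. x) \<in> CS"
  using q_scale[of 0 0 0] by (simp add: cauchy_seqs_def)

lemma subspace_cauchy: "subspace CS"
  unfolding subspace_def
proof (intro conjI ballI allI)
  show "0 \<in> CS" using const_cauchy[of 0] by (simp add: zero_fun_def)
next
  fix s t assume s: "s \<in> CS" and t: "t \<in> CS"
  show "s + t \<in> CS"
    unfolding cauchy_seqs_def
  proof (intro CollectI conjI allI impI)
    show "(s + t) n \<in> V" for n using s t by (auto dest: cauchy_mem)
    fix \<epsilon> :: real assume "0 < \<epsilon>"
    obtain N where N: "\<And>m n. m \<ge> N \<Longrightarrow> n \<ge> N \<Longrightarrow> seminorm (s m - s n) < \<epsilon> / 2"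
      using cauchyD[OF s, of "\<epsilon> / 2"] \<open>0 < \<epsilon>\<close> by auto
    obtain M where M: "\<And>m n. m \<ge> M \<Longrightarrow> n \<ge> M \<Longrightarrow> seminorm (t m - t n) < \<epsilon> / 2"
      using cauchyD[OF t, of "\<epsilon> / 2"] \<open>0 < \<epsilon>\<close> by auto
    have "seminorm ((s + t) m - (s + t) n) < \<epsilon>" if "m \<ge> max N M" "n \<ge> max N M" for m n
    proof -
      have eq: "(s + t) m - (s + t) n = (s m - s n) + (t m - t n)" by simp
      show ?thesis
        unfolding eq using seminorm_triangle[of "s m - s n" "t m - t n"] N[of m n] M[of m n] that
          cauchy_mem[OF s] cauchy_mem[OF t] by simp
    qed
    then show "\<exists>N. \<forall>m\<ge>N. \<forall>n\<ge>N. seminorm ((s + t) m - (s + t) n) < \<epsilon>" by blast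
  qed
next
  fix s c assume s: "s \<in> CS"
  show "c *\<^sub>R s \<in> CS"
    unfolding cauchy_seqs_def
  proof (intro CollectI conjI allI impI)
    show "(c *\<^sub>R s) n \<in> V" for n using s by (auto dest: cauchy_mem)
    fix \<epsilon> :: real assume "0 < \<epsilon>"
    \<comment> \<open>The denominator \<bar>c\<bar> + 1 instead of \<bar>c\<bar> covers c = 0 as
      well.\<close>
    obtain N where N: "\<And>m n. m \<ge> N \<Longrightarrow> n \<ge> N \<Longrightarrow> seminorm (s m - s n) < \<epsilon> / (\<bar>c\<bar> + 1)"
      using cauchyD[OF s, of "\<epsilon> / (\<bar>c\<bar> + 1)"] \<open>0 < \<epsilon>\<close> by auto
    have "seminorm ((c *\<^sub>R s) m - (c *\<^sub>R s) n) < \<epsilon>" if "m \<ge> N" "n \<ge> N" for m n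
    proof -
      have "seminorm ((c *\<^sub>R s) m - (c *\<^sub>R s) n) = \<bar>c\<bar> * seminorm (s m - s n)"
        using seminorm_scale[of "s m - s n" c] cauchy_mem[OF s] by (simp add: scaleR_diff_right)
      also have "\<dots> \<le> \<bar>c\<bar> * (\<epsilon> / (\<bar>c\<bar> + 1))"
        using N[OF that] by (intro mult_left_mono) auto
      also have "\<dots> < \<epsilon>" using \<open>0 < \<epsilon>\<close> by (simp add: field_simps)
      finally show ?thesis .
    qed
    then show "\<exists>N. \<forall>m\<ge>N. \<forall>n\<ge>N. seminorm ((c *\<^sub>R s) m - (c *\<^sub>R s) n) < \<epsilon>" by blast
  qed
qed

definition null_seqs :: "(nat \<Rightarrow> 'a) set" where
  "null_seqs = {s \<in> CS. (\<lambda>n. seminorm (s n)) \<longlonglongrightarrow> 0}"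

lemma subspace_null_seqs: "subspace null_seqs"
  unfolding subspace_def
proof (intro conjI ballI allI)
  show "0 \<in> null_seqs"
    using subspace_0[OF subspace_cauchy] q_scale[of 0 0 0] by (simp add: null_seqs_def)
next
  fix s t assume "s \<in> null_seqs" "t \<in> null_seqs"
  then have st: "s \<in> CS" "t \<in> CS" and lim: "(\<lambda>n. seminorm (s n)) \<longlonglongrightarrow> 0" "(\<lambda>n. seminorm (t n)) \<longlonglongrightarrow> 0"
    by (auto simp: null_seqs_def)
  have "(\<lambda>n. seminorm (s n) + seminorm (t n)) \<longlonglongrightarrow> 0"
    using tendsto_add[OF lim] by simp
  then have "(\<lambda>n. seminorm ((s + t) n)) \<longlonglongrightarrow> 0"
    by (rule real_tendsto_sandwich[OF _ _ tendsto_const, rotated 2])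
      (use st in \<open>auto simp: cauchy_mem seminorm_triangle q_nonneg\<close>)
  then show "s + t \<in> null_seqs"
    using st subspace_add[OF subspace_cauchy] by (simp add: null_seqs_def)
next
  fix s c assume "s \<in> null_seqs"
  then have s: "s \<in> CS" and lim: "(\<lambda>n. seminorm (s n)) \<longlonglongrightarrow> 0"
    by (auto simp: null_seqs_def)
  have "(\<lambda>n. \<bar>c\<bar> * seminorm (s n)) \<longlonglongrightarrow> 0"
    using tendsto_mult_right_zero[OF lim] by simp
  then have "(\<lambda>n. seminorm ((c *\<^sub>R s) n)) \<longlonglongrightarrow> 0"
    using s by (simp add: seminorm_scale cauchy_mem)
  then show "c *\<^sub>R s \<in> null_seqs"
    using s subspace_scale[OF subspace_cauchy] by (simp add: null_seqs_def)
qed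

lemma completion_rel_eq: "CR = coset_rel CS null_seqs"
  by (auto simp: completion_rel_def coset_rel_def null_seqs_def intro: subspace_diff[OF subspace_cauchy])

lemmas quot_add_CR = quot_add_coset[OF subspace_cauchy subspace_null_seqs, folded completion_rel_eq]
  and quot_scale_CR = quot_scale_coset[OF subspace_cauchy subspace_null_seqs, folded completion_rel_eq]
  and CR_eq_iff = coset_eq_iff[OF subspace_cauchy subspace_null_seqs, folded completion_rel_eq]
  and equiv_CR = equiv_coset_rel[OF subspace_cauchy subspace_null_seqs, folded completion_rel_eq]

lemma cauchy_seminorm_convergent:
  assumes "s \<in> CS"
  shows "convergent (\<lambda>n. seminorm (s n))"
proof (rule Cauchy_convergent, rule metric_CauchyI)
  fix \<epsilon> :: real assume "0 < \<epsilon>"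
  from cauchyD[OF assms this] obtain N where N: "\<forall>m\<ge>N. \<forall>n\<ge>N. seminorm (s m - s n) < \<epsilon>" ..
  show "\<exists>M. \<forall>m\<ge>M. \<forall>n\<ge>M. dist (seminorm (s m)) (seminorm (s n)) < \<epsilon>"
    using N seminorm_diff_le cauchy_mem[OF assms] unfolding dist_real_def
    by (meson order_le_less_trans)
qed

text \<open>The inner product is described through arbitrary representatives s', t' of the class.
  The splitting q s s - q s' t' = q (s - s') t' + q (s - t') s and Cauchy-Schwarz bound the
  deviation by null sequences times convergent ones, so all representatives lead to the same
  limit.\<close>

lemma completion_norm_class:
  assumes s: "s \<in> CS" and lim: "(\<lambda>n. seminorm (s n)) \<longlonglongrightarrow> l"
  shows "completion_norm q (CR `` {s}) = l"
proof -
  have l: "0 \<le> l"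
    using lim by (rule LIMSEQ_le_const) (use s in \<open>auto simp: cauchy_mem q_nonneg\<close>)
  have sq: "(\<lambda>n. (seminorm (s n))\<^sup>2) \<longlonglongrightarrow> l\<^sup>2"
    by (intro tendsto_intros lim)
  have key: "(\<lambda>n. q (s' n) (t' n)) \<longlonglongrightarrow> l\<^sup>2" if s': "s' \<in> CR `` {s}" and t': "t' \<in> CR `` {s}" for s' t'
  proof -
    have s'C: "s' \<in> CS" and t'C: "t' \<in> CS"
      and ds: "(\<lambda>n. seminorm (s n - s' n)) \<longlonglongrightarrow> 0" and dt: "(\<lambda>n. seminorm (s n - t' n)) \<longlonglongrightarrow> 0"
      using that by (auto simp: completion_rel_def)
    obtain lt where lt: "(\<lambda>n. seminorm (t' n)) \<longlonglongrightarrow> lt"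
      using cauchy_seminorm_convergent[OF t'C] by (auto simp: convergent_def)
    have "(\<lambda>n. seminorm (s n - s' n) * seminorm (t' n) + seminorm (s n - t' n) * seminorm (s n)) \<longlonglongrightarrow> 0 * lt + 0 * l"
      by (intro tendsto_intros ds dt lt lim)
    then have bound: "(\<lambda>n. seminorm (s n - s' n) * seminorm (t' n) + seminorm (s n - t' n) * seminorm (s n)) \<longlonglongrightarrow> 0"
      by simp
    have "(\<lambda>n. q (s n) (s n) - q (s' n) (t' n)) \<longlonglongrightarrow> 0"
    proof (rule Lim_null_comparison[OF _ bound])
      show "\<forall>\<^sub>F n in sequentially. norm (q (s n) (s n) - q (s' n) (t' n))
        \<le> seminorm (s n - s' n) * seminorm (t' n) + seminorm (s n - t' n) * seminorm (s n)"
      proof (intro always_eventually allI)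
        fix n
        have m: "s n \<in> V" "s' n \<in> V" "t' n \<in> V" using s s'C t'C by (auto dest: cauchy_mem)
        have "q (s n) (s n) - q (s' n) (t' n) = q (s n - s' n) (t' n) + q (s n - t' n) (s n)"
          using m by (simp add: q_diff q_diff_right q_sym[of "t' n" "s n"])
        then show "norm (q (s n) (s n) - q (s' n) (t' n))
          \<le> seminorm (s n - s' n) * seminorm (t' n) + seminorm (s n - t' n) * seminorm (s n)"
          using q_cauchy_schwarz[of "s n - s' n" "t' n"] q_cauchy_schwarz[of "s n - t' n" "s n"] m
          by (auto intro!: order_trans[OF abs_triangle_ineq] add_mono)
      qed
    qed
    from tendsto_diff[OF sq this] show ?thesis
      using s by (simp add: cauchy_mem q_nonneg)
  qed
  have self: "s \<in> CR `` {s}"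
    using equiv_class_self[OF equiv_CR s] .
  have "completion_inner q (CR `` {s}) (CR `` {s}) = l\<^sup>2"
    unfolding completion_inner_def
  proof (rule the_equality)
    show "\<exists>u\<in>CR `` {s}. \<exists>t\<in>CR `` {s}. (\<lambda>n. q (u n) (t n)) \<longlonglongrightarrow> l\<^sup>2"
      using key self by blast
  next
    fix l' assume "\<exists>u\<in>CR `` {s}. \<exists>t\<in>CR `` {s}. (\<lambda>n. q (u n) (t n)) \<longlonglongrightarrow> l'"
    then show "l' = l\<^sup>2" using key LIMSEQ_unique by blast
  qed
  then show ?thesis using l by (simp add: completion_norm_def)
qed

lemma completion_embed_class:
  assumes "x \<in> V"
  shows "completion_embed V q (null_rel V q `` {x}) = CR `` {\<lambda>_. x}"
proof -
  have "CR `` {\<lambda>_. y} = CR `` {\<lambda>_. x}" if "y \<in> null_rel V q `` {x}" for y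
  proof -
    have y: "y \<in> V" "q (x - y) (x - y) = 0" using that by (auto simp: null_rel_def)
    have "(\<lambda>_. x) - (\<lambda>_. y) \<in> null_seqs"
      using y assms subspace_diff[OF subspace_cauchy const_cauchy const_cauchy, of x y]
      by (simp add: null_seqs_def)
    then show ?thesis
      using CR_eq_iff[of "\<lambda>_. x" "\<lambda>_. y"] y assms const_cauchy by simp
  qed
  moreover have "x \<in> null_rel V q `` {x}"
    using equiv_class_self[OF equiv_null_rel assms] .
  ultimately show ?thesis
    unfolding completion_embed_def by fast
qed

lemma completion_embed_mem:
  "completion_embed V q ` (V // null_rel V q) \<subseteq> hilbert_completion V q"
  unfolding hilbert_completion_def
  by (auto elim!: quotientE simp: completion_embed_class const_cauchy intro!: quotientI)

lemma inj_completion_embed: "inj_on (completion_embed V q) (V // null_rel V q)"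
proof (rule inj_onI)
  fix X Y assume "X \<in> V // null_rel V q" "Y \<in> V // null_rel V q"
    and eq: "completion_embed V q X = completion_embed V q Y"
  then obtain x y where x: "x \<in> V" "X = null_rel V q `` {x}" and y: "y \<in> V" "Y = null_rel V q `` {y}"
    by (auto elim!: quotientE)
  have "(\<lambda>_. x) - (\<lambda>_. y) \<in> null_seqs"
    using eq x y CR_eq_iff[of "\<lambda>_. x" "\<lambda>_. y"] by (simp add: completion_embed_class const_cauchy)
  then have "q (x - y) (x - y) = 0" by (simp add: null_seqs_def LIMSEQ_const_iff)
  then show "X = Y"
    using x y null_eq_iff[of x y] by (simp add: null_def)
qed

lemma completion_embed_add:
  assumes "X \<in> V // null_rel V q" "Y \<in> V // null_rel V q"
  shows "completion_embed V q (quot_add (null_rel V q) X Y)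
    = quot_add CR (completion_embed V q X) (completion_embed V q Y)"
proof -
  obtain x y where x: "x \<in> V" "X = null_rel V q `` {x}" and y: "y \<in> V" "Y = null_rel V q `` {y}"
    using assms by (auto elim!: quotientE)
  then show ?thesis
    by (simp add: quot_add_null completion_embed_class quot_add_CR const_cauchy) (simp add: plus_fun_def)
qed

lemma completion_embed_scale:
  assumes "X \<in> V // null_rel V q"
  shows "completion_embed V q (quot_scale (null_rel V q) c X)
    = quot_scale CR c (completion_embed V q X)"
proof -
  obtain x where x: "x \<in> V" "X = null_rel V q `` {x}"
    using assms by (auto elim!: quotientE)
  then show ?thesis
    by (simp add: quot_scale_null completion_embed_class quot_scale_CR const_cauchy) (simp add: scaleR_fun_def)
qed

lemma completion_norm_embed:
  assumes "X \<in> V // null_rel V q"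
  shows "completion_norm q (completion_embed V q X) = sqrt (quot_form X X)"
proof -
  obtain x where x: "x \<in> V" "X = null_rel V q `` {x}"
    using assms by (auto elim!: quotientE)
  then show ?thesis
    by (simp add: completion_embed_class quot_form_class completion_norm_class const_cauchy)
qed

text \<open>A Cauchy sequence is approximated by the constant sequence of one of its late terms.
  Starting from \<epsilon> / 2 keeps the inequality strict after the passage to the limit.\<close>

lemma completion_embed_dense:
  assumes Z: "Z \<in> hilbert_completion V q" and \<epsilon>: "0 < \<epsilon>"
  shows "\<exists>X\<in>V // null_rel V q.
    completion_norm q (quot_add CR Z (quot_scale CR (- 1) (completion_embed V q X))) < \<epsilon>"
proof -
  obtain s where s: "s \<in> CS" "Z = CR `` {s}"
    using Z by (auto simp: hilbert_completion_def elim!: quotientE)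
  obtain N where N: "\<And>m n. m \<ge> N \<Longrightarrow> n \<ge> N \<Longrightarrow> seminorm (s m - s n) < \<epsilon> / 2"
    using cauchyD[OF s(1), of "\<epsilon> / 2"] \<epsilon> by auto
  have sN: "s N \<in> V" using s(1) by (rule cauchy_mem)
  define t where "t = s + (- 1) *\<^sub>R (\<lambda>_. s N)"
  have t: "t \<in> CS"
    unfolding t_def by (intro subspace_add[OF subspace_cauchy] subspace_scale[OF subspace_cauchy] s const_cauchy sN)
  have eq: "quot_add CR Z (quot_scale CR (- 1) (completion_embed V q (null_rel V q `` {s N}))) = CR `` {t}"
    using s sN const_cauchy[OF sN] subspace_scale[OF subspace_cauchy const_cauchy[OF sN], of "-1"]
    by (simp only: completion_embed_class quot_scale_CR quot_add_CR t_def)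
  obtain l where l: "(\<lambda>n. seminorm (t n)) \<longlonglongrightarrow> l"
    using cauchy_seminorm_convergent[OF t] by (auto simp: convergent_def)
  have "l \<le> \<epsilon> / 2"
  proof (rule LIMSEQ_le_const2[OF l], intro exI allI impI)
    fix n assume "N \<le> n"
    then show "seminorm (t n) \<le> \<epsilon> / 2"
      using N[of n N] by (simp add: t_def)
  qed
  then show ?thesis
    using completion_norm_class[OF t l] eq \<epsilon> quotientI[OF sN, of "null_rel V q"]
    by (intro bexI[of _ "null_rel V q `` {s N}"]) simp_all
qed

end

section \<open>Vertices and edges of the gasket\<close>

abbreviation letters :: "nat set" where "letters \<equiv> {0, 1, 2}"

lemma contraction_eq: "contraction i x = (1 / 2) *\<^sub>R corner i + (1 / 2) *\<^sub>R x"
  by (simp add: contraction_def algebra_simps flip: scaleR_add_left)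

lemma contraction_corner [simp]: "contraction i (corner i) = corner i"
  by (simp add: contraction_def)

lemma contraction_corner_commute: "contraction i (corner j) = contraction j (corner i)"
  by (simp add: contraction_eq add.commute)

lemma dist_contraction: "dist (contraction i x) (contraction i y) = dist x y / 2"
  by (simp add: contraction_eq dist_norm flip: scaleR_diff_right)

lemma word_map_Nil [simp]: "word_map [] = id"
  by (simp add: word_map_def)

lemma word_map_Cons: "word_map (i # \<sigma>) x = contraction i (word_map \<sigma> x)"
  by (simp add: word_map_def)

lemma word_map_append: "word_map (\<sigma> @ \<tau>) x = word_map \<sigma> (word_map \<tau> x)"
  by (induction \<sigma>) (simp_all add: word_map_Cons)

lemma word_map_snoc: "word_map (\<sigma> @ [i]) x = word_map \<sigma> (contraction i x)"
  by (simp add: word_map_append word_map_Cons)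

definition vertex :: "nat list \<Rightarrow> nat \<Rightarrow> pt" where
  "vertex \<sigma> i = word_map \<sigma> (corner i)"

lemma vertex_Nil: "vertex [] i = corner i"
  by (simp add: vertex_def)

lemma vertex_snoc_same [simp]: "vertex (\<sigma> @ [i]) i = vertex \<sigma> i"
  by (simp add: vertex_def word_map_snoc)

text \<open>Both sides are the midpoint of the edge between the corners i and j of the cell, the
  point where its subcells i and j touch.\<close>

lemma vertex_snoc_commute: "vertex (\<sigma> @ [i]) j = vertex (\<sigma> @ [j]) i"
  by (simp add: vertex_def word_map_snoc contraction_corner_commute)

lemma corner_0 [simp]: "corner 0 = 0"
  by (simp add: corner_def vec_eq_iff forall_2)

text \<open>The contractions do not rotate, and \<open>corner 0\<close> is the origin; so every cell
  is a scaled translate of the big triangle and its sides keep their directions.\<close>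

lemma word_map_affine: "word_map \<sigma> x = word_map \<sigma> 0 + (1 / 2 ^ length \<sigma>) *\<^sub>R x"
  by (induction \<sigma>) (simp_all add: word_map_Cons contraction_eq algebra_simps)

lemma vertex_eq: "vertex \<sigma> i = vertex \<sigma> 0 + (1 / 2 ^ length \<sigma>) *\<^sub>R corner i"
  using word_map_affine[of \<sigma> "corner i"] by (simp add: vertex_def)

lemma vertex_diff: "vertex \<sigma> j - vertex \<sigma> i = (1 / 2 ^ length \<sigma>) *\<^sub>R (corner j - corner i)"
  by (simp add: vertex_eq[of _ i] vertex_eq[of _ j] scaleR_diff_right)

lemma vertex_append: "vertex (\<sigma> @ \<tau>) i = vertex \<sigma> 0 + (1 / 2 ^ length \<sigma>) *\<^sub>R vertex \<tau> i"
  using word_map_affine[of \<sigma> "vertex \<tau> i"] by (simp add: vertex_def word_map_append)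

lemma words_0 [simp]: "words 0 = {[]}"
  by (auto simp: words_def)

lemma length_words: "\<sigma> \<in> words m \<Longrightarrow> length \<sigma> = m"
  by (simp add: words_def)

lemma finite_words [simp, intro]: "finite (words m)"
  using finite_lists_length_eq[of letters m] by (simp add: words_def conj_commute)

lemma words_append: "\<sigma> \<in> words m \<Longrightarrow> \<tau> \<in> words n \<Longrightarrow> \<sigma> @ \<tau> \<in> words (m + n)"
  by (auto simp: words_def)

lemma sum_words_add: "sum \<phi> (words (m + n)) = (\<Sum>\<sigma>\<in>words m. \<Sum>\<tau>\<in>words n. \<phi> (\<sigma> @ \<tau>))"
proof -
  have "bij_betw (\<lambda>(\<sigma>, \<tau>). \<sigma> @ \<tau>) (words m \<times> words n) (words (m + n))"
  proof (rule bij_betwI')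
    fix p q assume "p \<in> words m \<times> words n" "q \<in> words m \<times> words n"
    then have "length (fst p) = length (fst q)" by (metis mem_Times_iff length_words)
    then show "((case p of (\<sigma>, \<tau>) \<Rightarrow> \<sigma> @ \<tau>) = (case q of (\<sigma>, \<tau>) \<Rightarrow> \<sigma> @ \<tau>)) = (p = q)"
      by (simp add: split_def prod_eq_iff)
  next
    fix p assume "p \<in> words m \<times> words n"
    then show "(case p of (\<sigma>, \<tau>) \<Rightarrow> \<sigma> @ \<tau>) \<in> words (m + n)"
      by (simp add: split_def mem_Times_iff words_append)
  next
    fix \<rho> assume *: "\<rho> \<in> words (m + n)"
    have "take m \<rho> \<in> words m" "drop m \<rho> \<in> words n"
      using * order_trans[OF set_take_subset, of \<rho> letters m] order_trans[OF set_drop_subset, of \<rho> letters m]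
      unfolding words_def by simp_all
    then show "\<exists>p\<in>words m \<times> words n. \<rho> = (case p of (\<sigma>, \<tau>) \<Rightarrow> \<sigma> @ \<tau>)"
      by (intro bexI[of _ "(take m \<rho>, drop m \<rho>)"]) simp_all
  qed
  from sum.reindex_bij_betw[OF this, of \<phi>]
  have "sum \<phi> (words (m + n)) = (\<Sum>p\<in>words m \<times> words n. \<phi> (case p of (\<sigma>, \<tau>) \<Rightarrow> \<sigma> @ \<tau>))"
    by (rule sym)
  also have "\<dots> = (\<Sum>(\<sigma>, \<tau>)\<in>words m \<times> words n. \<phi> (\<sigma> @ \<tau>))"
    by (simp only: split_def)
  finally show ?thesis by (simp only: sum.cartesian_product)
qed

lemma words_1: "words 1 = {[0], [1], [2]}"
  by (auto simp: words_def length_Suc_conv)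

lemma sum_words_1: "sum \<phi> (words 1) = (\<Sum>i\<in>letters. \<phi> [i])"
  unfolding words_1 by simp

text \<open>Linear coordinates with respect to the basis \<open>corner 1\<close>, \<open>corner 2\<close>; in them the vertices
  of level \<open>m\<close> are points of the lattice \<open>2\<^sup>-\<^sup>m \<int>\<^sup>2\<close>.\<close>

definition coord1 :: "pt \<Rightarrow> real" where "coord1 x = 2 * x $ 2 / sqrt 3"
definition coord2 :: "pt \<Rightarrow> real" where "coord2 x = x $ 1 - x $ 2 / sqrt 3"

lemma coord_linear [simp]:
  "coord1 0 = 0" "coord2 0 = 0"
  "coord1 (x + y) = coord1 x + coord1 y" "coord2 (x + y) = coord2 x + coord2 y"
  "coord1 (x - y) = coord1 x - coord1 y" "coord2 (x - y) = coord2 x - coord2 y"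
  "coord1 (c *\<^sub>R x) = c * coord1 x" "coord2 (c *\<^sub>R x) = c * coord2 x"
  by (simp_all add: coord1_def coord2_def add_divide_distrib diff_divide_distrib ring_distribs)

lemma coord_corner:
  "coord1 (corner i) = (if i = 1 then 1 else 0)"
  "coord2 (corner i) = (if i = 0 \<or> i = 1 then 0 else 1)"
  by (simp_all add: coord1_def coord2_def corner_def)

text \<open>The strict inequality matters: the lower left corners of cells lie in a half-open
  triangle, and the three images of that triangle under the contractions are disjoint although the
  closed ones touch.\<close>

lemma coord_vertex_0:
  "0 \<le> coord1 (vertex \<sigma> 0) \<and> 0 \<le> coord2 (vertex \<sigma> 0) \<and> coord1 (vertex \<sigma> 0) + coord2 (vertex \<sigma> 0) < 1"
  by (induction \<sigma>)
    (auto simp: vertex_def word_map_Cons contraction_eq coord_corner)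

lemma vertex_Cons_0: "vertex (i # \<sigma>) 0 = (1 / 2) *\<^sub>R corner i + (1 / 2) *\<^sub>R vertex \<sigma> 0"
  by (simp add: vertex_def word_map_Cons contraction_eq)

text \<open>By \<open>coord_vertex_0\<close> the coordinates of the point reveal the first letter of
  the word; the remaining letters follow by induction.\<close>

lemma vertex_0_inj:
  assumes "\<sigma> \<in> words m" "\<tau> \<in> words m" "vertex \<sigma> 0 = vertex \<tau> 0"
  shows "\<sigma> = \<tau>"
  using assms
proof (induction m arbitrary: \<sigma> \<tau>)
  case 0
  then show ?case by simp
next
  case (Suc m)
  obtain i \<sigma>' where \<sigma>: "\<sigma> = i # \<sigma>'" "\<sigma>' \<in> words m" "i \<in> letters"
    using Suc.prems(1) by (cases \<sigma>) (auto simp: words_def)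
  obtain j \<tau>' where \<tau>: "\<tau> = j # \<tau>'" "\<tau>' \<in> words m" "j \<in> letters"
    using Suc.prems(2) by (cases \<tau>) (auto simp: words_def)
  have "corner i + vertex \<sigma>' 0 = corner j + vertex \<tau>' 0"
    using Suc.prems(3) unfolding \<sigma> \<tau> vertex_Cons_0
    by (simp flip: scaleR_add_right)
  then have c: "coord1 (corner i) + coord1 (vertex \<sigma>' 0) = coord1 (corner j) + coord1 (vertex \<tau>' 0)"
    "coord2 (corner i) + coord2 (vertex \<sigma>' 0) = coord2 (corner j) + coord2 (vertex \<tau>' 0)"
    and eq: "corner i + vertex \<sigma>' 0 = corner j + vertex \<tau>' 0"
    by (metis coord_linear(3) coord_linear(4))+
  have "i = j"
    using c coord_vertex_0[of \<sigma>'] coord_vertex_0[of \<tau>'] \<sigma>(3) \<tau>(3)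
    by (auto simp: coord_corner split: if_splits)
  then show ?case using eq \<sigma> \<tau> Suc.IH by simp
qed

text \<open>Ordered pairs, so that each side of a triangle occurs in both orientations, as in
  \<open>oriented_edges\<close>; the factor 1/2 in the energies compensates.\<close>

definition sides :: "(nat \<times> nat) set" where
  "sides = {(0, 1), (1, 0), (1, 2), (2, 1), (0, 2), (2, 0)}"

lemma finite_sides [simp]: "finite sides"
  by (simp add: sides_def)

lemma card_sides: "card sides = 6"
  by (simp add: sides_def)

lemma sides_iff: "(i, j) \<in> sides \<longleftrightarrow> i \<in> letters \<and> j \<in> letters \<and> i \<noteq> j"
  by (auto simp: sides_def)

text \<open>The six oriented sides point in six different directions, which the two coordinates
  distinguish.\<close>

lemma sides_direction:
  assumes "(i, j) \<in> sides" "(k, l) \<in> sides" "c > 0" "corner j - corner i = c *\<^sub>R (corner l - corner k)"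
  shows "i = k \<and> j = l"
proof -
  have "coord1 (corner j - corner i) = c * coord1 (corner l - corner k)"
    "coord2 (corner j - corner i) = c * coord2 (corner l - corner k)"
    unfolding assms(4) by simp_all
  with assms(1-3) show ?thesis
    by (auto simp: sides_def coord_corner)
qed

text \<open>Different cells of one level may share a vertex but never an edge: the direction of the
  edge determines the side, and its position then determines the lower left corner and with it the
  cell.\<close>

lemma edge_inj:
  assumes "\<sigma> \<in> words m" "\<tau> \<in> words m" "(i, j) \<in> sides" "(k, l) \<in> sides"
    "vertex \<sigma> i = vertex \<tau> k" "vertex \<sigma> j = vertex \<tau> l"
  shows "\<sigma> = \<tau> \<and> i = k \<and> j = l"
proof -
  have "vertex \<sigma> j - vertex \<sigma> i = vertex \<tau> l - vertex \<tau> k"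
    using assms by simp
  then have "corner j - corner i = 1 *\<^sub>R (corner l - corner k)"
    using length_words[OF assms(1)] length_words[OF assms(2)] by (simp add: vertex_diff)
  then have ij: "i = k" "j = l"
    using sides_direction[OF assms(3,4), of 1] by simp_all
  then have "vertex \<sigma> 0 = vertex \<tau> 0"
    using assms(5) length_words[OF assms(1)] length_words[OF assms(2)]
    by (simp add: vertex_eq[of _ k])
  then show ?thesis using vertex_0_inj assms ij by blast
qed

lemma word_map_closed_segment:
  "word_map \<sigma> ` closed_segment (corner i) (corner j) = closed_segment (vertex \<sigma> i) (vertex \<sigma> j)"
proof -
  have "word_map \<sigma> = (+) (word_map \<sigma> 0) \<circ> (*\<^sub>R) (1 / 2 ^ length \<sigma>)"
    by (rule ext) (simp add: word_map_affine[symmetric])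
  then have "word_map \<sigma> ` closed_segment (corner i) (corner j)
      = (+) (word_map \<sigma> 0) ` (*\<^sub>R) (1 / 2 ^ length \<sigma>) ` closed_segment (corner i) (corner j)"
    by (metis image_comp)
  also have "\<dots> = closed_segment (word_map \<sigma> (corner i)) (word_map \<sigma> (corner j))"
    by (subst (1 2) word_map_affine)
      (simp add: closed_segment_translation closed_segment_linear_image linear_scaleR)
  finally show ?thesis by (simp add: vertex_def)
qed

lemma UN_image_triples: "(\<Union>x\<in>A. (\<lambda>(i, j). c x i j) ` B) = (\<lambda>(x, i, j). c x i j) ` (A \<times> B)"
  by force

lemma edges_eq: "edges m = (\<lambda>(\<sigma>, i, j). closed_segment (vertex \<sigma> i) (vertex \<sigma> j)) ` (words m \<times> sides)"
proof -
  have "(\<lambda>s. word_map \<sigma> ` s) ` edges0 = (\<lambda>(i, j). closed_segment (vertex \<sigma> i) (vertex \<sigma> j)) ` sides" for \<sigma>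
    unfolding edges0_def sides_def image_insert image_empty case_prod_conv word_map_closed_segment
    unfolding closed_segment_commute[of "vertex \<sigma> 1" "vertex \<sigma> 0"]
      closed_segment_commute[of "vertex \<sigma> 2" "vertex \<sigma> 1"]
      closed_segment_commute[of "vertex \<sigma> 0" "vertex \<sigma> 2"] by blast
  then show ?thesis unfolding edges_def by (simp only: UN_image_triples)
qed

lemma oriented_edges_eq:
  "oriented_edges m = (\<lambda>(\<sigma>, i, j). (vertex \<sigma> i, vertex \<sigma> j)) ` (words m \<times> sides)"
proof
  show "oriented_edges m \<subseteq> (\<lambda>(\<sigma>, i, j). (vertex \<sigma> i, vertex \<sigma> j)) ` (words m \<times> sides)"
  proof
    fix e assume "e \<in> oriented_edges m"
    then obtain \<sigma> i j where *: "\<sigma> \<in> words m" "(i, j) \<in> sides"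
      "closed_segment (fst e) (snd e) = closed_segment (vertex \<sigma> i) (vertex \<sigma> j)"
      by (auto simp: oriented_edges_def edges_eq)
    then have "e = (vertex \<sigma> i, vertex \<sigma> j) \<or> e = (vertex \<sigma> j, vertex \<sigma> i)"
      by (cases e) (auto simp: closed_segment_eq doubleton_eq_iff)
    moreover have "(j, i) \<in> sides" using *(2) by (auto simp: sides_iff)
    ultimately show "e \<in> (\<lambda>(\<sigma>, i, j). (vertex \<sigma> i, vertex \<sigma> j)) ` (words m \<times> sides)"
      using * by force
  qed
next
  show "(\<lambda>(\<sigma>, i, j). (vertex \<sigma> i, vertex \<sigma> j)) ` (words m \<times> sides) \<subseteq> oriented_edges m"
    by (auto simp: oriented_edges_def edges_eq)
qed

lemma oriented_edgesE:
  assumes "e \<in> oriented_edges m"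
  obtains \<sigma> i j where "\<sigma> \<in> words m" "(i, j) \<in> sides" "e = (vertex \<sigma> i, vertex \<sigma> j)"
  using assms by (auto simp: oriented_edges_eq)

lemma oriented_edgesI:
  "\<sigma> \<in> words m \<Longrightarrow> (i, j) \<in> sides \<Longrightarrow> (vertex \<sigma> i, vertex \<sigma> j) \<in> oriented_edges m"
  by (force simp: oriented_edges_eq)

text \<open>By \<open>edge_inj\<close> no edge is counted twice. This turns every sum over edges
  into a sum over cells, where energies can be localised.\<close>

lemma sum_oriented_edges:
  "(\<Sum>(a, b)\<in>oriented_edges m. \<phi> a b) = (\<Sum>\<sigma>\<in>words m. \<Sum>(i, j)\<in>sides. \<phi> (vertex \<sigma> i) (vertex \<sigma> j))"
proof -
  have "inj_on (\<lambda>(\<sigma>, i, j). (vertex \<sigma> i, vertex \<sigma> j)) (words m \<times> sides)"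
  proof (rule inj_onI, clarsimp)
    fix \<sigma> i j \<tau> k l
    assume "\<sigma> \<in> words m" "(i, j) \<in> sides" "\<tau> \<in> words m" "(k, l) \<in> sides"
      "vertex \<sigma> i = vertex \<tau> k" "vertex \<sigma> j = vertex \<tau> l"
    then show "\<sigma> = \<tau> \<and> i = k \<and> j = l" by (intro edge_inj)
  qed
  then have "(\<Sum>(a, b)\<in>oriented_edges m. \<phi> a b)
      = (\<Sum>(\<sigma>, i, j)\<in>words m \<times> sides. \<phi> (vertex \<sigma> i) (vertex \<sigma> j))"
    unfolding oriented_edges_eq by (subst sum.reindex) (simp_all only: o_def split_def fst_conv snd_conv)
  also have "\<dots> = (\<Sum>\<sigma>\<in>words m. \<Sum>(i, j)\<in>sides. \<phi> (vertex \<sigma> i) (vertex \<sigma> j))"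
    by (rule sum.cartesian_product[symmetric])
  finally show ?thesis .
qed

lemma all_oriented_edgesE:
  assumes "e \<in> all_oriented_edges"
  obtains \<sigma> i j where "\<sigma> \<in> words (length \<sigma>)" "(i, j) \<in> sides" "e = (vertex \<sigma> i, vertex \<sigma> j)"
proof -
  obtain m where "e \<in> oriented_edges m" using assms by (auto simp: all_oriented_edges_def)
  then obtain \<sigma> i j where "\<sigma> \<in> words m" "(i, j) \<in> sides" "e = (vertex \<sigma> i, vertex \<sigma> j)"
    by (rule oriented_edgesE)
  moreover from this have "length \<sigma> = m" by (simp add: length_words)
  ultimately show thesis using that[of \<sigma> i j] by simp
qed

lemma all_oriented_edgesI:
  "\<sigma> \<in> words m \<Longrightarrow> (i, j) \<in> sides \<Longrightarrow> (vertex \<sigma> i, vertex \<sigma> j) \<in> all_oriented_edges"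
  unfolding all_oriented_edges_def by (rule UN_I[OF UNIV_I], rule oriented_edgesI)

lemma sum_oriented_edges_swap:
  "(\<Sum>(a, b)\<in>oriented_edges m. \<phi> a b) = (\<Sum>(a, b)\<in>oriented_edges m. \<phi> b a :: real)"
  unfolding sum_oriented_edges by (rule sum.cong[OF refl]) (simp add: sides_def)

section \<open>Subedges\<close>

text \<open>For i \<noteq> j in \<open>letters\<close> these are the addresses of the cells that
  have an edge on the side between the corners i and j.\<close>

definition side_words :: "nat \<Rightarrow> nat \<Rightarrow> nat \<Rightarrow> nat list set" where
  "side_words i j n = {v. length v = n \<and> set v \<subseteq> {i, j}}"

lemma side_words_0 [simp]: "side_words i j 0 = {[]}"
  by (auto simp: side_words_def)

lemma side_words_subset: "(i, j) \<in> sides \<Longrightarrow> side_words i j n \<subseteq> words n"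
  by (auto simp: side_words_def words_def sides_iff)

lemma finite_side_words [simp]: "finite (side_words i j n)"
  using finite_lists_length_eq[of "{i, j}" n] by (simp add: side_words_def conj_commute)

lemma sum_side_words_Suc:
  assumes "i \<noteq> j"
  shows "sum \<phi> (side_words i j (Suc n)) = (\<Sum>v\<in>side_words i j n. \<phi> (v @ [i]) + \<phi> (v @ [j]))"
proof -
  have "side_words i j (Suc n) = (\<lambda>v. v @ [i]) ` side_words i j n \<union> (\<lambda>v. v @ [j]) ` side_words i j n"
  proof
    show "side_words i j (Suc n) \<subseteq> (\<lambda>v. v @ [i]) ` side_words i j n \<union> (\<lambda>v. v @ [j]) ` side_words i j n"
    proof
      fix v assume v: "v \<in> side_words i j (Suc n)"
      then have "v = butlast v @ [last v]" by (cases v rule: rev_cases) (auto simp: side_words_def)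
      moreover have "last v \<in> {i, j}" using v last_in_set[of v] unfolding side_words_def by fastforce
      moreover have "butlast v \<in> side_words i j n"
        using v by (auto simp: side_words_def dest: in_set_butlastD)
      ultimately show "v \<in> (\<lambda>v. v @ [i]) ` side_words i j n \<union> (\<lambda>v. v @ [j]) ` side_words i j n"
        by (metis Un_iff image_eqI insertE singletonD)
    qed
  qed (auto simp: side_words_def)
  moreover have "(\<lambda>v. v @ [i]) ` side_words i j n \<inter> (\<lambda>v. v @ [j]) ` side_words i j n = {}"
    using assms by auto
  ultimately show ?thesis
    by (simp add: sum.union_disjoint sum.reindex inj_on_def sum.distrib)
qed

text \<open>With i as digit 0 and j as digit 1, a side word is the binary expansion of the position
  of its cell along the side; the induction splits off the leading digit.
  \<open>side_vertex'\<close> is the converse reading.\<close>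

lemma side_vertex:
  assumes "k < 2 ^ n"
  shows "\<exists>v\<in>side_words i j n. vertex v i = corner i + (real k / 2 ^ n) *\<^sub>R (corner j - corner i)"
  using assms
proof (induction n arbitrary: k)
  case 0
  then show ?case by (simp add: vertex_Nil)
next
  case (Suc n)
  show ?case
  proof (cases "k < 2 ^ n")
    case True
    then obtain v where v: "v \<in> side_words i j n"
      "vertex v i = corner i + (real k / 2 ^ n) *\<^sub>R (corner j - corner i)"
      using Suc.IH by blast
    have "vertex (i # v) i = contraction i (vertex v i)"
      by (simp add: vertex_def word_map_Cons)
    also have "\<dots> = corner i + (real k / 2 ^ Suc n) *\<^sub>R (corner j - corner i)"
      by (simp add: v contraction_def)
    finally show ?thesis using v(1) by (intro bexI[of _ "i # v"]) (auto simp: side_words_def)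
  next
    case False
    then have "k - 2 ^ n < 2 ^ n" using Suc.prems by simp
    then obtain v where v: "v \<in> side_words i j n"
      "vertex v i = corner i + (real (k - 2 ^ n) / 2 ^ n) *\<^sub>R (corner j - corner i)"
      using Suc.IH by blast
    have r: "real k / 2 ^ Suc n = 1 / 2 + (1 / 2) * (real (k - 2 ^ n) / 2 ^ n)"
      using False by (simp add: of_nat_diff field_simps)
    have "vertex (j # v) i = contraction j (vertex v i)"
      by (simp add: vertex_def word_map_Cons)
    also have "\<dots> = corner i + (real k / 2 ^ Suc n) *\<^sub>R (corner j - corner i)"
      unfolding r v(2) contraction_eq
      by (simp add: vec_eq_iff algebra_simps)
    finally show ?thesis using v(1) by (intro bexI[of _ "j # v"]) (auto simp: side_words_def)
  qed
qed

lemma side_vertex':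
  assumes "v \<in> side_words i j n"
  shows "\<exists>k<2 ^ n. vertex v i = corner i + (real k / 2 ^ n) *\<^sub>R (corner j - corner i)"
  using assms
proof (induction n arbitrary: v)
  case 0
  then show ?case by (simp add: vertex_Nil)
next
  case (Suc n)
  then obtain l v' where v: "v = l # v'" "l = i \<or> l = j" "v' \<in> side_words i j n"
    by (cases v) (auto simp: side_words_def)
  obtain k where k: "k < 2 ^ n" "vertex v' i = corner i + (real k / 2 ^ n) *\<^sub>R (corner j - corner i)"
    using Suc.IH[OF v(3)] by blast
  have *: "vertex v i = contraction l (vertex v' i)"
    by (simp add: vertex_def word_map_Cons v)
  from v(2) show ?case
  proof
    assume "l = i"
    then show ?thesis using k * by (intro exI[of _ k]) (simp add: contraction_def)
  next
    assume l: "l = j"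
    have r: "real (k + 2 ^ n) / 2 ^ Suc n = 1 / 2 + (1 / 2) * (real k / 2 ^ n)"
      by (simp add: field_simps)
    have "vertex v i = corner i + (real (k + 2 ^ n) / 2 ^ Suc n) *\<^sub>R (corner j - corner i)"
      unfolding r * k(2) contraction_eq l
      by (simp add: vec_eq_iff algebra_simps)
    then show ?thesis using k by (intro exI[of _ "k + 2 ^ n"]) simp
  qed
qed

lemma coord_vertex_lattice:
  "\<exists>a b :: int. 2 ^ length \<sigma> * coord1 (vertex \<sigma> i) = of_int a \<and> 2 ^ length \<sigma> * coord2 (vertex \<sigma> i) = of_int b"
proof (induction \<sigma>)
  case Nil
  show ?case by (rule exI[of _ "if i = 1 then 1 else 0"], rule exI[of _ "if i = 0 \<or> i = 1 then 0 else 1"])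
    (simp add: vertex_Nil coord_corner)
next
  case (Cons l \<sigma>)
  then obtain a b :: int where
    ab: "2 ^ length \<sigma> * coord1 (vertex \<sigma> i) = of_int a" "2 ^ length \<sigma> * coord2 (vertex \<sigma> i) = of_int b"
    by blast
  show ?case
    by (rule exI[of _ "a + (if l = 1 then 2 ^ length \<sigma> else 0)"],
        rule exI[of _ "b + (if l = 0 \<or> l = 1 then 0 else 2 ^ length \<sigma>)"])
      (use ab in \<open>simp add: vertex_def word_map_Cons contraction_eq coord_corner algebra_simps\<close>)
qed

text \<open>The definition of \<open>subedges\<close> is geometric, and the inclusion from left to
  right has to recover an address. The direction forces the side (i, j), comparison of lengths gives
  the parameter difference 2^-n, the lattice of vertices makes the initial parameter a multiple of
  2^-n, and \<open>side_vertex\<close> supplies the word for that multiple.\<close>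

lemma subedges_eq:
  assumes \<sigma>: "\<sigma> \<in> words m" and s: "(i, j) \<in> sides"
  shows "subedges (m + n) (vertex \<sigma> i, vertex \<sigma> j)
    = (\<lambda>v. (vertex (\<sigma> @ v) i, vertex (\<sigma> @ v) j)) ` side_words i j n"
proof (intro equalityI subsetI)
  let ?d = "corner j - corner i"
  have m: "length \<sigma> = m" using \<sigma> by (rule length_words)
  fix e assume "e \<in> subedges (m + n) (vertex \<sigma> i, vertex \<sigma> j)"
  then obtain a b c where e: "e = (a, b)" "(a, b) \<in> oriented_edges (m + n)"
    "closed_segment a b \<subseteq> closed_segment (vertex \<sigma> i) (vertex \<sigma> j)"
    "c > 0" "b - a = c *\<^sub>R (vertex \<sigma> j - vertex \<sigma> i)"
    by (auto simp: subedges_def)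
  obtain u k l where u: "u \<in> words (m + n)" "(k, l) \<in> sides" "a = vertex u k" "b = vertex u l"
    using e(2) by (auto elim: oriented_edgesE)
  have lu: "length u = m + n" using u(1) by (rule length_words)
  have "(1 / 2 ^ (m + n)) *\<^sub>R (corner l - corner k) = (c / 2 ^ m) *\<^sub>R ?d"
    using e(5) by (simp add: u vertex_diff m lu)
  then have "(2 ^ (m + n)) *\<^sub>R ((1 / 2 ^ (m + n)) *\<^sub>R (corner l - corner k)) = (2 ^ (m + n)) *\<^sub>R ((c / 2 ^ m) *\<^sub>R ?d)"
    by (rule arg_cong)
  then have "corner l - corner k = (2 ^ n * c) *\<^sub>R ?d"
    by (simp add: power_add mult.commute)
  then have kl: "k = i" "l = j"
    using sides_direction[OF u(2) s, of "2 ^ n * c"] e(4) by simp_all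
  have "a \<in> closed_segment (vertex \<sigma> i) (vertex \<sigma> j)" "b \<in> closed_segment (vertex \<sigma> i) (vertex \<sigma> j)"
    using e(3) by auto
  then obtain t t' where t: "0 \<le> t" "a = (1 - t) *\<^sub>R vertex \<sigma> i + t *\<^sub>R vertex \<sigma> j"
    and t': "t' \<le> 1" "b = (1 - t') *\<^sub>R vertex \<sigma> i + t' *\<^sub>R vertex \<sigma> j"
    by (auto simp: in_segment)
  have a: "a = vertex \<sigma> i + (t / 2 ^ m) *\<^sub>R ?d" and b: "b = vertex \<sigma> i + (t' / 2 ^ m) *\<^sub>R ?d"
  proof -
    have "a = vertex \<sigma> i + t *\<^sub>R (vertex \<sigma> j - vertex \<sigma> i)" "b = vertex \<sigma> i + t' *\<^sub>R (vertex \<sigma> j - vertex \<sigma> i)"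
      by (simp_all add: t(2) t'(2) algebra_simps)
    then show "a = vertex \<sigma> i + (t / 2 ^ m) *\<^sub>R ?d" "b = vertex \<sigma> i + (t' / 2 ^ m) *\<^sub>R ?d"
      by (simp_all add: vertex_diff m)
  qed
  have d: "coord1 ?d \<noteq> 0 \<or> coord2 ?d \<noteq> 0"
    using s by (auto simp: sides_def coord_corner)
  have "b - a = (1 / 2 ^ (m + n)) *\<^sub>R ?d" by (simp add: u kl vertex_diff lu)
  then have "((t' - t) / 2 ^ m) *\<^sub>R ?d = (1 / 2 ^ (m + n)) *\<^sub>R ?d"
    unfolding a b by (simp add: diff_divide_distrib scaleR_diff_left)
  then have "((t' - t) / 2 ^ m) * coord1 ?d = (1 / 2 ^ (m + n)) * coord1 ?d"
    "((t' - t) / 2 ^ m) * coord2 ?d = (1 / 2 ^ (m + n)) * coord2 ?d"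
    by (metis coord_linear(7), metis coord_linear(8))
  then have "(t' - t) / 2 ^ m = 1 / 2 ^ (m + n)" using d by (metis mult_right_cancel)
  then have "2 ^ m * ((t' - t) / 2 ^ m) = 2 ^ m * (1 / 2 ^ (m + n))" by (rule arg_cong)
  then have tt: "t' = t + 1 / 2 ^ n" by (simp add: power_add)
  have "\<exists>z::int. t * 2 ^ n = of_int z"
  proof -
    obtain A B :: int where A: "2 ^ (m + n) * coord1 a = of_int A" "2 ^ (m + n) * coord2 a = of_int B"
      using coord_vertex_lattice[of u k] by (auto simp: u lu)
    obtain A' B' :: int where A': "2 ^ m * coord1 (vertex \<sigma> i) = of_int A'" "2 ^ m * coord2 (vertex \<sigma> i) = of_int B'"
      using coord_vertex_lattice[of \<sigma> i] by (auto simp: m)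
    define D1 D2 where "D1 = coord1 ?d" and "D2 = coord2 ?d"
    have "coord1 a = coord1 (vertex \<sigma> i) + (t / 2 ^ m) * coord1 ?d"
      "coord2 a = coord2 (vertex \<sigma> i) + (t / 2 ^ m) * coord2 ?d"
      unfolding a by simp_all
    then have *: "coord1 a = coord1 (vertex \<sigma> i) + (t / 2 ^ m) * D1"
      "coord2 a = coord2 (vertex \<sigma> i) + (t / 2 ^ m) * D2"
      by (simp_all only: D1_def D2_def)
    have "2 ^ (m + n) * coord1 a = 2 ^ n * (2 ^ m * coord1 (vertex \<sigma> i)) + t * 2 ^ n * D1"
      "2 ^ (m + n) * coord2 a = 2 ^ n * (2 ^ m * coord2 (vertex \<sigma> i)) + t * 2 ^ n * D2"
      unfolding * by (simp_all add: power_add field_simps)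
    then have z: "t * 2 ^ n * D1 = of_int (A - 2 ^ n * A')" "t * 2 ^ n * D2 = of_int (B - 2 ^ n * B')"
      unfolding A A' by simp_all
    \<comment> \<open>Each side has a coordinate equal to 1 or -1; in that coordinate the lattice
      relation says that t 2^n itself is an integer.\<close>
    have cases: "D1 = 1 \<or> D1 = -1 \<or> D2 = 1 \<or> D2 = -1"
      unfolding D1_def D2_def using s by (auto simp: sides_def coord_corner)
    then consider "t * 2 ^ n = of_int (A - 2 ^ n * A')" | "t * 2 ^ n = of_int (- (A - 2 ^ n * A'))"
      | "t * 2 ^ n = of_int (B - 2 ^ n * B')" | "t * 2 ^ n = of_int (- (B - 2 ^ n * B'))"
      using z by fastforce
    then show ?thesis by cases blast+
  qed
  then obtain z :: int where z: "t * 2 ^ n = of_int z" by blast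
  have "0 \<le> z" using t(1) z by (metis of_int_0_le_iff mult_nonneg_nonneg zero_le_power zero_le_numeral)
  then obtain p :: nat where p: "z = int p" by (metis nat_0_le)
  have tp: "t = real p / 2 ^ n" using z p by (simp add: field_simps)
  \<comment> \<open>The far end point b must lie on the edge too, which excludes p = 2^n.\<close>
  have "real p / 2 ^ n + 1 / 2 ^ n \<le> 1" using t'(1) tt tp by simp
  then have "real p + 1 \<le> 2 ^ n" by (simp add: field_simps)
  then have "real (p + 1) \<le> real (2 ^ n)" by simp
  then have "p < 2 ^ n" unfolding of_nat_le_iff by simp
  then obtain v where v: "v \<in> side_words i j n" "vertex v i = corner i + (real p / 2 ^ n) *\<^sub>R ?d"
    using side_vertex by blast
  have va: "vertex (\<sigma> @ v) i = a"
    unfolding a vertex_append vertex_eq[of \<sigma> i] v(2) tp m by (simp add: algebra_simps)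
  have "vertex (\<sigma> @ v) j = vertex (\<sigma> @ v) i + (1 / 2 ^ (m + n)) *\<^sub>R ?d"
    using vertex_diff[of "\<sigma> @ v" j i] v(1) by (simp add: side_words_def m algebra_simps)
  also have "\<dots> = b" unfolding va using \<open>b - a = (1 / 2 ^ (m + n)) *\<^sub>R ?d\<close> by (simp add: algebra_simps)
  finally show "e \<in> (\<lambda>v. (vertex (\<sigma> @ v) i, vertex (\<sigma> @ v) j)) ` side_words i j n"
    using va v(1) e(1) by force
next
  let ?d = "corner j - corner i"
  have m: "length \<sigma> = m" using \<sigma> by (rule length_words)
  fix e assume "e \<in> (\<lambda>v. (vertex (\<sigma> @ v) i, vertex (\<sigma> @ v) j)) ` side_words i j n"
  then obtain v where v: "v \<in> side_words i j n" "e = (vertex (\<sigma> @ v) i, vertex (\<sigma> @ v) j)" by blast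
  have lv: "length v = n" using v(1) by (simp add: side_words_def)
  have w: "v \<in> words n" using v(1) side_words_subset[OF s] by blast
  obtain k where k: "k < 2 ^ n" "vertex v i = corner i + (real k / 2 ^ n) *\<^sub>R ?d"
    using side_vertex'[OF v(1)] by blast
  let ?t = "real k / 2 ^ n" let ?t' = "(real k + 1) / 2 ^ n"
  have "real (k + 1) \<le> real (2 ^ n)" using k(1) unfolding of_nat_le_iff by simp
  then have "real k + 1 \<le> 2 ^ n" by simp
  then have t: "0 \<le> ?t" "?t \<le> 1" "0 \<le> ?t'" "?t' \<le> 1" using k(1) by (simp_all add: divide_le_eq)
  have a: "vertex (\<sigma> @ v) i = vertex \<sigma> i + ?t *\<^sub>R (vertex \<sigma> j - vertex \<sigma> i)"
    unfolding vertex_diff vertex_append k(2) by (subst vertex_eq[of \<sigma> i]) (simp add: scaleR_add_right algebra_simps)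
  have b: "vertex (\<sigma> @ v) j - vertex (\<sigma> @ v) i = (1 / 2 ^ n) *\<^sub>R (vertex \<sigma> j - vertex \<sigma> i)"
    unfolding vertex_diff by (simp add: lv power_add)
  then have b': "vertex (\<sigma> @ v) j = vertex \<sigma> i + ?t' *\<^sub>R (vertex \<sigma> j - vertex \<sigma> i)"
    using a by (simp add: algebra_simps add_divide_distrib)
  have "vertex (\<sigma> @ v) i \<in> closed_segment (vertex \<sigma> i) (vertex \<sigma> j)"
    unfolding a in_segment by (rule exI[of _ ?t]) (use t in \<open>simp add: algebra_simps\<close>)
  moreover have "vertex (\<sigma> @ v) j \<in> closed_segment (vertex \<sigma> i) (vertex \<sigma> j)"
    unfolding b' in_segment by (rule exI[of _ ?t']) (use t in \<open>simp add: algebra_simps\<close>)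
  ultimately have "closed_segment (vertex (\<sigma> @ v) i) (vertex (\<sigma> @ v) j) \<subseteq> closed_segment (vertex \<sigma> i) (vertex \<sigma> j)"
    by (simp add: subset_closed_segment)
  moreover have "e \<in> oriented_edges (m + n)"
    unfolding v(2) using words_append[OF \<sigma> w] s by (rule oriented_edgesI)
  ultimately show "e \<in> subedges (m + n) (vertex \<sigma> i, vertex \<sigma> j)"
    unfolding subedges_def v(2) using b by (auto intro!: exI[of _ "1 / 2 ^ n"])
qed

lemma sum_subedges:
  assumes \<sigma>: "\<sigma> \<in> words m" and s: "(i, j) \<in> sides"
  shows "(\<Sum>(a, b)\<in>subedges (m + n) (vertex \<sigma> i, vertex \<sigma> j). \<phi> a b)
    = (\<Sum>v\<in>side_words i j n. \<phi> (vertex (\<sigma> @ v) i) (vertex (\<sigma> @ v) j))"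
proof -
  have "inj_on (\<lambda>v. (vertex (\<sigma> @ v) i, vertex (\<sigma> @ v) j)) (side_words i j n)"
  proof (rule inj_onI)
    fix v w assume "v \<in> side_words i j n" "w \<in> side_words i j n"
      and eq: "(vertex (\<sigma> @ v) i, vertex (\<sigma> @ v) j) = (vertex (\<sigma> @ w) i, vertex (\<sigma> @ w) j)"
    then have "\<sigma> @ v \<in> words (m + n)" "\<sigma> @ w \<in> words (m + n)"
      using side_words_subset[OF s] words_append[OF \<sigma>] by blast+
    then show "v = w" using edge_inj[OF _ _ s s] eq by blast
  qed
  then show ?thesis
    unfolding subedges_eq[OF assms] by (subst sum.reindex) simp_all
qed

section \<open>The gasket as the closure of its vertices\<close>

definition vertices :: "pt set" where
  "vertices = {vertex \<sigma> i |\<sigma> i. set \<sigma> \<subseteq> letters \<and> i \<in> letters}"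

lemma vertices_invariant: "vertices = (\<Union>i\<in>letters. contraction i ` vertices)"
proof (intro equalityI subsetI)
  fix x assume "x \<in> vertices"
  then obtain \<sigma> k where x: "x = vertex \<sigma> k" "set \<sigma> \<subseteq> letters" "k \<in> letters"
    by (auto simp: vertices_def)
  obtain l \<tau> where *: "vertex \<sigma> k = contraction l (vertex \<tau> k)" "set \<tau> \<subseteq> letters" "l \<in> letters"
  proof (cases \<sigma>)
    case Nil
    \<comment> \<open>A corner is the fixed point of its own contraction.\<close>
    then show thesis using that[of k "[]"] x by (simp add: vertex_Nil)
  next
    case (Cons l \<tau>)
    then show thesis using that[of l \<tau>] x by (simp add: vertex_def word_map_Cons)
  qed
  then have "vertex \<tau> k \<in> vertices" using x by (auto simp: vertices_def)
  then show "x \<in> (\<Union>i\<in>letters. contraction i ` vertices)"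
    using * x(1) by blast
next
  fix x assume "x \<in> (\<Union>i\<in>letters. contraction i ` vertices)"
  then obtain i \<sigma> k where "i \<in> letters" "x = contraction i (vertex \<sigma> k)" "set \<sigma> \<subseteq> letters" "k \<in> letters"
    by (auto simp: vertices_def)
  then show "x \<in> vertices"
    unfolding vertices_def
    by (intro CollectI exI[of _ "i # \<sigma>"] exI[of _ k]) (auto simp: vertex_def word_map_Cons)
qed

lemma norm_corner_le: "norm (corner i) \<le> 1"
proof -
  have "(norm (corner i))\<^sup>2 \<le> 1"
    unfolding norm_vec_def L2_set_def
    by (simp add: sum_2 corner_def power_divide real_sqrt_pow2)
  then show ?thesis using norm_ge_zero by (simp add: power_le_one_iff abs_square_le_1)
qed

lemma norm_vertex_le: "norm (vertex \<sigma> i) \<le> 1"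
proof (induction \<sigma>)
  case Nil
  then show ?case by (simp add: vertex_Nil norm_corner_le)
next
  case (Cons l \<sigma>)
  have "vertex (l # \<sigma>) i = (1 / 2) *\<^sub>R corner l + (1 / 2) *\<^sub>R vertex \<sigma> i"
    by (simp add: vertex_def word_map_Cons contraction_eq)
  then have "norm (vertex (l # \<sigma>) i) \<le> norm ((1 / 2) *\<^sub>R corner l) + norm ((1 / 2) *\<^sub>R vertex \<sigma> i)"
    by (simp only: norm_triangle_ineq)
  then show ?case using Cons norm_corner_le[of l] by simp
qed

lemma dist_vertex_append: "dist (vertex (\<sigma> @ \<tau>) i) (vertex \<sigma> j) \<le> 2 / 2 ^ length \<sigma>"
proof -
  have "vertex (\<sigma> @ \<tau>) i - vertex \<sigma> j = (1 / 2 ^ length \<sigma>) *\<^sub>R (vertex \<tau> i - corner j)"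
    unfolding vertex_append vertex_eq[of \<sigma> j] by (simp add: scaleR_diff_right)
  then have "dist (vertex (\<sigma> @ \<tau>) i) (vertex \<sigma> j) = norm (vertex \<tau> i - corner j) / 2 ^ length \<sigma>"
    by (simp add: dist_norm)
  also have "norm (vertex \<tau> i - corner j) \<le> 2"
    using norm_triangle_ineq4[of "vertex \<tau> i" "corner j"] norm_vertex_le[of \<tau> i] norm_corner_le[of j] by simp
  finally show ?thesis by (simp add: divide_right_mono)
qed

lemma closure_contraction: "closure (contraction i ` S) = contraction i ` closure S"
proof -
  have *: "contraction i ` T = (+) ((1 / 2) *\<^sub>R corner i) ` (*\<^sub>R) (1 / 2) ` T" for T
    by (auto simp: contraction_eq image_image)
  show ?thesis unfolding * by (simp add: closure_translation closure_scaleR)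
qed

text \<open>The distance of a point of \<open>K\<close> to \<open>L\<close> is halved by the contractions, so its supremum vanishes.\<close>

lemma invariant_subset:
  assumes K: "bounded K" "K = (\<Union>i\<in>letters. contraction i ` K)"
    and L: "closed L" "bounded L" "L \<noteq> {}" "L = (\<Union>i\<in>letters. contraction i ` L)"
  shows "K \<subseteq> L"
proof
  obtain B where B: "\<And>x. x \<in> K \<Longrightarrow> infdist x L \<le> B"
  proof -
    obtain y where y: "y \<in> L" using L(3) by blast
    obtain r where r: "\<And>x. x \<in> K \<Longrightarrow> dist y x \<le> r"
      using K(1) bounded_any_center[of K y] by auto
    then show thesis
      using that[of r] infdist_le[OF y] by (metis dist_commute order_trans)
  qed
  have bound: "\<forall>x\<in>K. infdist x L \<le> B / 2 ^ n" for n
  proof (induction n)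
    case 0
    then show ?case using B by simp
  next
    case (Suc n)
    show ?case
    proof
      fix x assume "x \<in> K"
      with equalityD1[OF K(2)] have "x \<in> (\<Union>i\<in>letters. contraction i ` K)" by (rule subsetD)
      then obtain i y where y: "i \<in> letters" "y \<in> K" "x = contraction i y" by (elim UN_E imageE)
      obtain z where z: "z \<in> L" "infdist y L = dist y z"
        by (rule infdist_attains_inf[OF L(1,3)])
      have "contraction i z \<in> L"
        by (rule subsetD[OF equalityD2[OF L(4)] UN_I[OF y(1) imageI[OF z(1)]]])
      then have "infdist x L \<le> dist x (contraction i z)" by (rule infdist_le)
      also have "\<dots> = infdist y L / 2" unfolding y(3) dist_contraction z(2) ..
      also have "\<dots> \<le> B / 2 ^ n / 2" using Suc y(2) by (simp add: divide_right_mono)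
      finally show "infdist x L \<le> B / 2 ^ Suc n" by (simp add: mult.commute)
    qed
  qed
  fix x assume x: "x \<in> K"
  have "(\<lambda>n. B * (1 / 2) ^ n) \<longlonglongrightarrow> B * 0"
    by (intro tendsto_intros LIMSEQ_power_zero) simp
  then have "infdist x L \<le> B * 0"
    by (rule LIMSEQ_le_const) (use bound x in \<open>auto simp: power_divide\<close>)
  then have "infdist x L = 0" using infdist_nonneg[of x L] by simp
  then show "x \<in> L" using in_closed_iff_infdist_zero[OF L(1,3)] by simp
qed

lemma bounded_vertices: "bounded vertices"
  by (rule boundedI[of _ 1]) (auto simp: vertices_def norm_vertex_le)

text \<open>\<open>gasket\<close> is a definite description: the closure of the vertices is a
  compact invariant set, and \<open>invariant_subset\<close> in both directions shows that any other
  one equals it.\<close>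

lemma gasket_eq: "gasket = closure vertices"
proof -
  have ne: "vertices \<noteq> {}"
  proof -
    have "vertex [] 0 \<in> vertices" unfolding vertices_def by (intro CollectI exI conjI) auto
    then show ?thesis by blast
  qed
  have inv: "closure vertices = (\<Union>i\<in>letters. contraction i ` closure vertices)"
  proof -
    have "closure vertices = closure (\<Union>i\<in>letters. contraction i ` vertices)"
      using vertices_invariant by (rule arg_cong)
    then show ?thesis by (simp add: closure_contraction)
  qed
  have c: "compact (closure vertices)" using bounded_vertices by (simp add: compact_closure)
  have ne': "closure vertices \<noteq> {}" using ne by simp
  show ?thesis
    unfolding gasket_def
  proof (rule the_equality)
    show "compact (closure vertices) \<and> closure vertices \<noteq> {} \<and>
      closure vertices = (\<Union>i\<in>letters. contraction i ` closure vertices)"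
      using c ne' inv by blast
  next
    fix K assume "compact K \<and> K \<noteq> {} \<and> K = (\<Union>i\<in>letters. contraction i ` K)"
    then have K: "compact K" "K \<noteq> {}" "K = (\<Union>i\<in>letters. contraction i ` K)" by blast+
    show "K = closure vertices"
    proof
      show "K \<subseteq> closure vertices"
        by (rule invariant_subset[OF compact_imp_bounded[OF K(1)] K(3) closed_closure
          compact_imp_bounded[OF c] ne' inv])
      show "closure vertices \<subseteq> K"
        by (rule invariant_subset[OF compact_imp_bounded[OF c] inv compact_imp_closed[OF K(1)]
          compact_imp_bounded[OF K(1)] K(2,3)])
    qed
  qed
qed

lemma compact_gasket: "compact gasket"
  using bounded_vertices by (simp add: gasket_eq compact_closure)

lemma vertex_in_gasket: "\<sigma> \<in> words m \<Longrightarrow> i \<in> letters \<Longrightarrow> vertex \<sigma> i \<in> gasket"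
  unfolding gasket_eq words_def by (intro subsetD[OF closure_subset]) (auto simp: vertices_def)

section \<open>Energy\<close>

text \<open>The renormalising power belongs to the global level \<open>length \<sigma> + n\<close>,
  not to the level inside the cell, so that the sums over subcells add up without any
  factor.\<close>

definition cell_sum :: "nat \<Rightarrow> nat list \<Rightarrow> (pt \<Rightarrow> pt \<Rightarrow> real) \<Rightarrow> real" where
  "cell_sum n \<sigma> \<phi> = (5 / 3) ^ (length \<sigma> + n) *
     (1 / 2 * (\<Sum>\<tau>\<in>words n. \<Sum>(i, j)\<in>sides. \<phi> (vertex (\<sigma> @ \<tau>) i) (vertex (\<sigma> @ \<tau>) j)))"

abbreviation edge_sum :: "nat \<Rightarrow> (pt \<Rightarrow> pt \<Rightarrow> real) \<Rightarrow> real" where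
  "edge_sum n \<phi> \<equiv> cell_sum n [] \<phi>"

abbreviation diff_sq :: "(pt \<Rightarrow> real) \<Rightarrow> pt \<Rightarrow> pt \<Rightarrow> real" where
  "diff_sq f \<equiv> \<lambda>a b. (f b - f a)\<^sup>2"

lemma edge_sum_eq: "edge_sum n \<phi> = (5 / 3) ^ n * (1 / 2 * (\<Sum>(a, b)\<in>oriented_edges n. \<phi> a b))"
  by (simp only: cell_sum_def sum_oriented_edges append_Nil list.size add_0)

lemma cell_sum_split: "cell_sum (m + n) \<sigma> \<phi> = (\<Sum>\<tau>\<in>words m. cell_sum n (\<sigma> @ \<tau>) \<phi>)"
proof -
  have "(\<Sum>\<tau>\<in>words m. cell_sum n (\<sigma> @ \<tau>) \<phi>)
    = (\<Sum>\<tau>\<in>words m. (5 / 3) ^ (length \<sigma> + (m + n)) * (1 / 2 *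
        (\<Sum>\<rho>\<in>words n. \<Sum>(i, j)\<in>sides. \<phi> (vertex (\<sigma> @ \<tau> @ \<rho>) i) (vertex (\<sigma> @ \<tau> @ \<rho>) j))))"
    by (rule sum.cong[OF refl]) (simp only: cell_sum_def length_append length_words append_assoc add.assoc)
  also have "\<dots> = cell_sum (m + n) \<sigma> \<phi>"
    by (simp only: cell_sum_def sum_words_add sum_distrib_left)
  finally show ?thesis by simp
qed

lemma cell_sum_Suc: "cell_sum (Suc n) \<sigma> \<phi> = (\<Sum>i\<in>letters. cell_sum n (\<sigma> @ [i]) \<phi>)"
  using cell_sum_split[of 1 n \<sigma> \<phi>] by (simp only: sum_words_1 plus_1_eq_Suc)

lemma cell_sum_0: "cell_sum 0 \<sigma> \<phi> = (5 / 3) ^ length \<sigma> * (1 / 2 * (\<Sum>(i, j)\<in>sides. \<phi> (vertex \<sigma> i) (vertex \<sigma> j)))"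
  by (simp add: cell_sum_def)

lemma cell_sum_mono:
  assumes "\<And>\<tau> i j. \<tau> \<in> words n \<Longrightarrow> (i, j) \<in> sides
    \<Longrightarrow> \<phi> (vertex (\<sigma> @ \<tau>) i) (vertex (\<sigma> @ \<tau>) j) \<le> \<psi> (vertex (\<sigma> @ \<tau>) i) (vertex (\<sigma> @ \<tau>) j)"
  shows "cell_sum n \<sigma> \<phi> \<le> cell_sum n \<sigma> \<psi>"
  unfolding cell_sum_def
  by (intro mult_left_mono sum_mono) (use assms in auto)

lemma cell_sum_add: "cell_sum n \<sigma> (\<lambda>a b. \<phi> a b + \<psi> a b) = cell_sum n \<sigma> \<phi> + cell_sum n \<sigma> \<psi>"
  by (simp only: cell_sum_def split_def sum.distrib distrib_left)

lemma cell_sum_mult: "cell_sum n \<sigma> (\<lambda>a b. c * \<phi> a b) = c * cell_sum n \<sigma> \<phi>"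
  unfolding cell_sum_def split_def by (simp flip: sum_distrib_left)

lemma cell_sum_diff: "cell_sum n \<sigma> (\<lambda>a b. \<phi> a b - \<psi> a b) = cell_sum n \<sigma> \<phi> - cell_sum n \<sigma> \<psi>"
  using cell_sum_add[of n \<sigma> \<phi> "\<lambda>a b. (- 1) * \<psi> a b"] by (simp only: cell_sum_mult) simp

lemma cell_sum_zero [simp]: "cell_sum n \<sigma> (\<lambda>a b. 0) = 0"
  using cell_sum_mult[of n \<sigma> 0 "\<lambda>a b. 0"] by simp

lemma cell_sum_sum: "cell_sum n \<sigma> (\<lambda>a b. \<Sum>k\<in>A. \<phi> k a b) = (\<Sum>k\<in>A. cell_sum n \<sigma> (\<phi> k))"
  by (induction A rule: infinite_finite_induct) (simp_all add: cell_sum_add)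

lemma cell_sum_nonneg:
  assumes "\<And>a b. 0 \<le> \<phi> a b"
  shows "0 \<le> cell_sum n \<sigma> \<phi>"
  using cell_sum_mono[of n "\<lambda>a b. 0" \<sigma> \<phi>] assms by simp

lemma abs_cell_sum_le: "\<bar>cell_sum n \<sigma> \<phi>\<bar> \<le> cell_sum n \<sigma> (\<lambda>a b. \<bar>\<phi> a b\<bar>)"
proof -
  have "cell_sum n \<sigma> \<phi> \<le> cell_sum n \<sigma> (\<lambda>a b. \<bar>\<phi> a b\<bar>)"
    "cell_sum n \<sigma> (\<lambda>a b. (- 1) * \<phi> a b) \<le> cell_sum n \<sigma> (\<lambda>a b. \<bar>\<phi> a b\<bar>)"
    by (rule cell_sum_mono; simp)+
  then show ?thesis unfolding cell_sum_mult by simp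
qed

lemma edge_sum_swap: "edge_sum n \<phi> = edge_sum n (\<lambda>a b. \<phi> b a)"
  unfolding edge_sum_eq using sum_oriented_edges_swap[of \<phi> n] by simp

lemma edge_diff_sq_le_cell_sum:
  assumes "(i, j) \<in> sides"
  shows "(f (vertex \<sigma> j) - f (vertex \<sigma> i))\<^sup>2 \<le> (3 / 5) ^ length \<sigma> * cell_sum 0 \<sigma> (diff_sq f)"
proof -
  have "(3 / 5) ^ length \<sigma> * cell_sum 0 \<sigma> (diff_sq f)
    = 1 / 2 * (\<Sum>(i, j)\<in>sides. (f (vertex \<sigma> j) - f (vertex \<sigma> i))\<^sup>2)"
    by (simp add: cell_sum_0 power_divide)
  also have "\<dots> = (f (vertex \<sigma> 1) - f (vertex \<sigma> 0))\<^sup>2 + (f (vertex \<sigma> 2) - f (vertex \<sigma> 1))\<^sup>2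
      + (f (vertex \<sigma> 0) - f (vertex \<sigma> 2))\<^sup>2"
    by (simp add: sides_def power2_eq_square algebra_simps)
  finally show ?thesis
    using assms by (auto simp: sides_def power2_commute)
qed

text \<open>The discrete harmonic extension of boundary values \<open>x\<close>, \<open>y\<close>, \<open>z\<close> takes the values
  \<open>(2 x + 2 y + z) / 5\<close> etc. at the midpoints; in the deviations \<open>u\<close>, \<open>v\<close>, \<open>w\<close> from it
  the difference of the two sides below is a sum of squares.\<close>

lemma triangle_energy_le:
  fixes x y z a b c :: real
  shows "(x - y)\<^sup>2 + (y - z)\<^sup>2 + (z - x)\<^sup>2 \<le> 5 / 3 *
    ((x - a)\<^sup>2 + (x - c)\<^sup>2 + (a - c)\<^sup>2 + (y - a)\<^sup>2 + (y - b)\<^sup>2 + (a - b)\<^sup>2 + (z - b)\<^sup>2 + (z - c)\<^sup>2 + (b - c)\<^sup>2)"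
proof -
  \<comment> \<open>In fifths of the boundary values the harmonic midpoint values, such as 2 p + 2 q
    + r, have integer coefficients and the identity becomes polynomial over the integers.\<close>
  define p q r where "p = x / 5" and "q = y / 5" and "r = z / 5"
  then have xyz: "x = 5 * p" "y = 5 * q" "z = 5 * r" by simp_all
  define u where "u = a - (2 * p + 2 * q + r)"
  define v where "v = b - (2 * q + 2 * r + p)"
  define w where "w = c - (2 * r + 2 * p + q)"
  have "5 * ((x - a)\<^sup>2 + (x - c)\<^sup>2 + (a - c)\<^sup>2 + (y - a)\<^sup>2 + (y - b)\<^sup>2 + (a - b)\<^sup>2 + (z - b)\<^sup>2 + (z - c)\<^sup>2 + (b - c)\<^sup>2)
      - 3 * ((x - y)\<^sup>2 + (y - z)\<^sup>2 + (z - x)\<^sup>2)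
    = 5 * (2 * u\<^sup>2 + 2 * v\<^sup>2 + 2 * w\<^sup>2 + (u - v)\<^sup>2 + (v - w)\<^sup>2 + (w - u)\<^sup>2)"
    unfolding u_def v_def w_def xyz by algebra
  moreover have "0 \<le> 5 * (2 * u\<^sup>2 + 2 * v\<^sup>2 + 2 * w\<^sup>2 + (u - v)\<^sup>2 + (v - w)\<^sup>2 + (w - u)\<^sup>2)"
    by simp
  moreover have "5 * A - 3 * B = C \<Longrightarrow> 0 \<le> C \<Longrightarrow> B \<le> 5 / 3 * A" for A B C :: real
    by linarith
  ultimately show ?thesis by blast
qed

text \<open>This is \<open>triangle_energy_le\<close> for the values at the three corners and the
  three midpoints, each midpoint being shared by two subcells. The factor 5/3 is the one for which
  the harmonic extension gives equality.\<close>

lemma cell_energy_mono_0: "cell_sum 0 \<sigma> (diff_sq f) \<le> cell_sum 1 \<sigma> (diff_sq f)"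
proof -
  define x y z a b c where "x = f (vertex \<sigma> 0)" and "y = f (vertex \<sigma> 1)" and "z = f (vertex \<sigma> 2)"
    and "a = f (vertex (\<sigma> @ [0]) 1)" and "b = f (vertex (\<sigma> @ [1]) 2)" and "c = f (vertex (\<sigma> @ [2]) 0)"
  note defs = x_def y_def z_def a_def b_def c_def
  have s: "(\<Sum>(i, j)\<in>sides. (g j - g i)\<^sup>2) = 2 * ((g 0 - g 1)\<^sup>2 + (g 1 - g 2)\<^sup>2 + (g 2 - g 0)\<^sup>2)"
    for g :: "nat \<Rightarrow> real"
    by (simp add: sides_def power2_eq_square algebra_simps)
  have letters: "(\<Sum>i\<in>letters. g i) = g 0 + (g 1 + g 2)" for g :: "nat \<Rightarrow> real"
    by simp
  have v: "f (vertex (\<sigma> @ [0]) 0) = x" "f (vertex (\<sigma> @ [0]) 1) = a" "f (vertex (\<sigma> @ [0]) 2) = c"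
    "f (vertex (\<sigma> @ [1]) 0) = a" "f (vertex (\<sigma> @ [1]) 1) = y" "f (vertex (\<sigma> @ [1]) 2) = b"
    "f (vertex (\<sigma> @ [2]) 0) = c" "f (vertex (\<sigma> @ [2]) 1) = b" "f (vertex (\<sigma> @ [2]) 2) = z"
    unfolding defs by (simp_all only: vertex_snoc_same vertex_snoc_commute[of \<sigma> 0 2]
        vertex_snoc_commute[of \<sigma> 1 0] vertex_snoc_commute[of \<sigma> 2 1])
  have "cell_sum 0 \<sigma> (diff_sq f) = (5 / 3) ^ length \<sigma> * ((x - y)\<^sup>2 + (y - z)\<^sup>2 + (z - x)\<^sup>2)"
    unfolding cell_sum_0 s defs by simp
  also have "\<dots> \<le> (5 / 3) ^ length \<sigma> * (5 / 3 *
    ((x - a)\<^sup>2 + (x - c)\<^sup>2 + (a - c)\<^sup>2 + (y - a)\<^sup>2 + (y - b)\<^sup>2 + (a - b)\<^sup>2 + (z - b)\<^sup>2 + (z - c)\<^sup>2 + (b - c)\<^sup>2))"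
    by (intro mult_left_mono triangle_energy_le) simp
  also have "\<dots> = (5 / 3) ^ length \<sigma> * (5 / 3 *
    (((x - a)\<^sup>2 + (a - c)\<^sup>2 + (c - x)\<^sup>2) + (((a - y)\<^sup>2 + (y - b)\<^sup>2 + (b - a)\<^sup>2) + ((c - b)\<^sup>2 + (b - z)\<^sup>2 + (z - c)\<^sup>2))))"
    by (simp add: power2_commute)
  also have "\<dots> = (\<Sum>i\<in>letters. cell_sum 0 (\<sigma> @ [i]) (diff_sq f))"
    unfolding letters cell_sum_0 s v by (simp add: algebra_simps add_divide_distrib)
  also have "\<dots> = cell_sum 1 \<sigma> (diff_sq f)"
    unfolding One_nat_def cell_sum_Suc ..
  finally show ?thesis .
qed

lemma cell_energy_incseq: "incseq (\<lambda>n. cell_sum n \<sigma> (diff_sq f))"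
proof (rule incseq_SucI)
  fix n
  have "cell_sum n \<sigma> (diff_sq f) = (\<Sum>\<tau>\<in>words n. cell_sum 0 (\<sigma> @ \<tau>) (diff_sq f))"
    using cell_sum_split[of n 0] by simp
  also have "\<dots> \<le> (\<Sum>\<tau>\<in>words n. cell_sum 1 (\<sigma> @ \<tau>) (diff_sq f))"
    by (intro sum_mono cell_energy_mono_0)
  also have "\<dots> = cell_sum (Suc n) \<sigma> (diff_sq f)"
    using cell_sum_split[of n 1] by simp
  finally show "cell_sum n \<sigma> (diff_sq f) \<le> cell_sum (Suc n) \<sigma> (diff_sq f)" .
qed

lemma level_energy_eq: "level_energy n f = edge_sum n (diff_sq f)"
  by (simp only: level_energy_def edge_sum_eq)

lemma energy_eq_SUP: "energy f = (SUP n. ereal (edge_sum n (diff_sq f)))"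
proof -
  have "incseq (\<lambda>n. ereal (edge_sum n (diff_sq f)))"
    using cell_energy_incseq[of "[]" f] by (simp add: incseq_def)
  then have "(\<lambda>n. ereal (edge_sum n (diff_sq f))) \<longlonglongrightarrow> (SUP n. ereal (edge_sum n (diff_sq f)))"
    by (rule LIMSEQ_SUP)
  then show ?thesis
    unfolding energy_def level_energy_eq by (rule limI)
qed

lemma finite_energyI:
  assumes "f \<in> gasket_continuous" "\<And>n. edge_sum n (diff_sq f) \<le> B"
  shows "f \<in> finite_energy"
proof -
  have "energy f \<le> ereal B"
    unfolding energy_eq_SUP by (rule SUP_least) (use assms in simp)
  then show ?thesis
    using assms(1) by (auto simp: finite_energy_def)
qed

text \<open>The part of the energy of f that lies in the cell \<sigma>. The \<open>lim\<close>
  carries information once convergence is known, that is by \<open>mass_lim\<close> for f of finite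
  energy and \<sigma> a word.\<close>

definition mass :: "(pt \<Rightarrow> real) \<Rightarrow> nat list \<Rightarrow> real" where
  "mass f \<sigma> = lim (\<lambda>n. cell_sum n \<sigma> (diff_sq f))"

lemma energy_real:
  assumes "f \<in> finite_energy"
  shows "edge_sum n (diff_sq f) \<le> real_of_ereal (energy f)"
    and "(\<lambda>n. edge_sum n (diff_sq f)) \<longlonglongrightarrow> real_of_ereal (energy f)"
proof -
  have le: "ereal (edge_sum n (diff_sq f)) \<le> energy f" for n
    unfolding energy_eq_SUP by (rule SUP_upper) simp
  have "energy f < \<infinity>" using assms by (simp add: finite_energy_def)
  moreover have "energy f \<noteq> -\<infinity>" using le[of 0] by auto
  ultimately have fin: "energy f = ereal (real_of_ereal (energy f))"
    by (cases "energy f") auto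
  show "edge_sum n (diff_sq f) \<le> real_of_ereal (energy f)"
    using le[of n] fin by (metis ereal_less_eq(3))
  have "incseq (\<lambda>n. ereal (edge_sum n (diff_sq f)))"
    using cell_energy_incseq[of "[]" f] by (simp add: incseq_def)
  then have "(\<lambda>n. ereal (edge_sum n (diff_sq f))) \<longlonglongrightarrow> energy f"
    unfolding energy_eq_SUP by (rule LIMSEQ_SUP)
  then have "(\<lambda>n. ereal (edge_sum n (diff_sq f))) \<longlonglongrightarrow> ereal (real_of_ereal (energy f))"
    using fin by simp
  then show "(\<lambda>n. edge_sum n (diff_sq f)) \<longlonglongrightarrow> real_of_ereal (energy f)"
    by simp
qed

context
  fixes f assumes f: "f \<in> finite_energy"
begin

text \<open>The sequence is increasing, and bounded by the total energy because the other cells of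
  the level contribute nonnegative amounts.\<close>

lemma mass_lim:
  assumes "\<sigma> \<in> words m"
  shows "(\<lambda>n. cell_sum n \<sigma> (diff_sq f)) \<longlonglongrightarrow> mass f \<sigma>"
proof -
  have "cell_sum n \<sigma> (diff_sq f) \<le> real_of_ereal (energy f)" for n
  proof -
    have "cell_sum n \<sigma> (diff_sq f) \<le> (\<Sum>\<sigma>\<in>words m. cell_sum n \<sigma> (diff_sq f))"
      using assms by (intro member_le_sum) (auto intro: cell_sum_nonneg)
    also have "\<dots> = edge_sum (m + n) (diff_sq f)"
      by (simp add: cell_sum_split)
    also have "\<dots> \<le> real_of_ereal (energy f)" by (rule energy_real[OF f])
    finally show ?thesis .
  qed
  then have "\<forall>n. cell_sum n \<sigma> (diff_sq f) \<le> real_of_ereal (energy f)" ..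
  then obtain L where "(\<lambda>n. cell_sum n \<sigma> (diff_sq f)) \<longlonglongrightarrow> L"
    by (rule incseq_convergent[OF cell_energy_incseq])
  then show ?thesis unfolding mass_def by (simp add: limI)
qed

lemma cell_sum_le_mass: "\<sigma> \<in> words m \<Longrightarrow> cell_sum n \<sigma> (diff_sq f) \<le> mass f \<sigma>"
  by (rule incseq_le[OF cell_energy_incseq mass_lim])

lemma mass_nonneg: "\<sigma> \<in> words m \<Longrightarrow> 0 \<le> mass f \<sigma>"
  using cell_sum_le_mass[of \<sigma> m 0] cell_sum_nonneg[of "diff_sq f" 0 \<sigma>] by simp

lemma mass_split:
  assumes "\<sigma> \<in> words m"
  shows "mass f \<sigma> = (\<Sum>\<tau>\<in>words n. mass f (\<sigma> @ \<tau>))"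
proof (rule LIMSEQ_unique)
  show "(\<lambda>k. cell_sum (n + k) \<sigma> (diff_sq f)) \<longlonglongrightarrow> mass f \<sigma>"
    using LIMSEQ_ignore_initial_segment[OF mass_lim[OF assms], of n] by (simp add: add.commute)
  show "(\<lambda>k. cell_sum (n + k) \<sigma> (diff_sq f)) \<longlonglongrightarrow> (\<Sum>\<tau>\<in>words n. mass f (\<sigma> @ \<tau>))"
    unfolding cell_sum_split
    by (intro tendsto_sum) (rule mass_lim[OF words_append[OF assms]])
qed

lemma mass_snoc: "\<sigma> \<in> words m \<Longrightarrow> mass f \<sigma> = (\<Sum>i\<in>letters. mass f (\<sigma> @ [i]))"
  using mass_split[of \<sigma> m 1] by (simp only: sum_words_1)

lemma mass_append_le:
  assumes "\<sigma> \<in> words m" "\<tau> \<in> words n"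
  shows "mass f (\<sigma> @ \<tau>) \<le> mass f \<sigma>"
  unfolding mass_split[OF assms(1), of n]
  by (rule member_le_sum[of \<tau> "words n" "\<lambda>\<tau>. mass f (\<sigma> @ \<tau>)"])
    (use assms mass_nonneg words_append in blast)+

text \<open>A single edge contributes at most the coarsest sum of its cell, and the sums of the cell
  increase to the mass. The factor (3/5)^m undoes the renormalisation.\<close>

lemma edge_diff_sq_le_mass:
  assumes "\<sigma> \<in> words m" "(i, j) \<in> sides"
  shows "(f (vertex \<sigma> j) - f (vertex \<sigma> i))\<^sup>2 \<le> (3 / 5) ^ m * mass f \<sigma>"
proof -
  have "(f (vertex \<sigma> j) - f (vertex \<sigma> i))\<^sup>2 \<le> (3 / 5) ^ m * cell_sum 0 \<sigma> (diff_sq f)"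
    using edge_diff_sq_le_cell_sum[OF assms(2), of f \<sigma>] by (simp add: length_words[OF assms(1)])
  also have "\<dots> \<le> (3 / 5) ^ m * mass f \<sigma>"
    by (intro mult_left_mono cell_sum_le_mass[OF assms(1)]) simp
  finally show ?thesis .
qed

text \<open>Telescoping along one edge of each level; \<open>sqrt (3/5) \<le> 4/5\<close> makes the bounds geometric.\<close>

lemma cell_oscillation:
  assumes \<sigma>: "\<sigma> \<in> words m" and \<tau>: "\<tau> \<in> words n" and k: "k \<in> letters" and j: "j \<in> letters"
  shows "\<bar>f (vertex (\<sigma> @ \<tau>) k) - f (vertex \<sigma> j)\<bar> \<le> 5 * sqrt ((3 / 5) ^ m * mass f \<sigma>)"
proof -
  define s where "s = sqrt ((3 / 5) ^ m * mass f \<sigma>)"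
  have s0: "0 \<le> (3 / 5) ^ m * mass f \<sigma>" using mass_nonneg[OF \<sigma>] by simp
  then have s: "0 \<le> s" "s\<^sup>2 = (3 / 5) ^ m * mass f \<sigma>" by (simp_all add: s_def)
  have step: "\<bar>f (vertex (\<sigma> @ \<tau>) k) - f (vertex (\<sigma> @ \<tau>) l)\<bar> \<le> (4 / 5) ^ n * s"
    if "\<tau> \<in> words n" "k \<in> letters" "l \<in> letters" for \<tau> n k l
  proof (cases "k = l")
    case True
    then show ?thesis using s by simp
  next
    case False
    have w: "\<sigma> @ \<tau> \<in> words (m + n)" using words_append[OF \<sigma> that(1)] .
    have "(f (vertex (\<sigma> @ \<tau>) k) - f (vertex (\<sigma> @ \<tau>) l))\<^sup>2 \<le> (3 / 5) ^ (m + n) * mass f (\<sigma> @ \<tau>)"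
      using edge_diff_sq_le_mass[OF w, of l k] that False by (auto simp: sides_iff)
    also have "\<dots> \<le> (3 / 5) ^ (m + n) * mass f \<sigma>"
      by (intro mult_left_mono mass_append_le[OF \<sigma> that(1)]) simp
    also have "\<dots> = (3 / 5) ^ n * s\<^sup>2" by (simp add: s power_add)
    also have "\<dots> \<le> (16 / 25) ^ n * s\<^sup>2" by (intro mult_right_mono power_mono) simp_all
    also have "(16 / 25 :: real) ^ n = ((4 / 5)\<^sup>2) ^ n" by (simp add: power_divide)
    also have "\<dots> * s\<^sup>2 = ((4 / 5) ^ n * s)\<^sup>2"
      by (simp only: power_mult_distrib power_mult[symmetric] mult.commute)
    finally have "\<bar>f (vertex (\<sigma> @ \<tau>) k) - f (vertex (\<sigma> @ \<tau>) l)\<bar> \<le> \<bar>(4 / 5) ^ n * s\<bar>"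
      by (simp only: abs_le_square_iff)
    then show ?thesis using s by simp
  qed
  \<comment> \<open>The factor 5 - 4 (4/5)^n is the geometric sum of (4/5)^l over l \<le> n: one
    change of corner at each level from 0 to n.\<close>
  have "\<bar>f (vertex (\<sigma> @ \<tau>) k) - f (vertex \<sigma> j)\<bar> \<le> (5 - 4 * (4 / 5) ^ n) * s"
    using \<tau> k
  proof (induction \<tau> arbitrary: n k rule: rev_induct)
    case Nil
    then have "n = 0" by (simp add: words_def)
    then show ?case using step[of "[]" 0 k j] Nil j by simp
  next
    case (snoc i \<tau>)
    then obtain n' where n: "n = Suc n'" and \<tau>: "\<tau> \<in> words n'" and i: "i \<in> letters"
      by (cases n) (auto simp: words_def)
    have "\<bar>f (vertex (\<sigma> @ \<tau> @ [i]) k) - f (vertex (\<sigma> @ \<tau> @ [i]) i)\<bar> \<le> (4 / 5) ^ n * s"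
      using step[OF snoc.prems(1,2) i] .
    moreover have "vertex (\<sigma> @ \<tau> @ [i]) i = vertex (\<sigma> @ \<tau>) i"
      using vertex_snoc_same[of "\<sigma> @ \<tau>" i] by simp
    moreover have "\<bar>f (vertex (\<sigma> @ \<tau>) i) - f (vertex \<sigma> j)\<bar> \<le> (5 - 4 * (4 / 5) ^ n') * s"
      by (rule snoc.IH[OF \<tau> i])
    ultimately have "\<bar>f (vertex (\<sigma> @ \<tau> @ [i]) k) - f (vertex \<sigma> j)\<bar> \<le> (4 / 5) ^ n * s + (5 - 4 * (4 / 5) ^ n') * s"
      by simp
    also have "\<dots> = (5 - 4 * (4 / 5) ^ n) * s"
      by (simp add: n algebra_simps)
    finally show ?case .
  qed
  also have "\<dots> \<le> 5 * s" using s by (intro mult_right_mono) simp_all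
  finally show ?thesis by (simp add: s_def)
qed

end

section \<open>The algebra of functions of finite energy\<close>

lemma edge_sum_mono:
  assumes "\<And>a b. a \<in> gasket \<Longrightarrow> b \<in> gasket \<Longrightarrow> \<phi> a b \<le> \<psi> a b"
  shows "edge_sum n \<phi> \<le> edge_sum n \<psi>"
  by (rule cell_sum_mono) (use assms vertex_in_gasket in \<open>auto simp: sides_iff\<close>)

lemma edge_sum_cong:
  assumes "\<And>a b. a \<in> gasket \<Longrightarrow> b \<in> gasket \<Longrightarrow> \<phi> a b = \<psi> a b"
  shows "edge_sum n \<phi> = edge_sum n \<psi>"
  by (intro antisym edge_sum_mono) (simp_all add: assms)

lemma finite_energy_continuous: "f \<in> finite_energy \<Longrightarrow> continuous_on gasket f"
  by (simp add: finite_energy_def gasket_continuous_def)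

lemma finite_energy_outside: "f \<in> finite_energy \<Longrightarrow> x \<notin> gasket \<Longrightarrow> f x = 0"
  by (simp add: finite_energy_def gasket_continuous_def)

lemma finite_energy_bounded:
  assumes "f \<in> finite_energy"
  obtains M where "0 \<le> M" "\<And>x. \<bar>f x\<bar> \<le> M"
proof -
  have "bounded (f ` gasket)"
    using compact_continuous_image[OF finite_energy_continuous[OF assms] compact_gasket]
    by (rule compact_imp_bounded)
  then obtain M where M: "\<And>x. x \<in> gasket \<Longrightarrow> \<bar>f x\<bar> \<le> M"
    unfolding bounded_iff by auto
  show thesis
  proof (rule that[of "max M 0"])
    show "\<bar>f x\<bar> \<le> max M 0" for x
      using M[of x] finite_energy_outside[OF assms, of x] by (cases "x \<in> gasket") auto
  qed simp
qed

lemma finite_energy_one: "gasket_one \<in> finite_energy"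
proof (rule finite_energyI)
  have "continuous_on gasket gasket_one"
    by (rule continuous_on_eq[of _ "\<lambda>_. 1"]) (auto simp: gasket_one_def)
  then show "gasket_one \<in> gasket_continuous"
    by (simp add: gasket_continuous_def gasket_one_def)
  show "edge_sum n (diff_sq gasket_one) \<le> 0" for n
    using edge_sum_mono[of "diff_sq gasket_one" "\<lambda>a b. 0" n] by (simp add: gasket_one_def)
qed

lemma finite_energy_add:
  assumes f: "f \<in> finite_energy" and g: "g \<in> finite_energy"
  shows "f + g \<in> finite_energy"
proof (rule finite_energyI)
  show "f + g \<in> gasket_continuous"
    using assms by (auto simp: finite_energy_def gasket_continuous_def plus_fun_def intro: continuous_on_add)
  fix n
  have "edge_sum n (diff_sq (f + g)) \<le> edge_sum n (\<lambda>a b. 2 * diff_sq f a b + 2 * diff_sq g a b)"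
  proof (rule edge_sum_mono)
    fix a b
    show "diff_sq (f + g) a b \<le> 2 * diff_sq f a b + 2 * diff_sq g a b"
      using zero_le_power2[of "(f b - f a) - (g b - g a)"]
      by (simp add: power2_eq_square algebra_simps)
  qed
  also have "\<dots> = 2 * edge_sum n (diff_sq f) + 2 * edge_sum n (diff_sq g)"
    by (simp only: cell_sum_add cell_sum_mult)
  also have "\<dots> \<le> 2 * real_of_ereal (energy f) + 2 * real_of_ereal (energy g)"
    using energy_real(1)[OF f, of n] energy_real(1)[OF g, of n] by simp
  finally show "edge_sum n (diff_sq (f + g)) \<le> 2 * real_of_ereal (energy f) + 2 * real_of_ereal (energy g)" .
qed

lemma finite_energy_scale:
  assumes f: "f \<in> finite_energy"
  shows "c *\<^sub>R f \<in> finite_energy"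
proof (rule finite_energyI)
  show "c *\<^sub>R f \<in> gasket_continuous"
    using assms by (auto simp: finite_energy_def gasket_continuous_def scaleR_fun_def intro!: continuous_intros)
  fix n
  have "edge_sum n (diff_sq (c *\<^sub>R f)) = edge_sum n (\<lambda>a b. c\<^sup>2 * diff_sq f a b)"
    by (rule edge_sum_cong) (simp add: power_mult_distrib flip: right_diff_distrib)
  also have "\<dots> \<le> c\<^sup>2 * real_of_ereal (energy f)"
    using energy_real(1)[OF f, of n] by (simp only: cell_sum_mult) (intro mult_left_mono, simp_all)
  finally show "edge_sum n (diff_sq (c *\<^sub>R f)) \<le> c\<^sup>2 * real_of_ereal (energy f)" .
qed

lemma finite_energy_mult:
  assumes f: "f \<in> finite_energy" and g: "g \<in> finite_energy"
  shows "f * g \<in> finite_energy"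
proof -
  obtain M where M: "0 \<le> M" "\<And>x. \<bar>f x\<bar> \<le> M" using finite_energy_bounded[OF f] by blast
  obtain N where N: "0 \<le> N" "\<And>x. \<bar>g x\<bar> \<le> N" using finite_energy_bounded[OF g] by blast
  show ?thesis
  proof (rule finite_energyI)
    show "f * g \<in> gasket_continuous"
      using assms by (auto simp: finite_energy_def gasket_continuous_def times_fun_def intro: continuous_on_mult)
    fix n
    have "edge_sum n (diff_sq (f * g)) \<le> edge_sum n (\<lambda>a b. (2 * N\<^sup>2) * diff_sq f a b + (2 * M\<^sup>2) * diff_sq g a b)"
    proof (rule edge_sum_mono)
      fix a b
      \<comment> \<open>Discrete Leibniz rule, with the two undifferentiated factors taken at
        opposite end points.\<close>
      have eq: "(f * g) b - (f * g) a = f b * (g b - g a) + g a * (f b - f a)"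
        by (simp add: algebra_simps)
      have "diff_sq (f * g) a b \<le> 2 * (f b * (g b - g a))\<^sup>2 + 2 * (g a * (f b - f a))\<^sup>2"
        unfolding eq using zero_le_power2[of "f b * (g b - g a) - g a * (f b - f a)"]
        by (simp only: power2_sum power2_diff)
      also have "\<dots> = (2 * (g a)\<^sup>2) * diff_sq f a b + (2 * (f b)\<^sup>2) * diff_sq g a b"
        by (simp add: power_mult_distrib)
      also have "\<dots> \<le> (2 * N\<^sup>2) * diff_sq f a b + (2 * M\<^sup>2) * diff_sq g a b"
      proof -
        have "(g a)\<^sup>2 \<le> N\<^sup>2" "(f b)\<^sup>2 \<le> M\<^sup>2"
          using M N by (metis abs_le_square_iff abs_of_nonneg)+
        then show ?thesis by (intro add_mono mult_right_mono) simp_all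
      qed
      finally show "diff_sq (f * g) a b \<le> (2 * N\<^sup>2) * diff_sq f a b + (2 * M\<^sup>2) * diff_sq g a b" .
    qed
    also have "\<dots> = (2 * N\<^sup>2) * edge_sum n (diff_sq f) + (2 * M\<^sup>2) * edge_sum n (diff_sq g)"
      by (simp only: cell_sum_add cell_sum_mult)
    also have "\<dots> \<le> (2 * N\<^sup>2) * real_of_ereal (energy f) + (2 * M\<^sup>2) * real_of_ereal (energy g)"
      by (intro add_mono mult_left_mono energy_real(1) f g) simp_all
    finally show "edge_sum n (diff_sq (f * g)) \<le> (2 * N\<^sup>2) * real_of_ereal (energy f) + (2 * M\<^sup>2) * real_of_ereal (energy g)" .
  qed
qed

lemma subspace_finite_energy: "subspace finite_energy"
  unfolding subspace_def
  using finite_energy_add finite_energy_scale finite_energy_scale[OF finite_energy_one, of 0] by simp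

lemmas finite_energy_intros = finite_energy_add finite_energy_scale finite_energy_mult finite_energy_one
  subspace_diff[OF subspace_finite_energy] subspace_0[OF subspace_finite_energy]

lemma finite_energy_mult_one: "f \<in> finite_energy \<Longrightarrow> f * gasket_one = f"
  using finite_energy_outside by (fastforce simp: gasket_one_def fun_eq_iff indicator_def)

lemma energy_form_lim:
  assumes f: "f \<in> finite_energy" and g: "g \<in> finite_energy"
  shows "(\<lambda>n. edge_sum n (\<lambda>a b. (f b - f a) * (g b - g a))) \<longlonglongrightarrow> energy_form f g"
proof -
  have "edge_sum n (\<lambda>a b. (f b - f a) * (g b - g a))
    = (edge_sum n (diff_sq (f + g)) - edge_sum n (diff_sq (f - g))) / 4" for n
  proof -
    have "edge_sum n (\<lambda>a b. (f b - f a) * (g b - g a))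
        = edge_sum n (\<lambda>a b. (1 / 4) * (diff_sq (f + g) a b - diff_sq (f - g) a b))"
      by (rule edge_sum_cong) (simp add: power2_eq_square algebra_simps)
    then show ?thesis by (simp only: cell_sum_mult cell_sum_diff)
  qed
  moreover have "(\<lambda>n. (edge_sum n (diff_sq (f + g)) - edge_sum n (diff_sq (f - g))) / 4) \<longlonglongrightarrow> energy_form f g"
    unfolding energy_form_def by (intro tendsto_intros energy_real(2) finite_energy_intros f g) simp
  ultimately show ?thesis by (simp only:)
qed

text \<open>The value prescribed for the integral of h against the energy measure of f and
  g.\<close>

definition measure_form :: "(pt \<Rightarrow> real) \<Rightarrow> (pt \<Rightarrow> real) \<Rightarrow> (pt \<Rightarrow> real) \<Rightarrow> real" where
  "measure_form f g h = (1 / 2) * (energy_form f (g * h) - energy_form (f * g) h + energy_form (h * f) g)"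

text \<open>The three products telescope on every edge into a single one, weighted by the mean of \<open>h\<close>.\<close>

lemma measure_form_lim:
  assumes f: "f \<in> finite_energy" and g: "g \<in> finite_energy" and h: "h \<in> finite_energy"
  shows "(\<lambda>n. edge_sum n (\<lambda>a b. (f b - f a) * (g b - g a) * ((h a + h b) / 2))) \<longlonglongrightarrow> measure_form f g h"
proof -
  let ?p = "\<lambda>f g a b. (f b - f a) * (g b - g a)"
  have "edge_sum n (\<lambda>a b. (f b - f a) * (g b - g a) * ((h a + h b) / 2))
    = (1 / 2) * (edge_sum n (?p f (g * h)) - edge_sum n (?p (f * g) h) + edge_sum n (?p (h * f) g))" for n
  proof -
    have "edge_sum n (\<lambda>a b. (f b - f a) * (g b - g a) * ((h a + h b) / 2))
        = edge_sum n (\<lambda>a b. (1 / 2) * (?p f (g * h) a b - ?p (f * g) h a b + ?p (h * f) g a b))"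
      by (rule edge_sum_cong) (simp add: algebra_simps add_divide_distrib)
    then show ?thesis by (simp only: cell_sum_mult cell_sum_diff cell_sum_add)
  qed
  moreover have "(\<lambda>n. (1 / 2) * (edge_sum n (?p f (g * h)) - edge_sum n (?p (f * g) h) + edge_sum n (?p (h * f) g)))
      \<longlonglongrightarrow> measure_form f g h"
    unfolding measure_form_def by (intro tendsto_intros energy_form_lim finite_energy_intros f g h)
  ultimately show ?thesis by (simp only:)
qed

section \<open>Energy measures\<close>

text \<open>The total mass of the cells of the level of \<sigma> that precede \<sigma>
  lexicographically, grouped by the first position k in which they differ from \<sigma>.\<close>

definition left_end :: "(pt \<Rightarrow> real) \<Rightarrow> nat list \<Rightarrow> real" where
  "left_end f \<sigma> = (\<Sum>k<length \<sigma>. \<Sum>j<\<sigma> ! k. mass f (take k \<sigma> @ [j]))"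

text \<open>Half-open, so that the intervals of the three subcells partition the interval of a cell;
  a cell without mass gets the empty interval.\<close>

definition cell_interval :: "(pt \<Rightarrow> real) \<Rightarrow> nat list \<Rightarrow> real set" where
  "cell_interval f \<sigma> = {left_end f \<sigma>..<left_end f \<sigma> + mass f \<sigma>}"

text \<open>The address of the cell of level n whose interval contains x. The comparisons produce a
  word for every real x, also outside the total interval, so that \<open>quantile\<close> is a point
  of the gasket everywhere.\<close>

primrec pick :: "(pt \<Rightarrow> real) \<Rightarrow> real \<Rightarrow> nat \<Rightarrow> nat list" where
  "pick f x 0 = []"
| "pick f x (Suc n) = pick f x n @
    [if x < left_end f (pick f x n @ [1]) then 0 else if x < left_end f (pick f x n @ [2]) then 1 else 2]"

text \<open>The point common to the nested cells addressed by x, a generalised inverse of the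
  distribution function of the energy. Since the cells shrink, following their corner 0 is
  enough.\<close>

definition quantile :: "(pt \<Rightarrow> real) \<Rightarrow> real \<Rightarrow> pt" where
  "quantile f x = lim (\<lambda>n. vertex (pick f x n) 0)"

text \<open>The energy measure \<open>\<mu>(f, f)\<close> as an image of Lebesgue measure: the interval \<open>[0, \<E>[f])\<close>
  is subdivided into one interval per word, whose length is the energy of the cell.\<close>

definition quantile_measure :: "(pt \<Rightarrow> real) \<Rightarrow> pt measure" where
  "quantile_measure f = distr (restrict_space lborel (cell_interval f [])) (restrict_space borel gasket) (quantile f)"

lemma abs_diff_mean_le: "\<bar>y - x\<bar> \<le> e \<Longrightarrow> \<bar>z - x\<bar> \<le> e \<Longrightarrow> \<bar>x - (y + z) / 2\<bar> \<le> (e :: real)"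
  by (simp add: abs_le_iff field_simps)

lemma left_end_Nil [simp]: "left_end f [] = 0"
  by (simp add: left_end_def)

lemma left_end_snoc: "left_end f (\<sigma> @ [i]) = left_end f \<sigma> + (\<Sum>j<i. mass f (\<sigma> @ [j]))"
proof -
  have "left_end f (\<sigma> @ [i])
    = (\<Sum>k<length \<sigma>. \<Sum>j<(\<sigma> @ [i]) ! k. mass f (take k (\<sigma> @ [i]) @ [j])) + (\<Sum>j<i. mass f (\<sigma> @ [j]))"
    by (simp add: left_end_def)
  also have "(\<Sum>k<length \<sigma>. \<Sum>j<(\<sigma> @ [i]) ! k. mass f (take k (\<sigma> @ [i]) @ [j])) = left_end f \<sigma>"
    unfolding left_end_def by (rule sum.cong) (simp_all add: nth_append)
  finally show ?thesis .
qed

lemma left_end_snoc_letters: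
  "left_end f (\<sigma> @ [0]) = left_end f \<sigma>"
  "left_end f (\<sigma> @ [1]) = left_end f \<sigma> + mass f (\<sigma> @ [0])"
  "left_end f (\<sigma> @ [2]) = left_end f \<sigma> + mass f (\<sigma> @ [0]) + mass f (\<sigma> @ [1])"
  by (simp_all add: left_end_snoc numeral_2_eq_2)

lemma words_snoc: "\<sigma> \<in> words n \<Longrightarrow> i \<in> letters \<Longrightarrow> \<sigma> @ [i] \<in> words (Suc n)"
  by (simp add: words_def)

lemma pick_in_words: "pick f x n \<in> words n"
proof (induction n)
  case (Suc n)
  then show ?case unfolding pick.simps by (intro words_snoc) simp_all
qed simp

lemma pick_add: "\<exists>\<tau>\<in>words k. pick f x (n + k) = pick f x n @ \<tau>"
proof (induction k)
  case (Suc k)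
  then obtain \<tau> where \<tau>: "\<tau> \<in> words k" "pick f x (n + k) = pick f x n @ \<tau>" by blast
  show ?case
    unfolding add_Suc_right pick.simps \<tau>(2) append_assoc
    by (rule bexI, rule refl) (intro words_snoc \<tau>(1), simp)
qed simp

lemma dist_pick: "dist (vertex (pick f x (n + k)) 0) (vertex (pick f x n) 0) \<le> 2 / 2 ^ n"
  using pick_add[of k f x n] dist_vertex_append[of "pick f x n" _ 0 0] length_words[OF pick_in_words[of f x n]]
  by auto

lemma eventually_two_div_power: "0 < \<epsilon> \<Longrightarrow> \<exists>N. \<forall>n\<ge>N. 2 / 2 ^ n < (\<epsilon> :: real)"
proof -
  assume "0 < \<epsilon>"
  have "(\<lambda>n. 2 * (1 / 2) ^ n) \<longlonglongrightarrow> (2 * 0 :: real)"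
    by (intro tendsto_intros LIMSEQ_power_zero) simp
  then have "\<forall>\<^sub>F n in sequentially. 2 * (1 / 2) ^ n < \<epsilon>"
    using \<open>0 < \<epsilon>\<close> by (intro order_tendstoD(2)) simp_all
  then show ?thesis by (simp add: eventually_sequentially power_divide)
qed

lemma pick_lim: "(\<lambda>n. vertex (pick f x n) 0) \<longlonglongrightarrow> quantile f x"
proof -
  have "Cauchy (\<lambda>n. vertex (pick f x n) 0)"
    unfolding Cauchy_altdef
  proof (intro allI impI)
    fix \<epsilon> :: real assume "0 < \<epsilon>"
    then obtain N where N: "\<And>n. N \<le> n \<Longrightarrow> 2 / 2 ^ n < \<epsilon>"
      using eventually_two_div_power by blast
    have "dist (vertex (pick f x m) 0) (vertex (pick f x n) 0) < \<epsilon>" if "N \<le> m" "m < n" for m n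
      using dist_pick[of f x m "n - m"] N[OF that(1)] that(2) by (simp add: dist_commute)
    then show "\<exists>N. \<forall>m\<ge>N. \<forall>n>m. dist (vertex (pick f x m) 0) (vertex (pick f x n) 0) < \<epsilon>"
      by blast
  qed
  then show ?thesis
    unfolding quantile_def by (simp add: Cauchy_convergent_iff convergent_LIMSEQ_iff)
qed

lemma vertex_pick_in_gasket: "vertex (pick f x n) 0 \<in> gasket"
  by (rule vertex_in_gasket[OF pick_in_words]) simp

lemma quantile_in_gasket: "quantile f x \<in> gasket"
  by (rule closed_sequentially[OF compact_imp_closed[OF compact_gasket] vertex_pick_in_gasket pick_lim])

context
  fixes f assumes f: "f \<in> finite_energy"
begin

lemma mass_snoc_letters:
  assumes "\<sigma> \<in> words n"
  shows "mass f \<sigma> = mass f (\<sigma> @ [0]) + mass f (\<sigma> @ [1]) + mass f (\<sigma> @ [2])"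
  using mass_snoc[OF f assms] by simp

lemma mass_snoc_nonneg:
  assumes "\<sigma> \<in> words n"
  shows "0 \<le> mass f (\<sigma> @ [0])" "0 \<le> mass f (\<sigma> @ [1])" "0 \<le> mass f (\<sigma> @ [2])"
  by (rule mass_nonneg[OF f words_snoc[OF assms]]; simp)+

lemma cell_interval_snoc_subset:
  assumes "\<sigma> \<in> words n" "i \<in> letters"
  shows "cell_interval f (\<sigma> @ [i]) \<subseteq> cell_interval f \<sigma>"
proof -
  have "left_end f \<sigma> \<le> left_end f (\<sigma> @ [i])
    \<and> left_end f (\<sigma> @ [i]) + mass f (\<sigma> @ [i]) \<le> left_end f \<sigma> + mass f \<sigma>"
    using assms(2) mass_snoc_letters[OF assms(1)] mass_snoc_nonneg[OF assms(1)]
      left_end_snoc_letters[of f \<sigma>] by auto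
  then show ?thesis unfolding cell_interval_def by auto
qed

lemma pick_interval:
  assumes "x \<in> cell_interval f []"
  shows "x \<in> cell_interval f (pick f x n)"
proof (induction n)
  case 0
  then show ?case using assms by simp
next
  case (Suc n)
  then show ?case
    using mass_snoc_letters[OF pick_in_words[of f x n]] left_end_snoc_letters[of f "pick f x n"]
    by (auto simp: cell_interval_def)
qed

text \<open>Together with \<open>pick_interval\<close> this identifies the fibres of
  \<open>pick\<close> at level n with the intervals of the cells; the left ends that
  \<open>pick\<close> compares with are the points separating them.\<close>

lemma pick_eq:
  assumes "\<sigma> \<in> words n" "x \<in> cell_interval f \<sigma>"
  shows "pick f x n = \<sigma> \<and> x \<in> cell_interval f []"
  using assms
proof (induction \<sigma> arbitrary: n rule: rev_induct)
  case Nil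
  then have "n = 0" by (simp add: words_def)
  then show ?case using Nil by simp
next
  case (snoc i \<sigma>)
  then obtain m where n: "n = Suc m" and \<sigma>: "\<sigma> \<in> words m" and i: "i \<in> letters"
    by (cases n) (auto simp: words_def)
  have "x \<in> cell_interval f \<sigma>"
    using cell_interval_snoc_subset[OF \<sigma> i] snoc.prems(2) by blast
  then have p: "pick f x m = \<sigma>" "x \<in> cell_interval f []"
    using snoc.IH[OF \<sigma>] by simp_all
  show ?case
    using i snoc.prems(2) p left_end_snoc_letters[of f \<sigma>] mass_snoc_nonneg[OF \<sigma>]
    by (auto simp: n cell_interval_def)
qed

text \<open>A function of the address of level n is a step function on intervals. Values in a vector
  space are allowed because this serves both for the vertices, in the proof of measurability, and
  for real functions, in the computation of integrals.\<close>

lemma indicator_pick: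
  fixes \<phi> :: "nat list \<Rightarrow> 'a::real_vector"
  shows "indicator (cell_interval f []) x *\<^sub>R \<phi> (pick f x n)
    = (\<Sum>\<sigma>\<in>words n. indicator (cell_interval f \<sigma>) x *\<^sub>R \<phi> \<sigma>)"
proof (cases "x \<in> cell_interval f []")
  case True
  have "(\<Sum>\<sigma>\<in>words n. indicator (cell_interval f \<sigma>) x *\<^sub>R \<phi> \<sigma>)
    = (\<Sum>\<sigma>\<in>words n. if \<sigma> = pick f x n then \<phi> \<sigma> else 0)"
  proof (rule sum.cong[OF refl])
    fix \<sigma> assume \<sigma>: "\<sigma> \<in> words n"
    have "x \<in> cell_interval f \<sigma> \<longleftrightarrow> \<sigma> = pick f x n"
      using pick_eq[OF \<sigma>, of x] pick_interval[OF True, of n] by metis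
    then show "indicator (cell_interval f \<sigma>) x *\<^sub>R \<phi> \<sigma> = (if \<sigma> = pick f x n then \<phi> \<sigma> else 0)"
      by (simp add: indicator_def)
  qed
  then show ?thesis using True by (simp add: pick_in_words)
next
  case False
  then have "indicator (cell_interval f \<sigma>) x *\<^sub>R \<phi> \<sigma> = 0" if "\<sigma> \<in> words n" for \<sigma>
    using pick_eq[OF that, of x] by (auto simp: indicator_def)
  then have "(\<Sum>\<sigma>\<in>words n. indicator (cell_interval f \<sigma>) x *\<^sub>R \<phi> \<sigma>) = 0"
    by (rule sum.neutral[OF ballI])
  then show ?thesis using False by simp
qed

abbreviation "interval_space \<equiv> restrict_space lborel (cell_interval f [])"

lemma space_interval_space: "space interval_space = cell_interval f []"
  by (simp add: space_restrict_space)

lemma finite_interval_space: "finite_measure interval_space"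
proof (rule finite_measureI)
  have "emeasure interval_space (cell_interval f []) = emeasure lborel (cell_interval f [])"
    by (rule emeasure_restrict_space) (simp_all add: cell_interval_def)
  then show "emeasure interval_space (space interval_space) \<noteq> \<infinity>"
    unfolding space_interval_space using mass_nonneg[OF f, of "[]" 0] by (simp add: cell_interval_def)
qed

lemma pick_integral: "(\<integral>x. \<phi> (pick f x n) \<partial>interval_space) = (\<Sum>\<sigma>\<in>words n. mass f \<sigma> * \<phi> \<sigma>)"
  for \<phi> :: "nat list \<Rightarrow> real"
proof -
  have "(\<integral>x. \<phi> (pick f x n) \<partial>interval_space)
    = (\<integral>x. indicator (cell_interval f []) x *\<^sub>R \<phi> (pick f x n) \<partial>lborel)"
    by (rule integral_restrict_space) (simp add: cell_interval_def)
  also have "\<dots> = (\<integral>x. (\<Sum>\<sigma>\<in>words n. indicator (cell_interval f \<sigma>) x *\<^sub>R \<phi> \<sigma>) \<partial>lborel)"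
    by (simp only: indicator_pick)
  also have "\<dots> = (\<Sum>\<sigma>\<in>words n. mass f \<sigma> * \<phi> \<sigma>)"
  proof (subst Bochner_Integration.integral_sum)
    fix \<sigma> assume \<sigma>: "\<sigma> \<in> words n"
    show "integrable lborel (\<lambda>x. indicator (cell_interval f \<sigma>) x *\<^sub>R \<phi> \<sigma>)"
      using mass_nonneg[OF f \<sigma>] by (auto simp: cell_interval_def)
  next
    show "(\<Sum>\<sigma>\<in>words n. \<integral>x. indicator (cell_interval f \<sigma>) x *\<^sub>R \<phi> \<sigma> \<partial>lborel) = (\<Sum>\<sigma>\<in>words n. mass f \<sigma> * \<phi> \<sigma>)"
    proof (rule sum.cong[OF refl])
      fix \<sigma> assume \<sigma>: "\<sigma> \<in> words n"
      show "(\<integral>x. indicator (cell_interval f \<sigma>) x *\<^sub>R \<phi> \<sigma> \<partial>lborel) = mass f \<sigma> * \<phi> \<sigma>"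
        using mass_nonneg[OF f \<sigma>] by (simp add: cell_interval_def)
    qed
  qed
  finally show ?thesis .
qed

lemma pick_measurable: "(\<lambda>x. vertex (pick f x n) 0) \<in> measurable interval_space (restrict_space borel gasket)"
proof (rule measurable_restrict_space2)
  have "(\<lambda>x. \<Sum>\<sigma>\<in>words n. indicator (cell_interval f \<sigma>) x *\<^sub>R vertex \<sigma> 0) \<in> borel_measurable lborel"
    by (intro borel_measurable_sum borel_measurable_scaleR borel_measurable_indicator borel_measurable_const)
      (simp add: cell_interval_def)
  then have "(\<lambda>x. \<Sum>\<sigma>\<in>words n. indicator (cell_interval f \<sigma>) x *\<^sub>R vertex \<sigma> 0) \<in> borel_measurable interval_space"
    by (rule measurable_restrict_space1)
  then show "(\<lambda>x. vertex (pick f x n) 0) \<in> borel_measurable interval_space"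
  proof (rule measurable_cong[THEN iffD1, rotated])
    fix x assume "x \<in> space interval_space"
    then have "x \<in> cell_interval f []" by (simp add: space_interval_space)
    then show "(\<Sum>\<sigma>\<in>words n. indicator (cell_interval f \<sigma>) x *\<^sub>R vertex \<sigma> 0) = vertex (pick f x n) 0"
      using indicator_pick[of x "\<lambda>\<sigma>. vertex \<sigma> 0" n] by simp
  qed
qed (use vertex_pick_in_gasket in auto)

lemma quantile_measurable: "quantile f \<in> measurable interval_space (restrict_space borel gasket)"
proof (rule measurable_restrict_space2)
  show "quantile f \<in> borel_measurable interval_space"
    by (rule borel_measurable_LIMSEQ_metric[OF _ pick_lim])
      (use pick_measurable in \<open>simp add: measurable_restrict_space2_iff\<close>)
qed (use quantile_in_gasket in auto)

text \<open>Riemann sums for the energy measure. By uniform continuity h may be replaced on a small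
  cell by its value at a corner, with an error relative to the energy of the cell.\<close>

lemma sum_mass_lim:
  assumes h: "h \<in> finite_energy"
  shows "(\<lambda>n. \<Sum>\<sigma>\<in>words n. mass f \<sigma> * h (vertex \<sigma> 0)) \<longlonglongrightarrow> measure_form f f h"
proof (rule LIMSEQ_I)
  fix \<epsilon> :: real assume \<epsilon>: "0 < \<epsilon>"
  define E where "E = mass f []"
  have E: "0 \<le> E" unfolding E_def using mass_nonneg[OF f, of "[]" 0] by simp
  \<comment> \<open>The summand 1 keeps \<eta> E < \<epsilon> valid for E = 0.\<close>
  define \<eta> where "\<eta> = \<epsilon> / (E + 1)"
  have \<eta>: "0 < \<eta>" "\<eta> * E < \<epsilon>" using \<epsilon> E by (simp_all add: \<eta>_def field_simps)
  have "uniformly_continuous_on gasket h"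
    by (rule compact_uniformly_continuous[OF finite_energy_continuous[OF h] compact_gasket])
  then obtain \<delta> where \<delta>: "0 < \<delta>"
    "\<And>x y. x \<in> gasket \<Longrightarrow> y \<in> gasket \<Longrightarrow> dist y x < \<delta> \<Longrightarrow> dist (h y) (h x) < \<eta>"
    using \<eta>(1) unfolding uniformly_continuous_on_def by metis
  obtain N where N: "\<And>n. N \<le> n \<Longrightarrow> 2 / 2 ^ n < \<delta>"
    using eventually_two_div_power[OF \<delta>(1)] by blast
  have "norm ((\<Sum>\<sigma>\<in>words n. mass f \<sigma> * h (vertex \<sigma> 0)) - measure_form f f h) < \<epsilon>" if n: "N \<le> n" for n
  proof -
    let ?\<phi> = "\<lambda>a b. diff_sq f a b * ((h a + h b) / 2)"
    have close: "\<bar>h (vertex (\<sigma> @ \<tau>) i) - h (vertex \<sigma> 0)\<bar> \<le> \<eta>"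
      if "\<sigma> \<in> words n" "\<tau> \<in> words k" "i \<in> letters" for \<sigma> \<tau> i k
    proof -
      have "dist (vertex (\<sigma> @ \<tau>) i) (vertex \<sigma> 0) < \<delta>"
        using dist_vertex_append[of \<sigma> \<tau> i 0] N[OF n] length_words[OF that(1)] by simp
      then show ?thesis
        using \<delta>(2)[OF vertex_in_gasket[OF that(1)] vertex_in_gasket[OF words_append[OF that(1,2)] that(3)], of 0]
        by (simp add: dist_real_def)
    qed
    \<comment> \<open>The estimate is uniform in the refinement k, so k may tend to infinity with n
      fixed: the cell sums become masses and the sum over edges becomes
      \<open>measure_form\<close>.\<close>
    have "\<bar>(\<Sum>\<sigma>\<in>words n. cell_sum k \<sigma> (diff_sq f) * h (vertex \<sigma> 0)) - edge_sum (n + k) ?\<phi>\<bar> \<le> \<eta> * E" for k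
    proof -
      have cell: "\<bar>cell_sum k \<sigma> (diff_sq f) * h (vertex \<sigma> 0) - cell_sum k \<sigma> ?\<phi>\<bar> \<le> \<eta> * cell_sum k \<sigma> (diff_sq f)"
        if \<sigma>: "\<sigma> \<in> words n" for \<sigma>
      proof -
        have "cell_sum k \<sigma> (diff_sq f) * h (vertex \<sigma> 0) - cell_sum k \<sigma> ?\<phi>
          = cell_sum k \<sigma> (\<lambda>a b. h (vertex \<sigma> 0) * diff_sq f a b - ?\<phi> a b)"
          by (simp only: cell_sum_diff cell_sum_mult mult.commute)
        also have "\<bar>\<dots>\<bar> \<le> cell_sum k \<sigma> (\<lambda>a b. \<bar>h (vertex \<sigma> 0) * diff_sq f a b - ?\<phi> a b\<bar>)"
          by (rule abs_cell_sum_le)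
        also have "\<dots> \<le> cell_sum k \<sigma> (\<lambda>a b. \<eta> * diff_sq f a b)"
        proof (rule cell_sum_mono)
          fix \<tau> i j assume \<tau>: "\<tau> \<in> words k" and s: "(i, j) \<in> sides"
          define a b where "a = vertex (\<sigma> @ \<tau>) i" and "b = vertex (\<sigma> @ \<tau>) j"
          have "\<bar>h a - h (vertex \<sigma> 0)\<bar> \<le> \<eta>" "\<bar>h b - h (vertex \<sigma> 0)\<bar> \<le> \<eta>"
            unfolding a_def b_def using close[OF \<sigma> \<tau>] s by (simp_all add: sides_iff)
          then have c: "\<bar>h (vertex \<sigma> 0) - (h a + h b) / 2\<bar> \<le> \<eta>" by (rule abs_diff_mean_le)
          have "\<bar>h (vertex \<sigma> 0) * diff_sq f a b - ?\<phi> a b\<bar> = \<bar>h (vertex \<sigma> 0) - (h a + h b) / 2\<bar> * diff_sq f a b"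
          proof -
            have "h (vertex \<sigma> 0) * diff_sq f a b - ?\<phi> a b = (h (vertex \<sigma> 0) - (h a + h b) / 2) * diff_sq f a b"
              by (simp add: algebra_simps)
            then show ?thesis by (simp only: abs_mult abs_power2)
          qed
          also have "\<dots> \<le> \<eta> * diff_sq f a b" using c by (intro mult_right_mono) simp_all
          finally show "\<bar>h (vertex \<sigma> 0) * diff_sq f (vertex (\<sigma> @ \<tau>) i) (vertex (\<sigma> @ \<tau>) j)
              - ?\<phi> (vertex (\<sigma> @ \<tau>) i) (vertex (\<sigma> @ \<tau>) j)\<bar>
            \<le> \<eta> * diff_sq f (vertex (\<sigma> @ \<tau>) i) (vertex (\<sigma> @ \<tau>) j)"
            unfolding a_def b_def .
        qed
        finally show ?thesis by (simp only: cell_sum_mult)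
      qed
      have "(\<Sum>\<sigma>\<in>words n. cell_sum k \<sigma> (diff_sq f) * h (vertex \<sigma> 0)) - edge_sum (n + k) ?\<phi>
        = (\<Sum>\<sigma>\<in>words n. cell_sum k \<sigma> (diff_sq f) * h (vertex \<sigma> 0) - cell_sum k \<sigma> ?\<phi>)"
        by (simp only: cell_sum_split sum_subtractf append_Nil)
      also have "\<bar>\<dots>\<bar> \<le> (\<Sum>\<sigma>\<in>words n. \<eta> * cell_sum k \<sigma> (diff_sq f))"
        by (rule order_trans[OF sum_abs sum_mono]) (rule cell)
      also have "\<dots> = \<eta> * edge_sum (n + k) (diff_sq f)"
        by (simp only: cell_sum_split append_Nil sum_distrib_left)
      also have "\<dots> \<le> \<eta> * E"
        unfolding E_def using \<eta>(1) cell_sum_le_mass[OF f, of "[]" 0 "n + k"] by (intro mult_left_mono) simp_all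
      finally show ?thesis .
    qed
    moreover have "(\<lambda>k. \<bar>(\<Sum>\<sigma>\<in>words n. cell_sum k \<sigma> (diff_sq f) * h (vertex \<sigma> 0)) - edge_sum (n + k) ?\<phi>\<bar>)
      \<longlonglongrightarrow> \<bar>(\<Sum>\<sigma>\<in>words n. mass f \<sigma> * h (vertex \<sigma> 0)) - measure_form f f h\<bar>"
    proof -
      have "(\<lambda>k. edge_sum k ?\<phi>) \<longlonglongrightarrow> measure_form f f h"
        using measure_form_lim[OF f f h] by (simp only: power2_eq_square)
      from LIMSEQ_ignore_initial_segment[OF this, of n]
      have "(\<lambda>k. edge_sum (n + k) ?\<phi>) \<longlonglongrightarrow> measure_form f f h"
        by (simp only: add.commute)
      moreover have "(\<lambda>k. \<Sum>\<sigma>\<in>words n. cell_sum k \<sigma> (diff_sq f) * h (vertex \<sigma> 0))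
        \<longlonglongrightarrow> (\<Sum>\<sigma>\<in>words n. mass f \<sigma> * h (vertex \<sigma> 0))"
        by (intro tendsto_sum tendsto_mult tendsto_const mass_lim[OF f])
      ultimately show ?thesis by (intro tendsto_rabs tendsto_diff)
    qed
    ultimately have "\<bar>(\<Sum>\<sigma>\<in>words n. mass f \<sigma> * h (vertex \<sigma> 0)) - measure_form f f h\<bar> \<le> \<eta> * E"
      by (intro LIMSEQ_le_const2) auto
    then show ?thesis using \<eta>(2) by simp
  qed
  then show "\<exists>N. \<forall>n\<ge>N. norm ((\<Sum>\<sigma>\<in>words n. mass f \<sigma> * h (vertex \<sigma> 0)) - measure_form f f h) < \<epsilon>"
    by blast
qed

lemma finite_quantile_measure: "finite_measure (quantile_measure f)"
  unfolding quantile_measure_def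
  by (rule finite_measure.finite_measure_distr[OF finite_interval_space quantile_measurable])

text \<open>The integrals of h along \<open>pick\<close> are exactly the Riemann sums of
  \<open>sum_mass_lim\<close>. By dominated convergence they also tend to the integral of h composed
  with \<open>quantile\<close>, which is the integral against the image measure.\<close>

lemma quantile_measure_integral:
  assumes h: "h \<in> finite_energy"
  shows "(\<integral>x. h x \<partial>quantile_measure f) = measure_form f f h"
proof -
  have hm: "h \<in> borel_measurable (restrict_space borel gasket)"
    by (rule borel_measurable_continuous_on_restrict[OF finite_energy_continuous[OF h]])
  obtain M where M: "\<And>x. \<bar>h x\<bar> \<le> M" using finite_energy_bounded[OF h] by blast
  have "(\<lambda>n. \<integral>x. h (vertex (pick f x n) 0) \<partial>interval_space) \<longlonglongrightarrow> (\<integral>x. h (quantile f x) \<partial>interval_space)"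
  proof (rule integral_dominated_convergence[where w = "\<lambda>_. M"])
    show "(\<lambda>x. h (quantile f x)) \<in> borel_measurable interval_space"
      by (rule measurable_compose[OF quantile_measurable hm])
    show "(\<lambda>x. h (vertex (pick f x n) 0)) \<in> borel_measurable interval_space" for n
      by (rule measurable_compose[OF pick_measurable hm])
    show "integrable interval_space (\<lambda>_. M)"
      by (rule finite_measure.integrable_const[OF finite_interval_space])
    have "(\<lambda>n. h (vertex (pick f x n) 0)) \<longlonglongrightarrow> h (quantile f x)" for x
      by (rule continuous_on_tendsto_compose[OF finite_energy_continuous[OF h] pick_lim quantile_in_gasket])
        (simp add: vertex_pick_in_gasket)
    then show "AE x in interval_space. (\<lambda>n. h (vertex (pick f x n) 0)) \<longlonglongrightarrow> h (quantile f x)"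
      by simp
    show "AE x in interval_space. norm (h (vertex (pick f x n) 0)) \<le> M" for n
      by (simp add: M)
  qed
  then have "(\<lambda>n. \<Sum>\<sigma>\<in>words n. mass f \<sigma> * h (vertex \<sigma> 0)) \<longlonglongrightarrow> (\<integral>x. h (quantile f x) \<partial>interval_space)"
    by (simp only: pick_integral[of "\<lambda>\<sigma>. h (vertex \<sigma> 0)"])
  then have "(\<integral>x. h (quantile f x) \<partial>interval_space) = measure_form f f h"
    using sum_mass_lim[OF h] by (rule LIMSEQ_unique)
  then show ?thesis
    unfolding quantile_measure_def by (simp only: integral_distr[OF quantile_measurable hm])
qed

end

text \<open>Integrals of simple functions, and hence their limits, only depend on the difference of the
  two measures.\<close>

lemma signed_integral_eq:
  assumes d: "difference_of_measures \<nu> M N"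
    and h: "h \<in> borel_measurable (restrict_space borel gasket)" and bound: "\<And>x. \<bar>h x\<bar> \<le> B"
  shows "signed_integral \<nu> h = (\<integral>x. h x \<partial>M) - (\<integral>x. h x \<partial>N)"
proof -
  let ?S = "restrict_space borel gasket"
  obtain F where F: "\<And>i. simple_function ?S (F i)" "\<And>x. x \<in> space ?S \<Longrightarrow> (\<lambda>i. F i x) \<longlonglongrightarrow> h x"
    "\<And>i x. x \<in> space ?S \<Longrightarrow> dist (F i x) 0 \<le> 2 * dist (h x) 0"
    using borel_measurable_implies_sequence_metric[OF h, of 0] by blast
  \<comment> \<open>The simple functions \<open>F\<close> are chosen before any measure, and
    \<open>s\<close> involves the measures only through \<nu>; so its limit is the same for all
    decompositions.\<close>
  define s where "s i = (\<Sum>y\<in>F i ` space ?S. \<nu> {x \<in> space ?S. F i x = y} * y)" for i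
  have int: "(\<lambda>i. Bochner_Integration.simple_bochner_integral P (F i)) \<longlonglongrightarrow> (\<integral>x. h x \<partial>P)"
    if P: "finite_measure P" "sets P = sets ?S" for P
  proof -
    have sp: "space P = space ?S" using P(2) by (rule sets_eq_imp_space_eq)
    have sf: "simple_function P (F i)" for i
      using F(1)[of i] unfolding simple_function_def sp P(2) .
    have fin: "emeasure P A \<noteq> \<infinity>" for A
      using finite_measure.emeasure_finite[OF P(1)] by simp
    have sbi: "Bochner_Integration.simple_bochner_integrable P (F i)" for i
      by (rule simple_bochner_integrable.intros[OF sf]) (rule fin)
    have "Bochner_Integration.simple_bochner_integral P (F i) = (\<integral>x. F i x \<partial>P)" for i
      using simple_bochner_integrable_eq_integral[OF sbi] by blast
    moreover have "(\<lambda>i. \<integral>x. F i x \<partial>P) \<longlonglongrightarrow> (\<integral>x. h x \<partial>P)"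
    proof (rule integral_dominated_convergence[where w = "\<lambda>_. 2 * B"])
      show "h \<in> borel_measurable P" using h by (simp add: measurable_cong_sets[OF P(2) refl])
      show "F i \<in> borel_measurable P" for i using sf by (rule borel_measurable_simple_function)
      show "integrable P (\<lambda>_. 2 * B)" by (rule finite_measure.integrable_const[OF P(1)])
      show "AE x in P. (\<lambda>i. F i x) \<longlonglongrightarrow> h x" by (rule AE_I2) (simp add: F(2) sp)
      show "AE x in P. norm (F i x) \<le> 2 * B" for i
      proof (rule AE_I2)
        fix x assume "x \<in> space P"
        then show "norm (F i x) \<le> 2 * B" using F(3)[of x i] bound[of x] sp by simp
      qed
    qed
    ultimately show ?thesis by simp
  qed
  have diff: "s \<longlonglongrightarrow> (\<integral>x. h x \<partial>M') - (\<integral>x. h x \<partial>N')" if d': "difference_of_measures \<nu> M' N'" for M' N'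
  proof -
    have M': "finite_measure M'" "sets M' = sets ?S" and N': "finite_measure N'" "sets N' = sets ?S"
      and \<nu>: "\<nu> = (\<lambda>A. measure M' A - measure N' A)"
      using d' by (simp_all add: difference_of_measures_def)
    have "s = (\<lambda>i. Bochner_Integration.simple_bochner_integral M' (F i) - Bochner_Integration.simple_bochner_integral N' (F i))"
      unfolding s_def simple_bochner_integral_def \<nu> sets_eq_imp_space_eq[OF M'(2)] sets_eq_imp_space_eq[OF N'(2)]
      by (simp add: left_diff_distrib sum_subtractf)
    then show ?thesis using tendsto_diff[OF int[OF M'] int[OF N']] by simp
  qed
  show ?thesis
    unfolding signed_integral_def
  proof (rule the_equality)
    show "\<exists>M' N'. difference_of_measures \<nu> M' N' \<and> (\<integral>x. h x \<partial>M) - (\<integral>x. h x \<partial>N) = (\<integral>x. h x \<partial>M') - (\<integral>x. h x \<partial>N')"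
      using d by blast
  next
    fix I assume "\<exists>M' N'. difference_of_measures \<nu> M' N' \<and> I = (\<integral>x. h x \<partial>M') - (\<integral>x. h x \<partial>N')"
    then show "I = (\<integral>x. h x \<partial>M) - (\<integral>x. h x \<partial>N)"
      using diff d LIMSEQ_unique by blast
  qed
qed

text \<open>The choice in \<open>energy_measure\<close> has the prescribed integrals as soon as some
  signed measure has them. By polarization, \<mu>(f, g) = \<mu>(u, u) - \<mu>(v, v) for u = (f + g)
  / 2 and v = (f - g) / 2, a difference of two quantile measures.\<close>

lemma energy_measure_integral:
  assumes f: "f \<in> finite_energy" and g: "g \<in> finite_energy" and h: "h \<in> finite_energy"
  shows "signed_integral (energy_measure f g) h = measure_form f g h"
proof -
  define u v where "u = (1 / 2) *\<^sub>R (f + g)" and "v = (1 / 2) *\<^sub>R (f - g)"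
  have u: "u \<in> finite_energy" and v: "v \<in> finite_energy"
    unfolding u_def v_def by (intro finite_energy_intros f g)+
  define \<nu> where "\<nu> A = measure (quantile_measure u) A - measure (quantile_measure v) A" for A
  have d: "difference_of_measures \<nu> (quantile_measure u) (quantile_measure v)"
    unfolding difference_of_measures_def
    using finite_quantile_measure[OF u] finite_quantile_measure[OF v]
    by (simp add: \<nu>_def fun_eq_iff quantile_measure_def)
  have eq: "measure_form u u h - measure_form v v h = measure_form f g h" if h: "h \<in> finite_energy" for h
  proof (rule LIMSEQ_unique)
    let ?p = "\<lambda>f g a b. (f b - f a) * (g b - g a) * ((h a + h b) / 2)"
    show "(\<lambda>n. edge_sum n (?p u u) - edge_sum n (?p v v)) \<longlonglongrightarrow> measure_form u u h - measure_form v v h"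
      by (intro tendsto_diff measure_form_lim u v h)
    have "edge_sum n (?p u u) - edge_sum n (?p v v) = edge_sum n (?p f g)" for n
      unfolding cell_sum_diff[symmetric]
      by (rule edge_sum_cong) (simp add: u_def v_def field_simps)
    then show "(\<lambda>n. edge_sum n (?p u u) - edge_sum n (?p v v)) \<longlonglongrightarrow> measure_form f g h"
      using measure_form_lim[OF f g h] by (simp only:)
  qed
  have "signed_integral \<nu> h = measure_form f g h" if h: "h \<in> finite_energy" for h
  proof -
    obtain B where B: "\<And>x. \<bar>h x\<bar> \<le> B" using finite_energy_bounded[OF h] by blast
    have "signed_integral \<nu> h = (\<integral>x. h x \<partial>quantile_measure u) - (\<integral>x. h x \<partial>quantile_measure v)"
      by (rule signed_integral_eq[OF d borel_measurable_continuous_on_restrict[OF finite_energy_continuous[OF h]] B])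
    then show ?thesis
      by (simp only: quantile_measure_integral[OF u h] quantile_measure_integral[OF v h] eq[OF h])
  qed
  then have "signed_measure \<nu> \<and> (\<forall>h\<in>finite_energy. signed_integral \<nu> h =
      (1 / 2) * (energy_form f (g * h) - energy_form (f * g) h + energy_form (h * f) g))"
    using d by (auto simp: signed_measure_def measure_form_def)
  from someI[of "\<lambda>\<nu>. signed_measure \<nu> \<and> (\<forall>h\<in>finite_energy. signed_integral \<nu> h =
      (1 / 2) * (energy_form f (g * h) - energy_form (f * g) h + energy_form (h * f) g))", OF this]
  show ?thesis
    using h unfolding energy_measure_def[symmetric] measure_form_def by blast
qed

section \<open>Universal 1-forms\<close>

lemma sum_fun_apply: "sum F A x = (\<Sum>i\<in>A. F i x)"
  by (induction A rule: infinite_finite_induct) simp_all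

abbreviation form_gens :: "(pt \<times> pt \<Rightarrow> real) set" where
  "form_gens \<equiv> {left_act f (univ_d g) |f g. f \<in> finite_energy \<and> g \<in> finite_energy}"

lemma left_act_univ_d: "left_act f (univ_d g) (x, y) = f x * (g x * gasket_one y - gasket_one x * g y)"
  by (simp add: left_act_def univ_d_def tensor_def)

lemma subspace_left_act_vimage:
  fixes S :: "('a \<times> 'b \<Rightarrow> real) set"
  assumes S: "subspace S"
  shows "subspace {\<omega>. left_act u \<omega> \<in> S}"
proof (rule subspaceI)
  have "left_act u (0 :: 'a \<times> 'b \<Rightarrow> real) = 0" by (simp add: left_act_def fun_eq_iff)
  then show "0 \<in> {\<omega>. left_act u \<omega> \<in> S}" using subspace_0[OF S] by simp
  fix \<omega> \<eta> c assume "\<omega> \<in> {\<omega>. left_act u \<omega> \<in> S}"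
  then have \<omega>: "left_act u \<omega> \<in> S" by simp
  have "left_act u (c *\<^sub>R \<omega>) = c *\<^sub>R left_act u \<omega>" by (simp add: left_act_def fun_eq_iff)
  then show "c *\<^sub>R \<omega> \<in> {\<omega>. left_act u \<omega> \<in> S}" using subspace_scale[OF S \<omega>] by simp
  assume "\<eta> \<in> {\<omega>. left_act u \<omega> \<in> S}"
  moreover have "left_act u (\<omega> + \<eta>) = left_act u \<omega> + left_act u \<eta>"
    by (simp add: left_act_def fun_eq_iff distrib_left)
  ultimately show "\<omega> + \<eta> \<in> {\<omega>. left_act u \<omega> \<in> S}" using subspace_add[OF S \<omega>] by simp
qed

lemma subspace_right_act_vimage:
  fixes S :: "('a \<times> 'b \<Rightarrow> real) set"
  assumes S: "subspace S"
  shows "subspace {\<omega>. right_act \<omega> u \<in> S}"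
proof (rule subspaceI)
  have "right_act (0 :: 'a \<times> 'b \<Rightarrow> real) u = 0" by (simp add: right_act_def fun_eq_iff)
  then show "0 \<in> {\<omega>. right_act \<omega> u \<in> S}" using subspace_0[OF S] by simp
  fix \<omega> \<eta> c assume "\<omega> \<in> {\<omega>. right_act \<omega> u \<in> S}"
  then have \<omega>: "right_act \<omega> u \<in> S" by simp
  have "right_act (c *\<^sub>R \<omega>) u = c *\<^sub>R right_act \<omega> u" by (simp add: right_act_def fun_eq_iff)
  then show "c *\<^sub>R \<omega> \<in> {\<omega>. right_act \<omega> u \<in> S}" using subspace_scale[OF S \<omega>] by simp
  assume "\<eta> \<in> {\<omega>. right_act \<omega> u \<in> S}"
  moreover have "right_act (\<omega> + \<eta>) u = right_act \<omega> u + right_act \<eta> u"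
    by (simp add: right_act_def fun_eq_iff distrib_right)
  ultimately show "\<omega> + \<eta> \<in> {\<omega>. right_act \<omega> u \<in> S}" using subspace_add[OF S \<omega>] by simp
qed

text \<open>The Leibniz rule in the form (dg) u = d(g u) - g du. It converts the right action into
  combinations of forms f dg.\<close>

lemma right_act_left_act_univ_d:
  assumes "g \<in> finite_energy" "u \<in> finite_energy"
  shows "right_act (left_act f (univ_d g)) u = left_act f (univ_d (g * u)) - left_act (f * g) (univ_d u)"
proof
  fix z :: "pt \<times> pt"
  obtain x y where z: "z = (x, y)" by (cases z)
  \<comment> \<open>The unit is the indicator of the gasket; it can be absorbed only next to a
    function that vanishes outside.\<close>
  have 1: "g x * gasket_one x = g x" "u y * gasket_one y = u y"
    using finite_energy_mult_one assms by (metis times_fun_apply)+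
  have "right_act (left_act f (univ_d g)) u z
      = f x * g x * (u y * gasket_one y) - f x * gasket_one x * g y * u y"
    unfolding z right_act_def by (simp add: left_act_univ_d algebra_simps)
  also have "\<dots> = f x * (g x * gasket_one x) * u y - f x * gasket_one x * g y * u y"
    by (simp only: 1)
  also have "\<dots> = (left_act f (univ_d (g * u)) - left_act (f * g) (univ_d u)) z"
    unfolding z by (simp add: left_act_univ_d algebra_simps)
  finally show "right_act (left_act f (univ_d g)) u z = (left_act f (univ_d (g * u)) - left_act (f * g) (univ_d u)) z" .
qed

text \<open>The generators lie in the tensor square by f dg = fg \<otimes> 1 - f \<otimes> g, and
  the Leibniz rule gives closure under the right action. Hence the generated bimodule is just a
  linear span.\<close>

lemma sub_bimodule_span: "sub_bimodule (span form_gens)"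
  unfolding sub_bimodule_def
proof (intro conjI ballI)
  show "span form_gens \<subseteq> tensor_square"
  proof (rule span_minimal)
    show "subspace tensor_square" by (simp add: tensor_square_def)
    have "left_act f (univ_d g) \<in> tensor_square" if "f \<in> finite_energy" "g \<in> finite_energy" for f g
    proof -
      have f1: "f x = f x * gasket_one x" for x
        using finite_energy_mult_one[OF that(1)] by (metis times_fun_apply)
      have "left_act f (univ_d g) = (f * g) \<otimes>\<^sub>f gasket_one - f \<otimes>\<^sub>f g"
      proof
        fix z :: "pt \<times> pt"
        obtain x y where z: "z = (x, y)" by (cases z)
        have "left_act f (univ_d g) z = f x * g x * gasket_one y - (f x * gasket_one x) * g y"
          unfolding z by (simp add: left_act_univ_d algebra_simps)
        then show "left_act f (univ_d g) z = ((f * g) \<otimes>\<^sub>f gasket_one - f \<otimes>\<^sub>f g) z"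
          unfolding f1[symmetric] by (simp add: z tensor_def)
      qed
      moreover have "(f * g) \<otimes>\<^sub>f gasket_one \<in> tensor_square" "f \<otimes>\<^sub>f g \<in> tensor_square"
        unfolding tensor_square_def using that finite_energy_mult finite_energy_one
        by (blast intro: span_base)+
      ultimately show ?thesis unfolding tensor_square_def by (simp add: span_diff)
    qed
    then show "form_gens \<subseteq> tensor_square" by blast
  qed
  show "subspace (span form_gens)" by (rule subspace_span)
  fix u \<omega> assume u: "u \<in> finite_energy" and \<omega>: "\<omega> \<in> span form_gens"
  have "span form_gens \<subseteq> {\<omega>. left_act u \<omega> \<in> span form_gens}"
  proof (rule span_minimal)
    show "subspace {\<omega>. left_act u \<omega> \<in> span form_gens}"
      by (rule subspace_left_act_vimage[OF subspace_span])
    have "left_act u (left_act f (univ_d g)) \<in> span form_gens" if "f \<in> finite_energy" "g \<in> finite_energy" for f g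
    proof -
      have "left_act u (left_act f (univ_d g)) = left_act (u * f) (univ_d g)"
        by (simp add: left_act_def fun_eq_iff)
      then show ?thesis using finite_energy_mult[OF u that(1)] that(2) by (auto intro: span_base)
    qed
    then show "form_gens \<subseteq> {\<omega>. left_act u \<omega> \<in> span form_gens}" by blast
  qed
  then show "left_act u \<omega> \<in> span form_gens" using \<omega> by blast
  have "span form_gens \<subseteq> {\<omega>. right_act \<omega> u \<in> span form_gens}"
  proof (rule span_minimal)
    show "subspace {\<omega>. right_act \<omega> u \<in> span form_gens}"
      by (rule subspace_right_act_vimage[OF subspace_span])
    have "right_act (left_act f (univ_d g)) u \<in> span form_gens" if "f \<in> finite_energy" "g \<in> finite_energy" for f g
    proof -
      have "left_act f (univ_d (g * u)) \<in> form_gens" "left_act (f * g) (univ_d u) \<in> form_gens"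
        using that u finite_energy_mult by blast+
      then show ?thesis
        unfolding right_act_left_act_univ_d[OF that(2) u] by (blast intro: span_diff span_base)
    qed
    then show "form_gens \<subseteq> {\<omega>. right_act \<omega> u \<in> span form_gens}" by blast
  qed
  then show "right_act \<omega> u \<in> span form_gens" using \<omega> by blast
qed

lemma univ_forms_eq_span: "univ_forms = span form_gens"
proof
  show "univ_forms \<subseteq> span form_gens"
    unfolding univ_forms_def by (rule hull_minimal) (rule span_superset, rule sub_bimodule_span)
  show "span form_gens \<subseteq> univ_forms"
    unfolding univ_forms_def hull_def
  proof (rule Inter_greatest)
    fix T assume "T \<in> {T. sub_bimodule T \<and> form_gens \<subseteq> T}"
    then show "span form_gens \<subseteq> T" by (intro span_minimal) (auto simp: sub_bimodule_def)
  qed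
qed

lemma subspace_univ_forms: "subspace univ_forms"
  by (simp add: univ_forms_eq_span)

lemma represents_univ_forms:
  assumes "represents n f g \<omega>"
  shows "\<omega> \<in> univ_forms"
proof -
  have "\<omega> = (\<Sum>i<n. left_act (f i) (univ_d (g i)))" and fg: "\<And>i. i < n \<Longrightarrow> f i \<in> finite_energy \<and> g i \<in> finite_energy"
    using assms by (auto simp: represents_def)
  then show ?thesis
    unfolding univ_forms_eq_span \<open>\<omega> = _\<close> by (intro span_sum span_base) (use fg in blast)
qed

lemma univ_forms_represents:
  assumes "\<omega> \<in> univ_forms"
  obtains n f g where "represents n f g \<omega>"
proof -
  have "\<exists>n f g. represents n f g \<omega>"
    using assms unfolding univ_forms_eq_span
  proof (induction rule: span_induct_alt)
    case base
    show ?case by (rule exI[of _ 0]) (simp add: represents_def zero_fun_def)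
  next
    case (step c \<gamma> \<omega>)
    then obtain u v where uv: "u \<in> finite_energy" "v \<in> finite_energy" "\<gamma> = left_act u (univ_d v)" by blast
    obtain n f g where r: "represents n f g \<omega>" using step by blast
    have "c *\<^sub>R \<gamma> = left_act (c *\<^sub>R u) (univ_d v)"
      unfolding uv(3) by (simp add: left_act_def fun_eq_iff)
    moreover have "(\<Sum>i<n. left_act ((f(n := c *\<^sub>R u)) i) (univ_d ((g(n := v)) i)))
      = (\<Sum>i<n. left_act (f i) (univ_d (g i)))"
      by (rule sum.cong) auto
    ultimately have "represents (Suc n) (f(n := c *\<^sub>R u)) (g(n := v)) (c *\<^sub>R \<gamma> + \<omega>)"
      using r finite_energy_scale[OF uv(1), of c] uv(2)
      by (auto simp: represents_def less_Suc_eq add.commute)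
    then show ?case by blast
  qed
  then show thesis using that by blast
qed

text \<open>On an edge the sum over a representation is a value of \<omega> itself. From this
  follows that neither \<open>Q_form\<close> nor \<open>edge_integral\<close> depends on the
  representation. The target b comes first because the left factor f is evaluated there.\<close>

lemma represents_apply:
  assumes r: "represents n f g \<omega>" and ab: "a \<in> gasket" "b \<in> gasket"
  shows "\<omega> (b, a) = (\<Sum>i<n. f i b * (g i b - g i a))"
proof -
  have "\<omega> (b, a) = (\<Sum>i<n. left_act (f i) (univ_d (g i)) (b, a))"
    using r by (simp add: represents_def sum_fun_apply)
  also have "\<dots> = (\<Sum>i<n. f i b * (g i b - g i a))"
    by (rule sum.cong) (simp_all add: left_act_univ_d gasket_one_def ab)
  finally show ?thesis .
qed

section \<open>The form as a limit of sums over edges\<close>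

text \<open>The orientations \<open>(a, b)\<close> and \<open>(b, a)\<close> contribute the weights \<open>H b\<close> and \<open>H a\<close>.\<close>

lemma edge_sum_mean:
  "edge_sum n (\<lambda>a b. (g b - g a) * (k b - k a) * H b)
    = edge_sum n (\<lambda>a b. (g b - g a) * (k b - k a) * ((H a + H b) / 2))"
proof -
  let ?A = "\<lambda>a b. (g b - g a) * (k b - k a) * H b" and ?B = "\<lambda>a b. (g b - g a) * (k b - k a) * H a"
  have "edge_sum n ?A = edge_sum n (\<lambda>a b. ?A b a)" by (rule edge_sum_swap)
  also have "\<dots> = edge_sum n ?B"
    by (rule edge_sum_cong) (simp add: algebra_simps)
  finally have "edge_sum n ?A = edge_sum n ?B" .
  moreover have "edge_sum n (\<lambda>a b. (g b - g a) * (k b - k a) * ((H a + H b) / 2))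
      = edge_sum n (\<lambda>a b. (1 / 2) * (?B a b + ?A a b))"
    by (rule edge_sum_cong) (simp add: algebra_simps add_divide_distrib)
  ultimately show ?thesis by (simp only: cell_sum_mult cell_sum_add) simp
qed

text \<open>Expanding the product on an edge gives terms dg_i dk_j weighted by (f_i h_j)(b).
  Averaging over the two orientations replaces the weight by its mean, which is the integrand of
  \<open>measure_form_lim\<close>.\<close>

lemma represents_form_lim:
  assumes r: "represents n f g \<omega>" and r': "represents m h k \<eta>"
  shows "(\<lambda>l. edge_sum l (\<lambda>a b. \<omega> (b, a) * \<eta> (b, a)))
    \<longlonglongrightarrow> (\<Sum>i<n. \<Sum>j<m. signed_integral (energy_measure (g i) (k j)) (f i * h j))"
proof -
  have fg: "f i \<in> finite_energy" "g i \<in> finite_energy" if "i < n" for i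
    using r that by (auto simp: represents_def)
  have hk: "h j \<in> finite_energy" "k j \<in> finite_energy" if "j < m" for j
    using r' that by (auto simp: represents_def)
  let ?t = "\<lambda>i j a b. (g i b - g i a) * (k j b - k j a) * (((f i * h j) a + (f i * h j) b) / 2)"
  have "edge_sum l (\<lambda>a b. \<omega> (b, a) * \<eta> (b, a)) = (\<Sum>i<n. \<Sum>j<m. edge_sum l (?t i j))" for l
  proof -
    have "edge_sum l (\<lambda>a b. \<omega> (b, a) * \<eta> (b, a))
        = edge_sum l (\<lambda>a b. \<Sum>i<n. \<Sum>j<m. (g i b - g i a) * (k j b - k j a) * (f i * h j) b)"
      by (rule edge_sum_cong)
        (simp add: represents_apply[OF r] represents_apply[OF r'] sum_product mult_ac)
    then show ?thesis by (simp only: cell_sum_sum edge_sum_mean)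
  qed
  moreover have "(\<lambda>l. \<Sum>i<n. \<Sum>j<m. edge_sum l (?t i j))
      \<longlonglongrightarrow> (\<Sum>i<n. \<Sum>j<m. signed_integral (energy_measure (g i) (k j)) (f i * h j))"
  proof (intro tendsto_sum)
    fix i j assume "i \<in> {..<n}" "j \<in> {..<m}"
    then have *: "f i * h j \<in> finite_energy" "g i \<in> finite_energy" "k j \<in> finite_energy"
      using fg hk finite_energy_mult by auto
    show "(\<lambda>l. edge_sum l (?t i j)) \<longlonglongrightarrow> signed_integral (energy_measure (g i) (k j)) (f i * h j)"
      unfolding energy_measure_integral[OF *(2,3,1)] by (rule measure_form_lim[OF *(2,3,1)])
  qed
  ultimately show ?thesis by (simp only:)
qed

text \<open>The sequence on the left mentions no representation, so by uniqueness of limits all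
  pairs of representations give the same number and the description is met.\<close>

lemma Q_form_lim:
  assumes "\<omega> \<in> univ_forms" "\<eta> \<in> univ_forms"
  shows "(\<lambda>l. edge_sum l (\<lambda>a b. \<omega> (b, a) * \<eta> (b, a))) \<longlonglongrightarrow> Q_form \<omega> \<eta>"
proof -
  obtain n f g where r: "represents n f g \<omega>" using univ_forms_represents[OF assms(1)] .
  obtain m h k where r': "represents m h k \<eta>" using univ_forms_represents[OF assms(2)] .
  have "Q_form \<omega> \<eta> = (\<Sum>i<n. \<Sum>j<m. signed_integral (energy_measure (g i) (k j)) (f i * h j))"
    unfolding Q_form_def
  proof (rule the_equality)
    show "\<exists>n' f' g' m' h' k'. represents n' f' g' \<omega> \<and> represents m' h' k' \<eta> \<and>
      (\<Sum>i<n. \<Sum>j<m. signed_integral (energy_measure (g i) (k j)) (f i * h j))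
      = (\<Sum>i<n'. \<Sum>j<m'. signed_integral (energy_measure (g' i) (k' j)) (f' i * h' j))"
      by (intro exI conjI, rule r, rule r', rule refl)
  next
    fix q assume "\<exists>n f g m h k. represents n f g \<omega> \<and> represents m h k \<eta> \<and>
      q = (\<Sum>i<n. \<Sum>j<m. signed_integral (energy_measure (g i) (k j)) (f i * h j))"
    then obtain n' f' g' m' h' k' where s: "represents n' f' g' \<omega>" "represents m' h' k' \<eta>"
      and q: "q = (\<Sum>i<n'. \<Sum>j<m'. signed_integral (energy_measure (g' i) (k' j)) (f' i * h' j))"
      by (elim exE conjE)
    show "q = (\<Sum>i<n. \<Sum>j<m. signed_integral (energy_measure (g i) (k j)) (f i * h j))"
      unfolding q by (rule LIMSEQ_unique[OF represents_form_lim[OF s] represents_form_lim[OF r r']])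
  qed
  then show ?thesis using represents_form_lim[OF r r'] by simp
qed

lemma psd_form_Q: "psd_form univ_forms Q_form"
proof
  show "subspace univ_forms" by (rule subspace_univ_forms)
next
  fix \<omega> \<eta> \<theta> assume u: "\<omega> \<in> univ_forms" "\<eta> \<in> univ_forms" "\<theta> \<in> univ_forms"
  have "(\<lambda>l. edge_sum l (\<lambda>a b. \<omega> (b, a) * \<theta> (b, a)) + edge_sum l (\<lambda>a b. \<eta> (b, a) * \<theta> (b, a)))
      \<longlonglongrightarrow> Q_form \<omega> \<theta> + Q_form \<eta> \<theta>"
    by (intro tendsto_add Q_form_lim u)
  moreover have "(\<lambda>l. edge_sum l (\<lambda>a b. (\<omega> + \<eta>) (b, a) * \<theta> (b, a))) \<longlonglongrightarrow> Q_form (\<omega> + \<eta>) \<theta>"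
    by (intro Q_form_lim subspace_add[OF subspace_univ_forms] u)
  ultimately show "Q_form (\<omega> + \<eta>) \<theta> = Q_form \<omega> \<theta> + Q_form \<eta> \<theta>"
    by (simp add: distrib_right cell_sum_add LIMSEQ_unique)
next
  fix \<omega> \<theta> c assume u: "\<omega> \<in> univ_forms" "\<theta> \<in> univ_forms"
  have "(\<lambda>l. c * edge_sum l (\<lambda>a b. \<omega> (b, a) * \<theta> (b, a))) \<longlonglongrightarrow> c * Q_form \<omega> \<theta>"
    by (intro tendsto_mult tendsto_const Q_form_lim u)
  moreover have "(\<lambda>l. edge_sum l (\<lambda>a b. (c *\<^sub>R \<omega>) (b, a) * \<theta> (b, a))) \<longlonglongrightarrow> Q_form (c *\<^sub>R \<omega>) \<theta>"
    by (intro Q_form_lim subspace_scale[OF subspace_univ_forms] u)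
  ultimately show "Q_form (c *\<^sub>R \<omega>) \<theta> = c * Q_form \<omega> \<theta>"
    by (simp add: cell_sum_mult mult.assoc LIMSEQ_unique)
next
  fix \<omega> \<eta> assume u: "\<omega> \<in> univ_forms" "\<eta> \<in> univ_forms"
  show "Q_form \<omega> \<eta> = Q_form \<eta> \<omega>"
    using Q_form_lim[OF u] Q_form_lim[OF u(2,1)] by (simp add: mult.commute LIMSEQ_unique)
next
  fix \<omega> assume u: "\<omega> \<in> univ_forms"
  show "0 \<le> Q_form \<omega> \<omega>"
    by (rule LIMSEQ_le_const[OF Q_form_lim[OF u u]]) (auto intro!: cell_sum_nonneg)
qed

section \<open>Edge integrals\<close>

context
  fixes n f g \<omega> assumes rep: "represents n f g \<omega>"
begin

text \<open>One additive function of cells that dominates the energies of all functions in the fixed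
  representation at once.\<close>

definition total_mass :: "nat list \<Rightarrow> real" where
  "total_mass \<sigma> = (\<Sum>r<n. mass (f r) \<sigma> + mass (g r) \<sigma>)"

lemma rep_finite_energy: "r < n \<Longrightarrow> f r \<in> finite_energy" "r < n \<Longrightarrow> g r \<in> finite_energy"
  using rep by (auto simp: represents_def)

lemma total_mass_nonneg: "\<sigma> \<in> words m \<Longrightarrow> 0 \<le> total_mass \<sigma>"
  unfolding total_mass_def
  by (intro sum_nonneg add_nonneg_nonneg) (auto intro: mass_nonneg rep_finite_energy)

lemma total_mass_split:
  assumes "\<sigma> \<in> words m"
  shows "total_mass \<sigma> = (\<Sum>\<tau>\<in>words k. total_mass (\<sigma> @ \<tau>))"
proof -
  have "total_mass \<sigma> = (\<Sum>r<n. \<Sum>\<tau>\<in>words k. mass (f r) (\<sigma> @ \<tau>) + mass (g r) (\<sigma> @ \<tau>))"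
    unfolding total_mass_def
  proof (rule sum.cong[OF refl])
    fix r assume "r \<in> {..<n}"
    then have "f r \<in> finite_energy" "g r \<in> finite_energy" by (simp_all add: rep_finite_energy)
    then show "mass (f r) \<sigma> + mass (g r) \<sigma> = (\<Sum>\<tau>\<in>words k. mass (f r) (\<sigma> @ \<tau>) + mass (g r) (\<sigma> @ \<tau>))"
      using mass_split[OF _ assms, of _ k] by (simp add: sum.distrib)
  qed
  then show ?thesis unfolding total_mass_def by (simp only: sum.swap[of _ "words k"])
qed

text \<open>The 2^k subedges lie in different subcells, so additivity keeps the sum bounded
  independently of k.\<close>

lemma sum_side_words_total_mass_le:
  assumes "\<sigma> \<in> words m" "(i, j) \<in> sides"
  shows "(\<Sum>v\<in>side_words i j k. total_mass (\<sigma> @ v)) \<le> total_mass \<sigma>"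
  unfolding total_mass_split[OF assms(1), of k]
proof (rule sum_mono2)
  fix v assume "v \<in> words k - side_words i j k"
  then have "\<sigma> @ v \<in> words (m + k)" using words_append[OF assms(1)] by blast
  then show "0 \<le> total_mass (\<sigma> @ v)" by (rule total_mass_nonneg)
qed (use side_words_subset[OF assms(2)] in auto)

abbreviation edge_value :: "nat list \<Rightarrow> nat \<Rightarrow> nat \<Rightarrow> real" where
  "edge_value \<sigma> i j \<equiv> \<omega> (vertex \<sigma> j, vertex \<sigma> i)"

abbreviation side_sum :: "nat list \<Rightarrow> nat \<Rightarrow> nat \<Rightarrow> nat \<Rightarrow> real" where
  "side_sum \<sigma> i j k \<equiv> \<Sum>v\<in>side_words i j k. edge_value (\<sigma> @ v) i j"

text \<open>Subdividing the edge \<open>(a, b)\<close> at \<open>c\<close> changes \<open>f dg\<close> by \<open>(f c - f b) * (g c - g a)\<close>.\<close>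

lemma edge_value_subdivide:
  assumes \<sigma>: "\<sigma> \<in> words m" and s: "(i, j) \<in> sides"
  shows "\<bar>edge_value (\<sigma> @ [i]) i j + edge_value (\<sigma> @ [j]) i j - edge_value \<sigma> i j\<bar>
    \<le> (3 / 5) ^ Suc m * total_mass \<sigma>"
proof -
  have ij: "i \<in> letters" "j \<in> letters" using s by (simp_all add: sides_iff)
  define a b c where "a = vertex \<sigma> i" and "b = vertex \<sigma> j" and "c = vertex (\<sigma> @ [i]) j"
  have \<sigma>i: "\<sigma> @ [i] \<in> words (Suc m)" and \<sigma>j: "\<sigma> @ [j] \<in> words (Suc m)"
    using words_snoc[OF \<sigma>] ij by blast+
  have in_gasket: "a \<in> gasket" "b \<in> gasket" "c \<in> gasket"
    unfolding a_def b_def c_def using vertex_in_gasket[OF \<sigma>] vertex_in_gasket[OF \<sigma>i] ij by blast+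
  have cj: "vertex (\<sigma> @ [j]) i = c" unfolding c_def by (rule vertex_snoc_commute)
  have "edge_value (\<sigma> @ [i]) i j + edge_value (\<sigma> @ [j]) i j - edge_value \<sigma> i j
      = \<omega> (c, a) + \<omega> (b, c) - \<omega> (b, a)"
    unfolding vertex_snoc_same cj by (simp only: a_def b_def c_def)
  also have "\<dots> = (\<Sum>r<n. (f r c - f r b) * (g r c - g r a))"
    unfolding represents_apply[OF rep in_gasket(1,3)] represents_apply[OF rep in_gasket(3,2)]
      represents_apply[OF rep in_gasket(1,2)]
    by (simp add: algebra_simps flip: sum.distrib sum_subtractf)
  also have "\<bar>\<dots>\<bar> \<le> (\<Sum>r<n. (3 / 5) ^ Suc m * (mass (f r) \<sigma> + mass (g r) \<sigma>))"
  proof (rule order_trans[OF sum_abs sum_mono])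
    fix r assume "r \<in> {..<n}"
    then have F: "f r \<in> finite_energy" "g r \<in> finite_energy" by (simp_all add: rep_finite_energy)
    have s': "(j, i) \<in> sides" using s by (auto simp: sides_iff)
    have "(f r c - f r b)\<^sup>2 \<le> (3 / 5) ^ Suc m * mass (f r) (\<sigma> @ [j])"
      using edge_diff_sq_le_mass[OF F(1) \<sigma>j s'] unfolding vertex_snoc_same cj b_def .
    also have "\<dots> \<le> (3 / 5) ^ Suc m * mass (f r) \<sigma>"
      by (intro mult_left_mono mass_append_le[OF F(1) \<sigma>, of _ 1]) (use ij in \<open>simp_all add: words_def\<close>)
    finally have 1: "(f r c - f r b)\<^sup>2 \<le> (3 / 5) ^ Suc m * mass (f r) \<sigma>" .
    have "(g r c - g r a)\<^sup>2 \<le> (3 / 5) ^ Suc m * mass (g r) (\<sigma> @ [i])"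
      using edge_diff_sq_le_mass[OF F(2) \<sigma>i s] unfolding vertex_snoc_same c_def[symmetric] a_def .
    also have "\<dots> \<le> (3 / 5) ^ Suc m * mass (g r) \<sigma>"
      by (intro mult_left_mono mass_append_le[OF F(2) \<sigma>, of _ 1]) (use ij in \<open>simp_all add: words_def\<close>)
    finally have 2: "(g r c - g r a)\<^sup>2 \<le> (3 / 5) ^ Suc m * mass (g r) \<sigma>" .
    have "2 * \<bar>f r c - f r b\<bar> * \<bar>g r c - g r a\<bar> \<le> (f r c - f r b)\<^sup>2 + (g r c - g r a)\<^sup>2"
      using sum_squares_bound[of "\<bar>f r c - f r b\<bar>" "\<bar>g r c - g r a\<bar>"] by simp
    moreover have "0 \<le> \<bar>f r c - f r b\<bar> * \<bar>g r c - g r a\<bar>" by simp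
    ultimately have "\<bar>f r c - f r b\<bar> * \<bar>g r c - g r a\<bar> \<le> (f r c - f r b)\<^sup>2 + (g r c - g r a)\<^sup>2"
      by linarith
    also have "\<dots> \<le> (3 / 5) ^ Suc m * (mass (f r) \<sigma> + mass (g r) \<sigma>)"
      unfolding distrib_left by (rule add_mono[OF 1 2])
    finally show "\<bar>(f r c - f r b) * (g r c - g r a)\<bar> \<le> (3 / 5) ^ Suc m * (mass (f r) \<sigma> + mass (g r) \<sigma>)"
      by (simp only: abs_mult)
  qed
  also have "\<dots> = (3 / 5) ^ Suc m * total_mass \<sigma>"
    by (simp only: total_mass_def sum_distrib_left)
  finally show ?thesis .
qed

text \<open>Each subdivided edge costs (3/5)^(m + k + 1) times the total mass of its own cell, and
  those masses add up to at most the one of \<sigma>; the increments are therefore dominated by a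
  geometric series.\<close>

lemma side_sum_step:
  assumes \<sigma>: "\<sigma> \<in> words m" and s: "(i, j) \<in> sides"
  shows "\<bar>side_sum \<sigma> i j (Suc k) - side_sum \<sigma> i j k\<bar> \<le> (3 / 5) ^ Suc k * ((3 / 5) ^ m * total_mass \<sigma>)"
proof -
  have ne: "i \<noteq> j" using s by (simp add: sides_iff)
  have eq: "side_sum \<sigma> i j (Suc k) - side_sum \<sigma> i j k = (\<Sum>v\<in>side_words i j k.
      edge_value ((\<sigma> @ v) @ [i]) i j + edge_value ((\<sigma> @ v) @ [j]) i j - edge_value (\<sigma> @ v) i j)"
    by (simp only: sum_side_words_Suc[OF ne] sum_subtractf append_assoc)
  have "\<bar>side_sum \<sigma> i j (Suc k) - side_sum \<sigma> i j k\<bar>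
      \<le> (\<Sum>v\<in>side_words i j k. (3 / 5) ^ Suc (m + k) * total_mass (\<sigma> @ v))"
    unfolding eq
  proof (rule order_trans[OF sum_abs sum_mono])
    fix v assume "v \<in> side_words i j k"
    then have "\<sigma> @ v \<in> words (m + k)" using side_words_subset[OF s] words_append[OF \<sigma>] by blast
    then show "\<bar>edge_value ((\<sigma> @ v) @ [i]) i j + edge_value ((\<sigma> @ v) @ [j]) i j - edge_value (\<sigma> @ v) i j\<bar>
      \<le> (3 / 5) ^ Suc (m + k) * total_mass (\<sigma> @ v)"
      using s by (rule edge_value_subdivide)
  qed
  also have "\<dots> = (3 / 5) ^ Suc (m + k) * (\<Sum>v\<in>side_words i j k. total_mass (\<sigma> @ v))"
    by (rule sum_distrib_left[symmetric])
  also have "\<dots> \<le> (3 / 5) ^ Suc (m + k) * total_mass \<sigma>"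
    by (rule mult_left_mono[OF sum_side_words_total_mass_le[OF \<sigma> s]]) simp
  also have "\<dots> = (3 / 5) ^ Suc k * ((3 / 5) ^ m * total_mass \<sigma>)"
    by (simp add: power_add)
  finally show ?thesis .
qed

text \<open>The factor (3/2) (1 - (3/5)^k) is the sum of (3/5)^l over 1 \<le> l \<le> k, the total
  of the bounds in \<open>side_sum_step\<close>.\<close>

lemma side_sum_bound:
  assumes \<sigma>: "\<sigma> \<in> words m" and s: "(i, j) \<in> sides"
  shows "\<bar>side_sum \<sigma> i j k - edge_value \<sigma> i j\<bar> \<le> (3 / 2) * (1 - (3 / 5) ^ k) * ((3 / 5) ^ m * total_mass \<sigma>)"
proof (induction k)
  case 0
  then show ?case by simp
next
  case (Suc k)
  define C where "C = (3 / 5) ^ m * total_mass \<sigma>"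
  have "\<bar>side_sum \<sigma> i j (Suc k) - edge_value \<sigma> i j\<bar>
    \<le> (3 / 5) ^ Suc k * C + (3 / 2) * (1 - (3 / 5) ^ k) * C"
    using side_sum_step[OF \<sigma> s, of k] Suc unfolding C_def[symmetric] by linarith
  also have "\<dots> = (3 / 2) * (1 - (3 / 5) ^ Suc k) * C"
    by (simp add: algebra_simps)
  finally show ?case unfolding C_def .
qed

lemma side_sum_convergent:
  assumes \<sigma>: "\<sigma> \<in> words m" and s: "(i, j) \<in> sides"
  shows "convergent (side_sum \<sigma> i j)"
proof -
  let ?d = "\<lambda>k. side_sum \<sigma> i j (Suc k) - side_sum \<sigma> i j k"
  have "summable (\<lambda>k. (3 / 5) ^ Suc k * ((3 / 5) ^ m * total_mass \<sigma>))"
    by (intro summable_mult2) (simp add: summable_geometric)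
  then have "summable ?d"
    by (rule summable_comparison_test'[where N = 0]) (simp only: real_norm_def side_sum_step[OF assms])
  then have "convergent (\<lambda>k. \<Sum>l<k. ?d l)" by (simp add: summable_iff_convergent)
  then have "convergent (\<lambda>k. side_sum \<sigma> i j k - side_sum \<sigma> i j 0)"
    by (simp only: sum_lessThan_telescope[of "side_sum \<sigma> i j"])
  then show ?thesis by (simp only: convergent_diff_const_right_iff)
qed

lemma subedges_represents_sum:
  assumes r': "represents n' f' g' \<omega>"
  shows "(\<Sum>(a, b)\<in>subedges l e. \<Sum>i<n'. f' i b * (g' i b - g' i a)) = (\<Sum>(a, b)\<in>subedges l e. \<omega> (b, a))"
proof (rule sum.cong[OF refl])
  fix x assume "x \<in> subedges l e"
  then obtain a b where x: "x = (a, b)" "(a, b) \<in> oriented_edges l" by (auto simp: subedges_def)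
  from x(2) obtain \<sigma> i j where *: "\<sigma> \<in> words l" "(i, j) \<in> sides" "(a, b) = (vertex \<sigma> i, vertex \<sigma> j)"
    by (rule oriented_edgesE)
  then have "a \<in> gasket" "b \<in> gasket" using vertex_in_gasket[OF *(1)] by (auto simp: sides_iff)
  then show "(case x of (a, b) \<Rightarrow> \<Sum>i<n'. f' i b * (g' i b - g' i a)) = (case x of (a, b) \<Rightarrow> \<omega> (b, a))"
    unfolding x(1) by (simp add: represents_apply[OF r'])
qed

lemma side_sum_lim:
  assumes \<sigma>: "\<sigma> \<in> words m" and s: "(i, j) \<in> sides"
  shows "side_sum \<sigma> i j \<longlonglongrightarrow> edge_integral (vertex \<sigma> i, vertex \<sigma> j) \<omega>"
proof -
  let ?e = "(vertex \<sigma> i, vertex \<sigma> j)"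
  obtain I where I: "side_sum \<sigma> i j \<longlonglongrightarrow> I"
    using side_sum_convergent[OF assms] by (auto simp: convergent_def)
  \<comment> \<open>\<open>edge_integral\<close> counts levels absolutely, \<open>side_sum\<close>
    relative to the level m of the edge; \<open>LIMSEQ_offset\<close> removes the shift.\<close>
  have "(\<lambda>k. \<Sum>(a, b)\<in>subedges (k + m) ?e. \<omega> (b, a)) = side_sum \<sigma> i j"
    using sum_subedges[OF assms, of "\<lambda>a b. \<omega> (b, a)"] by (simp only: add.commute)
  with I have "(\<lambda>k. \<Sum>(a, b)\<in>subedges (k + m) ?e. \<omega> (b, a)) \<longlonglongrightarrow> I"
    by (simp only:)
  then have lim: "(\<lambda>l. \<Sum>(a, b)\<in>subedges l ?e. \<omega> (b, a)) \<longlonglongrightarrow> I"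
    by (rule LIMSEQ_offset[where f = "\<lambda>l. \<Sum>(a, b)\<in>subedges l ?e. \<omega> (b, a)"])
  have "edge_integral ?e \<omega> = I"
    unfolding edge_integral_def
  proof (rule the_equality)
    show "\<exists>n f g. represents n f g \<omega> \<and> (\<lambda>l. \<Sum>(a, b)\<in>subedges l ?e. \<Sum>i<n. f i b * (g i b - g i a)) \<longlonglongrightarrow> I"
    proof (intro exI conjI)
      show "(\<lambda>l. \<Sum>(a, b)\<in>subedges l ?e. \<Sum>i<n. f i b * (g i b - g i a)) \<longlonglongrightarrow> I"
        using lim by (simp only: subedges_represents_sum[OF rep])
    qed (rule rep)
  next
    fix I' assume "\<exists>n f g. represents n f g \<omega> \<and>
      (\<lambda>l. \<Sum>(a, b)\<in>subedges l ?e. \<Sum>i<n. f i b * (g i b - g i a)) \<longlonglongrightarrow> I'"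
    then obtain n' f' g' where r': "represents n' f' g' \<omega>"
      and l': "(\<lambda>l. \<Sum>(a, b)\<in>subedges l ?e. \<Sum>i<n'. f' i b * (g' i b - g' i a)) \<longlonglongrightarrow> I'"
      by (elim exE conjE)
    from l' have "(\<lambda>l. \<Sum>(a, b)\<in>subedges l ?e. \<omega> (b, a)) \<longlonglongrightarrow> I'"
      by (simp only: subedges_represents_sum[OF r'])
    then show "I' = I" using lim by (rule LIMSEQ_unique)
  qed
  then show ?thesis using I by simp
qed

lemma edge_integral_error:
  assumes \<sigma>: "\<sigma> \<in> words m" and s: "(i, j) \<in> sides"
  shows "\<bar>edge_integral (vertex \<sigma> i, vertex \<sigma> j) \<omega> - edge_value \<sigma> i j\<bar> \<le> 3 / 2 * ((3 / 5) ^ m * total_mass \<sigma>)"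
proof (rule LIMSEQ_le_const2)
  show "(\<lambda>k. \<bar>side_sum \<sigma> i j k - edge_value \<sigma> i j\<bar>)
      \<longlonglongrightarrow> \<bar>edge_integral (vertex \<sigma> i, vertex \<sigma> j) \<omega> - edge_value \<sigma> i j\<bar>"
    by (intro tendsto_intros side_sum_lim[OF assms])
  have "\<bar>side_sum \<sigma> i j k - edge_value \<sigma> i j\<bar> \<le> 3 / 2 * ((3 / 5) ^ m * total_mass \<sigma>)" for k
  proof -
    have "(3 / 2) * (1 - (3 / 5) ^ k) * ((3 / 5) ^ m * total_mass \<sigma>) \<le> 3 / 2 * ((3 / 5) ^ m * total_mass \<sigma>)"
      using total_mass_nonneg[OF \<sigma>] by (intro mult_right_mono) simp_all
    then show ?thesis using side_sum_bound[OF assms, of k] by linarith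
  qed
  then show "\<exists>N. \<forall>k\<ge>N. \<bar>side_sum \<sigma> i j k - edge_value \<sigma> i j\<bar> \<le> 3 / 2 * ((3 / 5) ^ m * total_mass \<sigma>)"
    by blast
qed

text \<open>With vanishing integrals, \<open>edge_integral_error\<close> bounds the values on edges
  by (3/5)^m times the total mass of the cell. Their squares gain (3/5)^(2 m), of which the
  renormalisation (5/3)^m consumes only one half.\<close>

lemma Q_form_eq_0:
  assumes zero: "\<And>e. e \<in> all_oriented_edges \<Longrightarrow> edge_integral e \<omega> = 0"
  shows "Q_form \<omega> \<omega> = 0"
proof -
  define B where "B = total_mass []"
  have B: "0 \<le> B" unfolding B_def by (rule total_mass_nonneg[of _ 0]) simp
  \<comment> \<open>The constant 27/4 is 1/2 * 6 * (3/2)^2: the orientation factor, the six oriented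
    sides, and the squared constant of \<open>edge_integral_error\<close>.\<close>
  have bound: "edge_sum m (\<lambda>a b. \<omega> (b, a) * \<omega> (b, a)) \<le> (27 / 4 * B\<^sup>2) * (3 / 5) ^ m" for m
  proof -
    have cell: "cell_sum 0 \<sigma> (\<lambda>a b. \<omega> (b, a) * \<omega> (b, a)) \<le> 27 / 4 * (3 / 5) ^ m * B * total_mass \<sigma>"
      if \<sigma>: "\<sigma> \<in> words m" for \<sigma>
    proof -
      \<comment> \<open>One of the two factors \<open>total_mass \<sigma>\<close> is estimated by
        \<open>B\<close>; the other is kept, so that summation over the cells yields
        \<open>B\<close> again.\<close>
      have le: "total_mass \<sigma> \<le> B"
        unfolding B_def total_mass_split[of "[]" 0 m, simplified]
        by (rule member_le_sum) (use \<sigma> total_mass_nonneg in auto)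
      have "edge_value \<sigma> i j * edge_value \<sigma> i j \<le> (9 / 4) * ((3 / 5) ^ m)\<^sup>2 * (B * total_mass \<sigma>)"
        if s: "(i, j) \<in> sides" for i j
      proof -
        have "\<bar>edge_value \<sigma> i j\<bar> \<le> 3 / 2 * ((3 / 5) ^ m * total_mass \<sigma>)"
          using edge_integral_error[OF \<sigma> s] zero[OF all_oriented_edgesI[OF \<sigma> s]] by simp
        then have "\<bar>edge_value \<sigma> i j\<bar>\<^sup>2 \<le> (3 / 2 * ((3 / 5) ^ m * total_mass \<sigma>))\<^sup>2"
          by (rule power_mono) simp
        then have "edge_value \<sigma> i j * edge_value \<sigma> i j \<le> (9 / 4) * ((3 / 5) ^ m)\<^sup>2 * (total_mass \<sigma> * total_mass \<sigma>)"
          by (simp add: power2_eq_square algebra_simps)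
        also have "\<dots> \<le> (9 / 4) * ((3 / 5) ^ m)\<^sup>2 * (B * total_mass \<sigma>)"
          using le total_mass_nonneg[OF \<sigma>] by (intro mult_left_mono mult_right_mono) simp_all
        finally show ?thesis .
      qed
      then have "(\<Sum>(i, j)\<in>sides. edge_value \<sigma> i j * edge_value \<sigma> i j)
        \<le> of_nat (card sides) * ((9 / 4) * ((3 / 5) ^ m)\<^sup>2 * (B * total_mass \<sigma>))"
        by (intro sum_bounded_above) auto
      then have "cell_sum 0 \<sigma> (\<lambda>a b. \<omega> (b, a) * \<omega> (b, a))
        \<le> (5 / 3) ^ m * (1 / 2 * (6 * ((9 / 4) * ((3 / 5) ^ m)\<^sup>2 * (B * total_mass \<sigma>))))"
        unfolding cell_sum_0 length_words[OF \<sigma>] card_sides by (intro mult_left_mono) simp_all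
      also have "\<dots> = 27 / 4 * ((5 / 3) ^ m * (3 / 5) ^ m) * (3 / 5) ^ m * B * total_mass \<sigma>"
        by (simp add: power2_eq_square algebra_simps)
      also have "(5 / 3 :: real) ^ m * (3 / 5) ^ m = 1"
        unfolding power_mult_distrib[symmetric] by simp
      finally show ?thesis by simp
    qed
    have "edge_sum m (\<lambda>a b. \<omega> (b, a) * \<omega> (b, a)) = (\<Sum>\<sigma>\<in>words m. cell_sum 0 \<sigma> (\<lambda>a b. \<omega> (b, a) * \<omega> (b, a)))"
      using cell_sum_split[of m 0 "[]"] by simp
    also have "\<dots> \<le> (\<Sum>\<sigma>\<in>words m. 27 / 4 * (3 / 5) ^ m * B * total_mass \<sigma>)"
      by (rule sum_mono) (rule cell)
    also have "\<dots> = 27 / 4 * (3 / 5) ^ m * B * (\<Sum>\<sigma>\<in>words m. total_mass \<sigma>)"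
      by (simp only: sum_distrib_left)
    also have "(\<Sum>\<sigma>\<in>words m. total_mass \<sigma>) = B"
      unfolding B_def using total_mass_split[of "[]" 0 m] by simp
    finally show ?thesis by (simp add: power2_eq_square algebra_simps)
  qed
  have \<omega>: "\<omega> \<in> univ_forms" using rep by (rule represents_univ_forms)
  have "(\<lambda>m. (27 / 4 * B\<^sup>2) * (3 / 5) ^ m) \<longlonglongrightarrow> (27 / 4 * B\<^sup>2) * 0"
    by (intro tendsto_intros LIMSEQ_power_zero) simp
  then have "Q_form \<omega> \<omega> \<le> (27 / 4 * B\<^sup>2) * 0"
    by (rule LIMSEQ_le[OF Q_form_lim[OF \<omega> \<omega>]]) (use bound in blast)
  moreover have "0 \<le> Q_form \<omega> \<omega>" using psd_form.q_nonneg[OF psd_form_Q \<omega>] .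
  ultimately show ?thesis by simp
qed

text \<open>On a small cell, \<open>\<omega>\<close> is close to the exact form \<open>dG\<close>, \<open>G = \<Sum> f r b * g r\<close>. Energies of
  exact forms increase with the level, so \<open>Q = 0\<close> makes \<open>\<omega>\<close> small on the edges of the cell.\<close>

lemma edge_value_bound:
  assumes Q: "Q_form \<omega> \<omega> = 0" and \<sigma>: "\<sigma> \<in> words m" and s: "(i, j) \<in> sides"
  shows "\<bar>edge_value \<sigma> i j\<bar> \<le> sqrt (50 * real n) * (3 / 5) ^ m * total_mass \<sigma>"
proof -
  have \<omega>: "\<omega> \<in> univ_forms" using rep by (rule represents_univ_forms)
  have ij: "i \<in> letters" "j \<in> letters" using s by (simp_all add: sides_iff)
  define b where "b = vertex \<sigma> j"
  \<comment> \<open>Freezing each f r at the target b makes dG agree exactly with \<omega> on the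
    edge in question, and elsewhere in the cell up to the oscillation of the f r.\<close>
  define G where "G = (\<Sum>r<n. f r b *\<^sub>R g r)"
  have G: "G \<in> finite_energy"
    unfolding G_def
    by (intro subspace_sum[OF subspace_finite_energy] finite_energy_scale) (simp add: rep_finite_energy)
  have G_diff: "G y - G x = (\<Sum>r<n. f r b * (g r y - g r x))" for x y
    by (simp add: G_def sum_fun_apply right_diff_distrib sum_subtractf)
  \<comment> \<open>The factor 25 is the square of the constant 5 in
    \<open>cell_oscillation\<close>.\<close>
  define C where "C r = 25 * ((3 / 5) ^ m * mass (f r) \<sigma>)" for r
  have osc: "(f r (vertex (\<sigma> @ \<tau>) l) - f r b)\<^sup>2 \<le> C r"
    if "r < n" "\<tau> \<in> words k" "l \<in> letters" for r \<tau> k l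
  proof -
    have F: "f r \<in> finite_energy" using rep_finite_energy that by blast
    have "\<bar>f r (vertex (\<sigma> @ \<tau>) l) - f r b\<bar>\<^sup>2 \<le> (5 * sqrt ((3 / 5) ^ m * mass (f r) \<sigma>))\<^sup>2"
      unfolding b_def by (intro power_mono cell_oscillation[OF F \<sigma> that(2,3) ij(2)]) simp
    also have "\<dots> = C r"
      using mass_nonneg[OF F \<sigma>] by (simp add: C_def power_mult_distrib)
    finally show ?thesis by simp
  qed
  have C: "0 \<le> C r" if "r < n" for r
    using mass_nonneg[OF rep_finite_energy(1)[OF that] \<sigma>] by (simp add: C_def)
  \<comment> \<open>The factors 2 come from (x - y)^2 \<le> 2 x^2 + 2 y^2, the factor n from
    Cauchy-Schwarz for the n summands of dG - \<omega>. The squares of \<omega> in the cell are part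
    of the global sum, which tends to Q = 0; this is the summand 2 * 0. With the 25 in
    \<open>C\<close> the final constant 50 n arises.\<close>
  have "mass G \<sigma> \<le> 2 * 0 + 2 * real n * (\<Sum>r<n. C r * mass (g r) \<sigma>)"
  proof (rule LIMSEQ_le[OF mass_lim[OF G \<sigma>]])
    have "(\<lambda>k. edge_sum (m + k) (\<lambda>a b. \<omega> (b, a) * \<omega> (b, a))) \<longlonglongrightarrow> 0"
      using LIMSEQ_ignore_initial_segment[OF Q_form_lim[OF \<omega> \<omega>], of m] Q by (simp only: add.commute)
    then show "(\<lambda>k. 2 * edge_sum (m + k) (\<lambda>a b. \<omega> (b, a) * \<omega> (b, a)) + 2 * real n * (\<Sum>r<n. C r * mass (g r) \<sigma>))
        \<longlonglongrightarrow> 2 * 0 + 2 * real n * (\<Sum>r<n. C r * mass (g r) \<sigma>)"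
      by (intro tendsto_intros)
    have "cell_sum k \<sigma> (diff_sq G)
        \<le> 2 * edge_sum (m + k) (\<lambda>a b. \<omega> (b, a) * \<omega> (b, a)) + 2 * real n * (\<Sum>r<n. C r * mass (g r) \<sigma>)" for k
    proof -
      have "cell_sum k \<sigma> (diff_sq G)
        \<le> cell_sum k \<sigma> (\<lambda>x y. 2 * (\<omega> (y, x) * \<omega> (y, x)) + 2 * real n * (\<Sum>r<n. C r * diff_sq (g r) x y))"
      proof (rule cell_sum_mono)
        fix \<tau> p q assume \<tau>: "\<tau> \<in> words k" and pq: "(p, q) \<in> sides"
        define x y where "x = vertex (\<sigma> @ \<tau>) p" and "y = vertex (\<sigma> @ \<tau>) q"
        have xy: "x \<in> gasket" "y \<in> gasket"
          unfolding x_def y_def using vertex_in_gasket[OF words_append[OF \<sigma> \<tau>]] pq by (auto simp: sides_iff)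
        define R where "R = (\<Sum>r<n. (f r y - f r b) * (g r y - g r x))"
        have G_eq: "G y - G x = \<omega> (y, x) - R"
          unfolding G_diff represents_apply[OF rep xy] R_def
          by (simp add: algebra_simps flip: sum.distrib sum_subtractf)
        have "diff_sq G x y \<le> 2 * (\<omega> (y, x) * \<omega> (y, x)) + 2 * R\<^sup>2"
          unfolding G_eq using zero_le_power2[of "\<omega> (y, x) + R"] by (simp add: power2_eq_square algebra_simps)
        also have "R\<^sup>2 \<le> real n * (\<Sum>r<n. ((f r y - f r b) * (g r y - g r x))\<^sup>2)"
          unfolding R_def using sum_squared_le_sum_of_squares[of "\<lambda>r. (f r y - f r b) * (g r y - g r x)" "{..<n}"]
          by (simp add: mult.commute)
        also have "(\<Sum>r<n. ((f r y - f r b) * (g r y - g r x))\<^sup>2) \<le> (\<Sum>r<n. C r * diff_sq (g r) x y)"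
        proof (rule sum_mono)
          fix r assume "r \<in> {..<n}"
          then have "(f r y - f r b)\<^sup>2 \<le> C r"
            unfolding y_def using osc[OF _ \<tau>] pq by (simp add: sides_iff)
          then show "((f r y - f r b) * (g r y - g r x))\<^sup>2 \<le> C r * diff_sq (g r) x y"
            unfolding power_mult_distrib by (rule mult_right_mono) simp
        qed
        finally have "diff_sq G x y \<le> 2 * (\<omega> (y, x) * \<omega> (y, x)) + 2 * (real n * (\<Sum>r<n. C r * diff_sq (g r) x y))"
          by (simp add: mult_left_mono)
        then show "diff_sq G (vertex (\<sigma> @ \<tau>) p) (vertex (\<sigma> @ \<tau>) q)
          \<le> 2 * (\<omega> (vertex (\<sigma> @ \<tau>) q, vertex (\<sigma> @ \<tau>) p) * \<omega> (vertex (\<sigma> @ \<tau>) q, vertex (\<sigma> @ \<tau>) p))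
            + 2 * real n * (\<Sum>r<n. C r * diff_sq (g r) (vertex (\<sigma> @ \<tau>) p) (vertex (\<sigma> @ \<tau>) q))"
          unfolding x_def y_def by (simp only: mult.assoc)
      qed
      also have "\<dots> = 2 * cell_sum k \<sigma> (\<lambda>x y. \<omega> (y, x) * \<omega> (y, x))
          + 2 * real n * (\<Sum>r<n. C r * cell_sum k \<sigma> (diff_sq (g r)))"
        by (simp only: cell_sum_add cell_sum_mult cell_sum_sum)
      also have "\<dots> \<le> 2 * edge_sum (m + k) (\<lambda>a b. \<omega> (b, a) * \<omega> (b, a)) + 2 * real n * (\<Sum>r<n. C r * mass (g r) \<sigma>)"
      proof (intro add_mono mult_left_mono sum_mono)
        show "cell_sum k \<sigma> (\<lambda>x y. \<omega> (y, x) * \<omega> (y, x)) \<le> edge_sum (m + k) (\<lambda>a b. \<omega> (b, a) * \<omega> (b, a))"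
          unfolding cell_sum_split append_Nil
          by (rule member_le_sum[OF \<sigma>]) (auto intro: cell_sum_nonneg)
        fix r assume "r \<in> {..<n}"
        then have r: "r < n" by simp
        show "cell_sum k \<sigma> (diff_sq (g r)) \<le> mass (g r) \<sigma>"
          by (rule cell_sum_le_mass[OF rep_finite_energy(2)[OF r] \<sigma>])
        show "0 \<le> C r" by (rule C[OF r])
      qed simp_all
      finally show ?thesis .
    qed
    then show "\<exists>N. \<forall>k\<ge>N. cell_sum k \<sigma> (diff_sq G)
        \<le> 2 * edge_sum (m + k) (\<lambda>a b. \<omega> (b, a) * \<omega> (b, a)) + 2 * real n * (\<Sum>r<n. C r * mass (g r) \<sigma>)"
      by blast
  qed
  moreover have "(\<Sum>r<n. C r * mass (g r) \<sigma>) \<le> 25 * (3 / 5) ^ m * (total_mass \<sigma>)\<^sup>2"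
  proof -
    have "mass (f r) \<sigma> * mass (g r) \<sigma> \<le> (mass (f r) \<sigma> + mass (g r) \<sigma>) * total_mass \<sigma>" if "r < n" for r
    proof (rule mult_mono)
      have nonneg: "0 \<le> mass (f r) \<sigma>" "0 \<le> mass (g r) \<sigma>" if "r < n" for r
        using that by (auto intro!: mass_nonneg[OF _ \<sigma>] rep_finite_energy)
      show "mass (f r) \<sigma> \<le> mass (f r) \<sigma> + mass (g r) \<sigma>" "0 \<le> mass (f r) \<sigma> + mass (g r) \<sigma>" "0 \<le> mass (g r) \<sigma>"
        using nonneg[OF that] by simp_all
      have "mass (f r) \<sigma> + mass (g r) \<sigma> \<le> total_mass \<sigma>"
        unfolding total_mass_def
        by (rule member_le_sum[of r "{..<n}" "\<lambda>r. mass (f r) \<sigma> + mass (g r) \<sigma>"]) (use that nonneg in auto)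
      then show "mass (g r) \<sigma> \<le> total_mass \<sigma>" using nonneg[OF that] by simp
    qed
    then have "(\<Sum>r<n. mass (f r) \<sigma> * mass (g r) \<sigma>) \<le> (\<Sum>r<n. (mass (f r) \<sigma> + mass (g r) \<sigma>) * total_mass \<sigma>)"
      by (intro sum_mono) simp
    also have "\<dots> = (total_mass \<sigma>)\<^sup>2"
      by (simp only: sum_distrib_right[symmetric] power2_eq_square total_mass_def)
    finally have le: "(\<Sum>r<n. mass (f r) \<sigma> * mass (g r) \<sigma>) \<le> (total_mass \<sigma>)\<^sup>2" .
    have "(\<Sum>r<n. C r * mass (g r) \<sigma>) = 25 * (3 / 5) ^ m * (\<Sum>r<n. mass (f r) \<sigma> * mass (g r) \<sigma>)"
      by (simp add: C_def sum_distrib_left mult.assoc)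
    also have "\<dots> \<le> 25 * (3 / 5) ^ m * (total_mass \<sigma>)\<^sup>2"
      by (intro mult_left_mono le) simp
    finally show ?thesis .
  qed
  then have "2 * real n * (\<Sum>r<n. C r * mass (g r) \<sigma>) \<le> 2 * real n * (25 * (3 / 5) ^ m * (total_mass \<sigma>)\<^sup>2)"
    by (rule mult_left_mono) simp
  ultimately have "mass G \<sigma> \<le> 2 * real n * (25 * (3 / 5) ^ m * (total_mass \<sigma>)\<^sup>2)"
    by linarith
  then have G_mass: "(3 / 5) ^ m * mass G \<sigma> \<le> (3 / 5) ^ m * (2 * real n * (25 * (3 / 5) ^ m * (total_mass \<sigma>)\<^sup>2))"
    by (rule mult_left_mono) simp
  have edge_G: "edge_value \<sigma> i j = G (vertex \<sigma> j) - G (vertex \<sigma> i)"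
    unfolding G_diff represents_apply[OF rep vertex_in_gasket[OF \<sigma> ij(1)] vertex_in_gasket[OF \<sigma> ij(2)]] b_def ..
  have "(edge_value \<sigma> i j)\<^sup>2 \<le> (3 / 5) ^ m * (2 * real n * (25 * (3 / 5) ^ m * (total_mass \<sigma>)\<^sup>2))"
    unfolding edge_G by (rule order_trans[OF edge_diff_sq_le_mass[OF G \<sigma> s] G_mass])
  also have "\<dots> = (sqrt (50 * real n) * (3 / 5) ^ m * total_mass \<sigma>)\<^sup>2"
    by (simp add: power2_eq_square algebra_simps)
  finally have "\<bar>edge_value \<sigma> i j\<bar> \<le> \<bar>sqrt (50 * real n) * (3 / 5) ^ m * total_mass \<sigma>\<bar>"
    by (simp only: abs_le_square_iff)
  then show ?thesis using total_mass_nonneg[OF \<sigma>] by (simp add: abs_mult)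
qed

text \<open>\<open>edge_value_bound\<close> holds at every level and is linear in
  \<open>total_mass\<close>, so the sum over the 2^k subedges is at most a constant times
  (3/5)^k.\<close>

lemma edge_integral_eq_0:
  assumes Q: "Q_form \<omega> \<omega> = 0" and e: "e \<in> all_oriented_edges"
  shows "edge_integral e \<omega> = 0"
proof -
  obtain \<sigma> i j where \<sigma>: "\<sigma> \<in> words (length \<sigma>)" and s: "(i, j) \<in> sides" and e: "e = (vertex \<sigma> i, vertex \<sigma> j)"
    using e by (rule all_oriented_edgesE)
  define m where "m = length \<sigma>"
  have \<sigma>: "\<sigma> \<in> words m" using \<sigma> by (simp add: m_def)
  define K where "K = sqrt (50 * real n)"
  have bound: "\<bar>side_sum \<sigma> i j k\<bar> \<le> (K * (3 / 5) ^ m * total_mass \<sigma>) * (3 / 5) ^ k" for k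
  proof -
    have "\<bar>side_sum \<sigma> i j k\<bar> \<le> (\<Sum>v\<in>side_words i j k. K * (3 / 5) ^ (m + k) * total_mass (\<sigma> @ v))"
    proof (rule order_trans[OF sum_abs sum_mono])
      fix v assume "v \<in> side_words i j k"
      then have "\<sigma> @ v \<in> words (m + k)" using side_words_subset[OF s] words_append[OF \<sigma>] by blast
      then show "\<bar>edge_value (\<sigma> @ v) i j\<bar> \<le> K * (3 / 5) ^ (m + k) * total_mass (\<sigma> @ v)"
        unfolding K_def by (rule edge_value_bound[OF Q _ s])
    qed
    also have "\<dots> = K * (3 / 5) ^ (m + k) * (\<Sum>v\<in>side_words i j k. total_mass (\<sigma> @ v))"
      by (rule sum_distrib_left[symmetric])
    also have "\<dots> \<le> K * (3 / 5) ^ (m + k) * total_mass \<sigma>"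
      by (rule mult_left_mono[OF sum_side_words_total_mass_le[OF \<sigma> s]]) (simp add: K_def)
    finally show ?thesis by (simp add: power_add mult_ac)
  qed
  have "(\<lambda>k. (K * (3 / 5) ^ m * total_mass \<sigma>) * (3 / 5) ^ k) \<longlonglongrightarrow> (K * (3 / 5) ^ m * total_mass \<sigma>) * 0"
    by (intro tendsto_intros LIMSEQ_power_zero) simp
  then have "side_sum \<sigma> i j \<longlonglongrightarrow> 0"
    by (intro Lim_null_comparison[of "side_sum \<sigma> i j"]) (use bound in simp_all)
  then show ?thesis
    unfolding e using side_sum_lim[OF \<sigma> s] LIMSEQ_unique by blast
qed

end

lemma edge_integrals_zero_iff:
  assumes "\<omega> \<in> univ_forms"
  shows "(\<forall>e\<in>all_oriented_edges. edge_integral e \<omega> = 0) \<longleftrightarrow> Q_form \<omega> \<omega> = 0"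
proof -
  obtain n f g where r: "represents n f g \<omega>" using univ_forms_represents[OF assms] .
  show ?thesis using Q_form_eq_0[OF r] edge_integral_eq_0[OF r] by blast
qed

text \<open>The description defining \<open>edge_integral\<close> does not show linearity, but the
  sums in \<open>side_sum_lim\<close> are linear in \<omega>.\<close>

lemma edge_integral_diff:
  assumes "\<omega> \<in> univ_forms" "\<eta> \<in> univ_forms" "e \<in> all_oriented_edges"
  shows "edge_integral e (\<omega> - \<eta>) = edge_integral e \<omega> - edge_integral e \<eta>"
proof -
  obtain \<sigma> i j where \<sigma>: "\<sigma> \<in> words (length \<sigma>)" and s: "(i, j) \<in> sides" and e: "e = (vertex \<sigma> i, vertex \<sigma> j)"
    using assms(3) by (rule all_oriented_edgesE)
  let ?S = "\<lambda>\<omega> k. \<Sum>v\<in>side_words i j k. \<omega> (vertex (\<sigma> @ v) j, vertex (\<sigma> @ v) i)"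
  have lim: "?S \<omega> \<longlonglongrightarrow> edge_integral e \<omega>" if "\<omega> \<in> univ_forms" for \<omega>
  proof -
    obtain n f g where r: "represents n f g \<omega>" using univ_forms_represents[OF \<open>\<omega> \<in> univ_forms\<close>] .
    show ?thesis unfolding e by (rule side_sum_lim[OF r \<sigma> s])
  qed
  have "(\<lambda>k. ?S \<omega> k - ?S \<eta> k) \<longlonglongrightarrow> edge_integral e \<omega> - edge_integral e \<eta>"
    by (intro tendsto_diff lim assms)
  moreover have "?S (\<omega> - \<eta>) \<longlonglongrightarrow> edge_integral e (\<omega> - \<eta>)"
    by (intro lim subspace_diff[OF subspace_univ_forms] assms)
  ultimately show ?thesis by (simp add: sum_subtractf LIMSEQ_unique)
qed

section \<open>Smooth 1-forms\<close>

text \<open>This is \<open>edge_integrals_zero_iff\<close> for differences of forms. It identifies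
  the smooth 1-forms with the separation of \<open>Q_form\<close>, and the assertions on norm,
  embedding and density become instances of the abstract ones.\<close>

lemma smooth_rel_eq_null_rel: "smooth_rel = null_rel univ_forms Q_form"
  unfolding smooth_rel_def null_rel_def
  using edge_integrals_zero_iff subspace_diff[OF subspace_univ_forms] by blast

interpretation Q: psd_form univ_forms Q_form
  by (rule psd_form_Q)

lemma smooth_Q_eq_quot_form: "smooth_Q X Y = Q.quot_form X Y"
  by (simp only: smooth_Q_def Q.quot_form_def)

lemma smooth_edge_integral_class:
  assumes \<omega>: "\<omega> \<in> univ_forms" and e: "e \<in> all_oriented_edges"
  shows "smooth_edge_integral e (smooth_rel `` {\<omega>}) = edge_integral e \<omega>"
proof -
  have "edge_integral e \<eta> = edge_integral e \<omega>" if "\<eta> \<in> smooth_rel `` {\<omega>}" for \<eta>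
    using that e edge_integral_diff[of \<omega> \<eta> e] by (auto simp: smooth_rel_def)
  moreover have "\<omega> \<in> smooth_rel `` {\<omega>}"
    unfolding smooth_rel_eq_null_rel by (rule equiv_class_self[OF Q.equiv_null_rel \<omega>])
  ultimately show ?thesis unfolding smooth_edge_integral_def by (intro the_equality) blast+
qed

lemma smooth_forms_eq: "smooth_forms = univ_forms // null_rel univ_forms Q_form"
  by (simp only: smooth_forms_def smooth_rel_eq_null_rel)

lemma smooth_edge_integrals_zero_iff:
  assumes "X \<in> smooth_forms"
  shows "(\<forall>e\<in>all_oriented_edges. smooth_edge_integral e X = 0) \<longleftrightarrow> smooth_Q X X = 0"
proof -
  obtain \<omega> where \<omega>: "\<omega> \<in> univ_forms" "X = smooth_rel `` {\<omega>}"
    using assms by (auto simp: smooth_forms_def elim: quotientE)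
  have "smooth_Q X X = Q_form \<omega> \<omega>"
    unfolding \<omega>(2) smooth_Q_eq_quot_form smooth_rel_eq_null_rel by (rule Q.quot_form_class[OF \<omega>(1,1)])
  then show ?thesis
    using edge_integrals_zero_iff[OF \<omega>(1)] smooth_edge_integral_class[OF \<omega>(1)] \<omega>(2) by simp
qed

theorem theorem2p24:
  shows
    "(\<forall>X\<in>smooth_forms.
        (\<forall>e\<in>all_oriented_edges. smooth_edge_integral e X = 0) \<longleftrightarrow> smooth_Q X X = 0) \<and>
     norm_on_quotient univ_forms smooth_rel (\<lambda>X. sqrt (smooth_Q X X)) \<and>
     (\<forall>\<omega>\<in>univ_forms.
        (\<forall>e\<in>all_oriented_edges. edge_integral e \<omega> = 0) \<longleftrightarrow> Q_form \<omega> \<omega> = 0) \<and>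
     smooth_forms = univ_forms // null_rel univ_forms Q_form \<and>
     embed_form ` smooth_forms \<subseteq> form_space \<and>
     inj_on embed_form smooth_forms \<and>
     (\<forall>X\<in>smooth_forms. \<forall>Y\<in>smooth_forms.
        embed_form (quot_add smooth_rel X Y) =
          quot_add form_space_rel (embed_form X) (embed_form Y)) \<and>
     (\<forall>X\<in>smooth_forms. \<forall>c.
        embed_form (quot_scale smooth_rel c X) = quot_scale form_space_rel c (embed_form X)) \<and>
     (\<forall>X\<in>smooth_forms. form_norm (embed_form X) = sqrt (smooth_Q X X)) \<and>
     (\<forall>Z\<in>form_space. \<forall>\<epsilon>>0. \<exists>X\<in>smooth_forms.
        form_norm (form_space_diff Z (embed_form X)) < \<epsilon>)"
proof (intro conjI ballI allI impI)
  show "norm_on_quotient univ_forms smooth_rel (\<lambda>X. sqrt (smooth_Q X X))"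
    unfolding smooth_rel_eq_null_rel smooth_Q_eq_quot_form by (rule Q.norm_on_quotient_null_rel)
  show "smooth_forms = univ_forms // null_rel univ_forms Q_form"
    by (rule smooth_forms_eq)
  show "embed_form ` smooth_forms \<subseteq> form_space"
    unfolding smooth_forms_eq by (rule Q.completion_embed_mem)
  show "inj_on embed_form smooth_forms"
    unfolding smooth_forms_eq by (rule Q.inj_completion_embed)
next
  fix X assume X: "X \<in> smooth_forms"
  show "(\<forall>e\<in>all_oriented_edges. smooth_edge_integral e X = 0) \<longleftrightarrow> smooth_Q X X = 0"
    by (rule smooth_edge_integrals_zero_iff[OF X])
  show "form_norm (embed_form X) = sqrt (smooth_Q X X)"
    using X unfolding smooth_forms_eq smooth_Q_eq_quot_form by (rule Q.completion_norm_embed)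
  show "embed_form (quot_scale smooth_rel c X) = quot_scale form_space_rel c (embed_form X)" for c
    using X unfolding smooth_forms_eq smooth_rel_eq_null_rel by (rule Q.completion_embed_scale)
  fix Y assume Y: "Y \<in> smooth_forms"
  show "embed_form (quot_add smooth_rel X Y) = quot_add form_space_rel (embed_form X) (embed_form Y)"
    using X Y unfolding smooth_forms_eq smooth_rel_eq_null_rel by (rule Q.completion_embed_add)
next
  fix \<omega> assume "\<omega> \<in> univ_forms"
  then show "(\<forall>e\<in>all_oriented_edges. edge_integral e \<omega> = 0) \<longleftrightarrow> Q_form \<omega> \<omega> = 0"
    by (rule edge_integrals_zero_iff)
next
  fix Z and \<epsilon> :: real assume "Z \<in> form_space" "0 < \<epsilon>"
  then show "\<exists>X\<in>smooth_forms. form_norm (form_space_diff Z (embed_form X)) < \<epsilon>"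
    unfolding smooth_forms_eq by (rule Q.completion_embed_dense)
qed

end
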